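(* Let $\alpha=3/2$, $\rho\in(0,1)$, $c^+,c^-\ge0$ with $c^++c^->0$, and $m\in\mathbb R$. The set of stationary energy solutions of the fractional Burgers equation $$d\mathcal Y_t=(\mathcal L^\rho)^*\mathcal Y_t\,dt+m\nabla\mathcal Y_t^2\,dt+\sqrt{2\rho(1-\rho)(-\mathcal L^{1/2})}\,d\mathcal W_t$$ is invariant under the space-time renormalization group of exponents $1:2:3$. That is, if $\{\mathcal Y_t;t\ge0\}$ is a stationary energy solution and $\varepsilon>0$, then the process $\{\mathcal Y^\varepsilon_t;t\ge0\}$ formally given by $\mathcal Y^\varepsilon_t(x)=\varepsilon^{-1/2}\mathcal Y_{t/\varepsilon^{3/2}}(x/\varepsilon)$, i.e. $\mathcal Y^\varepsilon_t(f)=\varepsilon^{1/2}\,\mathcal Y_{t/\varepsilon^{3/2}}(f(\varepsilon\,\cdot))$ for $f\in\mathbb S(\mathbb R)$, is also a stationary energy solution of the same equation.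
   Context: $\mathbb S(\mathbb R)$ is the Schwartz space, $\mathbb S'(\mathbb R)$ its dual; $\|\cdot\|$, $\langle\cdot,\cdot\rangle$ are the norm and inner product of $L^2(\mathbb R)$. $\mathcal W$ is an $\mathbb S'(\mathbb R)$-valued Brownian motion (each $\mathcal W_t(f)$ is a Brownian motion of variance $\|f\|^2$). A process indexed by $t\ge0$ is a stationary energy solution if it is one on $[0,T]$, in the sense below, for every $T>0$. Operator ($\alpha=3/2$): $\mathcal L^\rho f(x)=\int_{\mathbb R}\frac{c_\rho(y)}{|y|^{1+\alpha}}\big(f(x+y)-f(x)-yf'(x)\big)dy$, where $c_\rho(y)=c^+(1-\rho)+c^-\rho$ for $y\ge0$ and $c_\rho(y)=c^+\rho+c^-(1-\rho)$ for $y<0$. Its adjoint in $L^2(\mathbb R)$ is $\mathcal L^{1-\rho}$ and its symmetric part is $\mathcal L^{1/2}$. It maps $\mathbb S(\mathbb R)$ continuously into $L^2(\mathbb R)$. USC: an $\mathbb S'(\mathbb R)$-valued process $\{\mathcal Y_t;t\in[0,T]\}$ is uniformly stochastically continuous in $L^2(\mathbb R)$ (USC) if there is $K_0<\infty$ with $E[\mathcal Y_t(f)^2]\le K_0\|f\|^2$ for all $f\in\mathbb S(\mathbb R)$, $t\in[0,T]$. Then $\mathcal Y_t(g)$ extends by continuity to $g\in L^2(\mathbb R)$, and for differentiable $f:[0,T]\to\mathbb S(\mathbb R)$ one sets $\int_0^t\mathcal Y_s(\mathcal L^\rho f_s)ds:=\lim_{\varepsilon\to0}\int_0^t\mathcal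 Y_s(\psi_\varepsilon\mathcal L^\rho f_s)ds$, $\psi_\varepsilon(x)=e^{-\varepsilon^2x^2}$. Energy estimate (EE): let $\{\iota_\varepsilon;\varepsilon\in(0,1)\}$ be an approximation of the identity, in general $\iota_\varepsilon(x)=\frac1\varepsilon h(\frac x\varepsilon)$ with $h\in\mathbb S(\mathbb R)$ positive and $\int_{\mathbb R}h(x)dx=1$; if the process is USC, $h$ can even be in $L^2(\mathbb R)\cap L^1(\mathbb R)$. Write $\mathcal Y_s*\iota_\varepsilon(x)=\mathcal Y_s(\iota_\varepsilon(\cdot-x))$ and, for $0\le s<t\le T$, $f\in\mathbb S(\mathbb R)$, $\mathcal A^\varepsilon_{s,t}(f)=\int_s^t\int_{\mathbb R}(\mathcal Y_{s'}*\iota_\varepsilon(x))^2f'(x)\,dx\,ds'$. The process satisfies (EE) on $[0,T]$ if there are $\kappa_0>0$ and $\beta\in(0,1)$ such that $E[(\mathcal A^\varepsilon_{s,t}(f)-\mathcal A^\delta_{s,t}(f))^2]\le\kappa_0\,\varepsilon\,(t-s)^{\beta}\|f'\|^2$ for all $f\in\mathbb S(\mathbb R)$, $0<\delta<\varepsilon<1$, $0\le s<t\le T$. Under (EE) the limit $\mathcal A_{s,t}(f)=\lim_{\varepsilon\to0}\mathcal A_{s,t}^\varepsilon(f)$ exists in $L^2(P)$, and for a USC process satisfying (EE) there is an $\mathbb S'(\mathbb R)$-valued process $\{\mathcal A_t;t\in[0,T]\}$ with continuous trajectories such that $\mathcal A_{s,t}(f)=\mathcal A_t(f)-\mathcal A_s(f)$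 a.s. For a trajectory $f:[0,T]\to\mathbb S(\mathbb R)$, $\mathcal A_t(f)$ is the corresponding limit with $f'(x)$ replaced by $f'_s(x)$ at time $s$. Stationary energy solution on $[0,T]$: an $\mathbb S'(\mathbb R)$-valued process $\{\mathcal Y_t;t\in[0,T]\}$ such that (a) it is USC and satisfies (EE); (b) for every differentiable trajectory $f:[0,T]\to\mathbb S(\mathbb R)$ the process $\mathcal Y_t(f_t)-\mathcal Y_0(f_0)-\int_0^t\mathcal Y_s((\partial_s+\mathcal L^\rho)f_s)ds+m\mathcal A_t(f)$ is a continuous martingale of quadratic variation $2\rho(1-\rho)\int_0^t\langle f_s,-\mathcal L^{1/2}f_s\rangle ds$; (c) for each $t$, $\mathcal Y_t$ is a white noise of variance $\rho(1-\rho)$, i.e. $\mathcal Y_t(f)$ is centered Gaussian with variance $\rho(1-\rho)\|f\|^2$ for each $f\in\mathbb S(\mathbb R)$. *)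

theory Defs
  imports "HOL-Probability.Probability"
begin

subsection \<open>Schwartz functions and tempered distributions\<close>

text \<open>Test functions are real valued. A distribution is modelled as a functional on all functions
  \<open>real \<Rightarrow> real\<close>, whose values are only ever meaningful on the Schwartz functions.\<close>

definition schwartz :: "(real \<Rightarrow> real) \<Rightarrow> bool" where
  "schwartz f \<longleftrightarrow>
     (\<forall>n x. (deriv ^^ n) f field_differentiable (at x)) \<and>
     (\<forall>k n. bounded (range (\<lambda>x. x ^ k * (deriv ^^ n) f x)))"

definition schwartz_seminorm :: "nat \<Rightarrow> nat \<Rightarrow> (real \<Rightarrow> real) \<Rightarrow> real" where
  "schwartz_seminorm k n f = (SUP x. \<bar>x ^ k * (deriv ^^ n) f x\<bar>)"

text \<open>The last clause is continuity for the locally convex topology of the seminorms.\<close>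

definition tempered_distribution :: "((real \<Rightarrow> real) \<Rightarrow> real) \<Rightarrow> bool" where
  "tempered_distribution \<Lambda> \<longleftrightarrow>
     (\<forall>f g. schwartz f \<longrightarrow> schwartz g \<longrightarrow> \<Lambda> (\<lambda>x. f x + g x) = \<Lambda> f + \<Lambda> g) \<and>
     (\<forall>f c. schwartz f \<longrightarrow> \<Lambda> (\<lambda>x. c * f x) = c * \<Lambda> f) \<and>
     (\<forall>f. schwartz f \<longrightarrow> (\<forall>e>0. \<exists>N. \<exists>d>0. \<forall>g. schwartz g \<longrightarrow>
        (\<forall>k\<le>N. \<forall>n\<le>N. schwartz_seminorm k n (\<lambda>x. g x - f x) < d) \<longrightarrow> \<bar>\<Lambda> g - \<Lambda> f\<bar> < e))"

definition L2_norm_sq :: "(real \<Rightarrow> real) \<Rightarrow> real" where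
  "L2_norm_sq f = (LBINT x. (f x)\<^sup>2)"

definition L2_inner :: "(real \<Rightarrow> real) \<Rightarrow> (real \<Rightarrow> real) \<Rightarrow> real" where
  "L2_inner f g = (LBINT x. f x * g x)"

text \<open>\<open>schwartz_trajectory T f f'\<close>: \<open>f\<close> is a trajectory from \<open>[0,T]\<close> to the Schwartz space,
  differentiable in its topology with derivative \<open>f'\<close> (one-sided at the end points). Integrability
  of the derivative (automatic if it is continuous) is what gives a meaning to the time integral
  of a process tested against \<open>f'\<close>.\<close>

definition schwartz_trajectory ::
    "real \<Rightarrow> (real \<Rightarrow> real \<Rightarrow> real) \<Rightarrow> (real \<Rightarrow> real \<Rightarrow> real) \<Rightarrow> bool" where
  "schwartz_trajectory T f f' \<longleftrightarrow>
     (\<forall>t\<in>{0..T}. schwartz (f t) \<and> schwartz (f' t)) \<and>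
     (\<forall>t\<in>{0..T}. \<forall>k n.
        ((\<lambda>s. schwartz_seminorm k n (\<lambda>x. (f s x - f t x) / (s - t) - f' t x)) \<longlongrightarrow> 0)
          (at t within {0..T})) \<and>
     (\<forall>k n. set_integrable lborel {0..T} (\<lambda>s. schwartz_seminorm k n (f' s)))"

subsection \<open>The operator\<close>

definition jump_coeff :: "real \<Rightarrow> real \<Rightarrow> real \<Rightarrow> real \<Rightarrow> real" where
  "jump_coeff cp cm \<rho> y =
     (if y \<ge> 0 then cp * (1 - \<rho>) + cm * \<rho> else cp * \<rho> + cm * (1 - \<rho>))"

definition levy_op :: "real \<Rightarrow> real \<Rightarrow> real \<Rightarrow> real \<Rightarrow> (real \<Rightarrow> real) \<Rightarrow> real \<Rightarrow> real" where
  "levy_op \<alpha> cp cm \<rho> f x =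
     (LBINT y. jump_coeff cp cm \<rho> y / \<bar>y\<bar> powr (1 + \<alpha>) * (f (x + y) - f x - y * deriv f x))"

definition gauss_cutoff :: "real \<Rightarrow> real \<Rightarrow> real" where
  "gauss_cutoff \<epsilon> x = exp (- (\<epsilon>\<^sup>2 * x\<^sup>2))"

subsection \<open>Processes\<close>

definition L2_lim :: "'w measure \<Rightarrow> ('i \<Rightarrow> 'w \<Rightarrow> real) \<Rightarrow> ('w \<Rightarrow> real) \<Rightarrow> 'i filter \<Rightarrow> bool" where
  "L2_lim M X Z F \<longleftrightarrow> Z \<in> borel_measurable M \<and>
     ((\<lambda>i. \<integral>\<^sup>+\<omega>. ennreal ((X i \<omega> - Z \<omega>)\<^sup>2) \<partial>M) \<longlongrightarrow> 0) F"

text \<open>\<open>Y t \<omega> f\<close> is the value of the distribution \<open>Y t \<omega>\<close> at \<open>f\<close>. Joint measurability in time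
  and chance is required for the time integrals of the process to be random variables.\<close>

definition distribution_process ::
    "'w measure \<Rightarrow> real \<Rightarrow> (real \<Rightarrow> 'w \<Rightarrow> (real \<Rightarrow> real) \<Rightarrow> real) \<Rightarrow> bool" where
  "distribution_process M T Y \<longleftrightarrow>
     (\<forall>t\<in>{0..T}. \<forall>\<omega>\<in>space M. tempered_distribution (Y t \<omega>)) \<and>
     (\<forall>f. schwartz f \<longrightarrow>
        (\<lambda>(t, \<omega>). Y t \<omega> f) \<in> borel_measurable (restrict_space borel {0..T} \<Otimes>\<^sub>M M))"

definition usc_process ::
    "'w measure \<Rightarrow> real \<Rightarrow> (real \<Rightarrow> 'w \<Rightarrow> (real \<Rightarrow> real) \<Rightarrow> real) \<Rightarrow> bool" where
  "usc_process M T Y \<longleftrightarrow>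
     (\<exists>K::real. \<forall>f. schwartz f \<longrightarrow> (\<forall>t\<in>{0..T}.
        (\<integral>\<^sup>+\<omega>. ennreal ((Y t \<omega> f)\<^sup>2) \<partial>M) \<le> ennreal (K * L2_norm_sq f)))"

text \<open>\<open>Z\<close> is the value at \<open>g \<in> L\<^sup>2\<close> of the extension by continuity of the random
  distribution \<open>\<Lambda>\<close>.\<close>

definition L2_extension ::
    "'w measure \<Rightarrow> ('w \<Rightarrow> (real \<Rightarrow> real) \<Rightarrow> real) \<Rightarrow> (real \<Rightarrow> real) \<Rightarrow> ('w \<Rightarrow> real) \<Rightarrow> bool" where
  "L2_extension M \<Lambda> g Z \<longleftrightarrow>
     (\<exists>\<phi>. (\<forall>n::nat. schwartz (\<phi> n)) \<and> L2_lim lborel \<phi> g sequentially \<and>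
          L2_lim M (\<lambda>n \<omega>. \<Lambda> \<omega> (\<phi> n)) Z sequentially)"

text \<open>The quadratic variation is the limit in probability of the sums of squared increments
  along partitions of \<open>[0,t]\<close>, as their mesh tends to zero. Only deterministic ones are needed.\<close>

definition quadratic_variation ::
    "'w measure \<Rightarrow> real \<Rightarrow> (real \<Rightarrow> 'w \<Rightarrow> real) \<Rightarrow> (real \<Rightarrow> real) \<Rightarrow> bool" where
  "quadratic_variation M T X q \<longleftrightarrow>
     (\<forall>t\<in>{0..T}. \<forall>e>0. \<forall>\<eta>>0. \<exists>d>0. \<forall>(n::nat) p.
        p 0 = 0 \<and> p n = t \<and> (\<forall>i<n. p i \<le> p (Suc i) \<and> p (Suc i) - p i < d) \<longrightarrow>
        measure M {\<omega>\<in>space M. \<bar>(\<Sum>i<n. (X (p (Suc i)) \<omega> - X (p i) \<omega>)\<^sup>2) - q t\<bar> > e} < \<eta>)"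

definition continuous_paths :: "'w measure \<Rightarrow> real \<Rightarrow> (real \<Rightarrow> 'w \<Rightarrow> real) \<Rightarrow> bool" where
  "continuous_paths M T X \<longleftrightarrow> (AE \<omega> in M. continuous_on {0..T} (\<lambda>t. X t \<omega>))"

definition martingale_on ::
    "'w measure \<Rightarrow> (real \<Rightarrow> 'w measure) \<Rightarrow> real \<Rightarrow> (real \<Rightarrow> 'w \<Rightarrow> real) \<Rightarrow> bool" where
  "martingale_on M F T X \<longleftrightarrow>
     (\<forall>t\<in>{0..T}. X t \<in> borel_measurable (F t) \<and> integrable M (X t)) \<and>
     (\<forall>s t. 0 \<le> s \<and> s \<le> t \<and> t \<le> T \<longrightarrow>
        (AE \<omega> in M. real_cond_exp M (F s) (X t) \<omega> = X s \<omega>))"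

text \<open>The filtration generated by the process, augmented by the null sets: limits in
  \<open>L\<^sup>2(P)\<close> are only defined almost surely.\<close>

definition process_filtration ::
    "'w measure \<Rightarrow> (real \<Rightarrow> 'w \<Rightarrow> (real \<Rightarrow> real) \<Rightarrow> real) \<Rightarrow> real \<Rightarrow> 'w measure" where
  "process_filtration M Y t = sigma (space M)
     ({(\<lambda>\<omega>. Y s \<omega> f) -` B \<inter> space M |s f B. s \<in> {0..t} \<and> schwartz f \<and> B \<in> sets borel}
      \<union> null_sets M)"

definition centered_gaussian :: "'w measure \<Rightarrow> ('w \<Rightarrow> real) \<Rightarrow> real \<Rightarrow> bool" where
  "centered_gaussian M X v \<longleftrightarrow> X \<in> borel_measurable M \<and>
     (if v = 0 then (AE \<omega> in M. X \<omega> = 0)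
      else v > 0 \<and> distributed M lborel X (\<lambda>x. ennreal (normal_density 0 (sqrt v) x)))"

subsection \<open>The energy estimate\<close>

definition mollifier :: "(real \<Rightarrow> real) \<Rightarrow> bool" where
  "mollifier h \<longleftrightarrow> (\<forall>x. h x \<ge> 0) \<and> integrable lborel h \<and> integrable lborel (\<lambda>x. (h x)\<^sup>2) \<and>
     (LBINT x. h x) = 1"

text \<open>\<open>V \<epsilon> s x\<close> is \<open>Y\<^sub>s * \<iota>\<^sub>\<epsilon> (x)\<close>. For \<open>h\<close> merely in \<open>L\<^sup>1 \<inter> L\<^sup>2\<close> the value of \<open>Y\<^sub>s\<close> at
  \<open>\<iota>\<^sub>\<epsilon>(\<cdot> - x)\<close> is only defined almost surely, so a jointly measurable version is taken; for a
  Schwartz function \<open>h\<close> it agrees almost surely with \<open>Y s \<omega> (\<lambda>z. h ((z - x) / \<epsilon>) / \<epsilon>)\<close>. Any two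
  versions give the same integrals below, almost surely, and for USC processes one exists for all
  \<open>\<epsilon> > 0\<close>, although only small \<open>\<epsilon>\<close> matters.\<close>

definition mollification ::
    "'w measure \<Rightarrow> real \<Rightarrow> (real \<Rightarrow> real) \<Rightarrow> (real \<Rightarrow> 'w \<Rightarrow> (real \<Rightarrow> real) \<Rightarrow> real) \<Rightarrow>
     (real \<Rightarrow> real \<Rightarrow> real \<Rightarrow> 'w \<Rightarrow> real) \<Rightarrow> bool" where
  "mollification M T h Y V \<longleftrightarrow> (\<forall>\<epsilon>>0.
     (\<lambda>(s, x, \<omega>). V \<epsilon> s x \<omega>)
        \<in> borel_measurable (restrict_space borel {0..T} \<Otimes>\<^sub>M (borel \<Otimes>\<^sub>M M)) \<and>
     (\<forall>s\<in>{0..T}. \<forall>x. L2_extension M (Y s) (\<lambda>z. h ((z - x) / \<epsilon>) / \<epsilon>) (V \<epsilon> s x)))"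

definition energy_field ::
    "(real \<Rightarrow> real \<Rightarrow> real \<Rightarrow> 'w \<Rightarrow> real) \<Rightarrow> real \<Rightarrow> real \<Rightarrow> real \<Rightarrow>
     (real \<Rightarrow> real \<Rightarrow> real) \<Rightarrow> 'w \<Rightarrow> real" where
  "energy_field V \<epsilon> s t f \<omega> =
     (LBINT r:{s..t}. (LBINT x. (V \<epsilon> r x \<omega>)\<^sup>2 * deriv (f r) x))"

definition energy_estimate ::
    "'w measure \<Rightarrow> real \<Rightarrow> (real \<Rightarrow> real \<Rightarrow> real \<Rightarrow> 'w \<Rightarrow> real) \<Rightarrow> bool" where
  "energy_estimate M T V \<longleftrightarrow>
     (\<exists>\<kappa>>0. \<exists>\<beta>\<in>{0<..<1::real}. \<forall>f \<epsilon> \<delta> s t.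
        schwartz f \<longrightarrow> 0 < \<delta> \<longrightarrow> \<delta> < \<epsilon> \<longrightarrow> \<epsilon> < 1 \<longrightarrow> 0 \<le> s \<longrightarrow> s < t \<longrightarrow> t \<le> T \<longrightarrow>
        (\<integral>\<^sup>+\<omega>. ennreal ((energy_field V \<epsilon> s t (\<lambda>_. f) \<omega> - energy_field V \<delta> s t (\<lambda>_. f) \<omega>)\<^sup>2) \<partial>M)
          \<le> ennreal (\<kappa> * \<epsilon> * (t - s) powr \<beta> * L2_norm_sq (deriv f)))"

subsection \<open>Stationary energy solutions\<close>

text \<open>The processes \<open>I\<close> and \<open>A\<close> are the continuous versions of the limits defining
  the time integral of \<open>Y\<^sub>s(\<L>\<^sup>\<rho> f\<^sub>s)\<close> and the nonlinear term.\<close>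

definition energy_martingale_problem ::
    "'w measure \<Rightarrow> real \<Rightarrow> real \<Rightarrow> real \<Rightarrow> real \<Rightarrow> real \<Rightarrow> real \<Rightarrow>
     (real \<Rightarrow> 'w \<Rightarrow> (real \<Rightarrow> real) \<Rightarrow> real) \<Rightarrow> (real \<Rightarrow> real \<Rightarrow> real \<Rightarrow> 'w \<Rightarrow> real) \<Rightarrow> bool" where
  "energy_martingale_problem M \<alpha> cp cm \<rho> m T Y V \<longleftrightarrow>
     (\<forall>f f'. schwartz_trajectory T f f' \<longrightarrow>
       (\<exists>I A.
          (\<forall>t\<in>{0..T}. L2_lim M
             (\<lambda>\<epsilon> \<omega>. LBINT s:{0..t}. Y s \<omega> (\<lambda>x. gauss_cutoff \<epsilon> x * levy_op \<alpha> cp cm \<rho> (f s) x))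
             (I t) (at_right 0)) \<and>
          continuous_paths M T I \<and>
          (\<forall>t\<in>{0..T}. L2_lim M (\<lambda>\<epsilon>. energy_field V \<epsilon> 0 t f) (A t) (at_right 0)) \<and>
          continuous_paths M T A \<and>
          (let N = (\<lambda>t \<omega>. Y t \<omega> (f t) - Y 0 \<omega> (f 0)
                      - ((LBINT s:{0..t}. Y s \<omega> (f' s)) + I t \<omega>) + m * A t \<omega>)
           in martingale_on M (process_filtration M Y) T N \<and>
              continuous_paths M T N \<and>
              quadratic_variation M T N
                (\<lambda>t. 2 * \<rho> * (1 - \<rho>) *
                   (LBINT s:{0..t}. L2_inner (f s) (\<lambda>x. - levy_op \<alpha> cp cm (1/2) (f s) x))))))"

definition stationary_energy_solution_on ::
    "'w measure \<Rightarrow> real \<Rightarrow> real \<Rightarrow> real \<Rightarrow> real \<Rightarrow> real \<Rightarrow> (real \<Rightarrow> real) \<Rightarrow> real \<Rightarrow>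
     (real \<Rightarrow> 'w \<Rightarrow> (real \<Rightarrow> real) \<Rightarrow> real) \<Rightarrow> bool" where
  "stationary_energy_solution_on M \<alpha> cp cm \<rho> m h T Y \<longleftrightarrow>
     distribution_process M T Y \<and> usc_process M T Y \<and>
     (\<exists>V. mollification M T h Y V \<and> energy_estimate M T V \<and>
          energy_martingale_problem M \<alpha> cp cm \<rho> m T Y V) \<and>
     (\<forall>t\<in>{0..T}. \<forall>f. schwartz f \<longrightarrow>
        centered_gaussian M (\<lambda>\<omega>. Y t \<omega> f) (\<rho> * (1 - \<rho>) * L2_norm_sq f))"

definition stationary_energy_solution ::
    "'w measure \<Rightarrow> real \<Rightarrow> real \<Rightarrow> real \<Rightarrow> real \<Rightarrow> real \<Rightarrow> (real \<Rightarrow> real) \<Rightarrow>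
     (real \<Rightarrow> 'w \<Rightarrow> (real \<Rightarrow> real) \<Rightarrow> real) \<Rightarrow> bool" where
  "stationary_energy_solution M \<alpha> cp cm \<rho> m h Y \<longleftrightarrow>
     (\<forall>T>0. stationary_energy_solution_on M \<alpha> cp cm \<rho> m h T Y)"

definition renormalize ::
    "real \<Rightarrow> (real \<Rightarrow> 'w \<Rightarrow> (real \<Rightarrow> real) \<Rightarrow> real) \<Rightarrow> (real \<Rightarrow> 'w \<Rightarrow> (real \<Rightarrow> real) \<Rightarrow> real)" where
  "renormalize \<epsilon> Y t \<omega> f = \<epsilon> powr (1/2) * Y (t / \<epsilon> powr (3/2)) \<omega> (\<lambda>x. f (\<epsilon> * x))"

end

theory Submission
  imports Defs "HOL-Real_Asymp.Real_Asymp"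
begin

text \<open>Every term of the martingale problem for the renormalized process on \<open>[0,T]\<close> is a multiple of
  the corresponding term for the original process on \<open>[0,T/\<epsilon>\<^bsup>3/2\<^esup>]\<close>, by changes of variables in space
  and time. Only the energy estimate needs more than scaling. The mollification at scale
  \<open>\<delta>\<close> of the renormalized process is that of the original one at scale \<open>\<delta>/\<epsilon>\<close>, which exceeds \<open>1\<close> for some
  \<open>\<delta> < 1\<close> if \<open>\<epsilon> < 1\<close>, and there the hypothesis says nothing. At a fixed scale the energy field is
  controlled by stationarity alone: the mollified white noise is Gaussian, its square has constant mean,
  which integrates to zero against a derivative, and a covariance that is integrable in space, so the
  second moment of the energy field is at most a constant times \<open>(t - s)\<^sup>2\<close> and the squared norm of the
  derivative of the test function.\<close>

subsection \<open>Schwartz functions\<close>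

text \<open>The factor \<epsilon>^(1/2) is forced by the white noise: its square cancels the
  1/\<epsilon> that a dilation puts on the squared L2 norm. With time scaled by \<tau> and test
  functions divided by \<tau>, the linear terms pick up \<epsilon>^(1/2) \<tau> and the nonlinear
  one \<tau>^2/\<epsilon>. These agree exactly when \<tau> = \<epsilon>^(3/2), and the operator is
  homogeneous of that degree because \<alpha> = 3/2. The auxiliary objects of a solution (mollified
  field, drift, energy) are given existentially, so explicit rescalings of the given ones serve as
  witnesses. The Gaussian bound at a fixed scale meets two obstacles. The mollifier lies only in L1
  and L2, so the mollified field is a mean-square limit of Schwartz evaluations and its law has to
  be passed to that limit. Moreover, only the law of each single evaluation is prescribed. Joint
  moments come from linearity: sums and differences of two evaluations are again evaluations, hence
  Gaussian.\<close>

lemma schwartz_smooth: "schwartz f \<Longrightarrow> (deriv ^^ n) f field_differentiable (at x)"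
  by (simp add: schwartz_def)

lemma schwartz_bounded: "schwartz f \<Longrightarrow> bounded (range (\<lambda>x. x ^ k * (deriv ^^ n) f x))"
  by (simp add: schwartz_def)

lemma schwartz_DERIV:
  assumes "schwartz f"
  shows "(f has_real_derivative deriv f x) (at x)"
  using schwartz_smooth[OF assms, of 0 x] by (simp add: field_differentiable_derivI)

lemma schwartz_deriv: "schwartz f \<Longrightarrow> schwartz (deriv f)"
  unfolding schwartz_def
  by (metis funpow_Suc_right comp_apply)

lemma schwartz_continuous: "schwartz f \<Longrightarrow> continuous_on A f"
  by (intro continuous_at_imp_continuous_on ballI DERIV_isCont[OF schwartz_DERIV])

lemma schwartz_measurable: "schwartz f \<Longrightarrow> f \<in> borel_measurable borel"
  by (intro borel_measurable_continuous_onI schwartz_continuous)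

section \<open>Linear combinations and dilations of Schwartz functions\<close>

lemma deriv_funpow_lincomb:
  assumes "schwartz f" "schwartz g"
  shows "(deriv ^^ n) (\<lambda>x. a * f x + b * g x) = (\<lambda>x. a * (deriv ^^ n) f x + b * (deriv ^^ n) g x)"
proof (induction n)
  case (Suc n)
  have "((\<lambda>x. a * (deriv ^^ n) f x + b * (deriv ^^ n) g x) has_real_derivative
      a * deriv ((deriv ^^ n) f) x + b * deriv ((deriv ^^ n) g) x) (at x)" for x
    by (intro DERIV_add DERIV_cmult field_differentiable_derivI schwartz_smooth assms)
  then show ?case
    by (simp add: Suc DERIV_imp_deriv fun_eq_iff)
qed simp

lemma deriv_funpow_scale:
  assumes "schwartz f"
  shows "(deriv ^^ n) (\<lambda>x. f (c * x)) = (\<lambda>x. c ^ n * (deriv ^^ n) f (c * x))"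
proof (induction n)
  case (Suc n)
  have "((\<lambda>x. c ^ n * (deriv ^^ n) f (c * x)) has_real_derivative
      c ^ Suc n * deriv ((deriv ^^ n) f) (c * x)) (at x)" for x
  proof -
    have "((deriv ^^ n) f has_real_derivative deriv ((deriv ^^ n) f) (c * x)) (at (c * x))"
      by (intro field_differentiable_derivI schwartz_smooth assms)
    then have "((\<lambda>x. (deriv ^^ n) f (c * x)) has_real_derivative
      deriv ((deriv ^^ n) f) (c * x) * c) (at x)"
      by (rule DERIV_chain2) (auto intro!: derivative_eq_intros)
    from DERIV_cmult[OF this, of "c ^ n"] show ?thesis by (simp add: mult_ac)
  qed
  then show ?case
    by (simp add: Suc DERIV_imp_deriv fun_eq_iff)
qed simp

lemma schwartz_lincomb:
  assumes "schwartz f" "schwartz g"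
  shows "schwartz (\<lambda>x. a * f x + b * g x)"
  unfolding schwartz_def
proof safe
  fix n x
  show "(deriv ^^ n) (\<lambda>x. a * f x + b * g x) field_differentiable (at x)"
    unfolding deriv_funpow_lincomb[OF assms]
    by (intro derivative_intros field_differentiable_add field_differentiable_mult schwartz_smooth assms
        field_differentiable_const)
next
  fix k n
  obtain A B where "\<And>x. \<bar>x ^ k * (deriv ^^ n) f x\<bar> \<le> A" "\<And>x. \<bar>x ^ k * (deriv ^^ n) g x\<bar> \<le> B"
    using schwartz_bounded[OF assms(1), of k n] schwartz_bounded[OF assms(2), of k n]
    by (auto simp: bounded_iff)
  then have "\<bar>a * (x ^ k * (deriv ^^ n) f x) + b * (x ^ k * (deriv ^^ n) g x)\<bar> \<le> \<bar>a\<bar> * A + \<bar>b\<bar> * B"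
    for x
    by (intro order_trans[OF abs_triangle_ineq] add_mono) (auto simp: abs_mult intro!: mult_left_mono)
  then show "bounded (range (\<lambda>x. x ^ k * (deriv ^^ n) (\<lambda>x. a * f x + b * g x) x))"
    unfolding deriv_funpow_lincomb[OF assms] bounded_iff
    by (auto simp: algebra_simps intro!: exI[of _ "\<bar>a\<bar> * A + \<bar>b\<bar> * B"])
qed

lemma schwartz_cmult: "schwartz f \<Longrightarrow> schwartz (\<lambda>x. a * f x)"
  using schwartz_lincomb[of f f a 0] by simp

lemma schwartz_diff: "schwartz f \<Longrightarrow> schwartz g \<Longrightarrow> schwartz (\<lambda>x. f x - g x)"
  using schwartz_lincomb[of f g 1 "-1"] by simp

lemma schwartz_divide: "schwartz f \<Longrightarrow> schwartz (\<lambda>x. f x / a)"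
  using schwartz_cmult[of f "1 / a"] by simp

lemma schwartz_scale:
  assumes "schwartz f" "c \<noteq> 0"
  shows "schwartz (\<lambda>x. f (c * x))"
  unfolding schwartz_def
proof safe
  fix n x
  have "(deriv ^^ n) f field_differentiable (at (c * x))"
    by (intro schwartz_smooth assms)
  then have "((\<lambda>x. (deriv ^^ n) f (c * x)) field_differentiable (at x))"
    using field_differentiable_compose[of "\<lambda>x. c * x" x "(deriv ^^ n) f"]
    by (simp add: o_def field_differentiable_mult field_differentiable_const)
  then show "(deriv ^^ n) (\<lambda>x. f (c * x)) field_differentiable (at x)"
    unfolding deriv_funpow_scale[OF assms(1)]
    by (intro field_differentiable_mult field_differentiable_const)
next
  fix k n
  obtain A where A: "\<And>x. \<bar>x ^ k * (deriv ^^ n) f x\<bar> \<le> A"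
    using schwartz_bounded[OF assms(1), of k n] by (auto simp: bounded_iff)
  have "\<bar>x ^ k * (c ^ n * (deriv ^^ n) f (c * x))\<bar> \<le> \<bar>c ^ n / c ^ k\<bar> * A" for x
  proof -
    have "x ^ k * (c ^ n * (deriv ^^ n) f (c * x)) = c ^ n / c ^ k * ((c * x) ^ k * (deriv ^^ n) f (c * x))"
      using assms by (simp add: power_mult_distrib)
    then show ?thesis
      by (simp only: abs_mult[of "c ^ n / c ^ k"]) (intro mult_left_mono A, simp)
  qed
  then show "bounded (range (\<lambda>x. x ^ k * (deriv ^^ n) (\<lambda>x. f (c * x)) x))"
    unfolding deriv_funpow_scale[OF assms(1)] bounded_iff by auto
qed

lemma schwartz_seminorm_upper:
  assumes "schwartz f"
  shows "\<bar>x ^ k * (deriv ^^ n) f x\<bar> \<le> schwartz_seminorm k n f"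
proof -
  obtain A where "\<And>x. \<bar>x ^ k * (deriv ^^ n) f x\<bar> \<le> A"
    using schwartz_bounded[OF assms, of k n] by (auto simp: bounded_iff)
  then show ?thesis
    unfolding schwartz_seminorm_def by (intro cSUP_upper bdd_aboveI2[where M = A]) auto
qed

lemma schwartz_seminorm_nonneg: "schwartz f \<Longrightarrow> 0 \<le> schwartz_seminorm k n f"
  using schwartz_seminorm_upper[of f 0 k n] by (smt (verit) abs_ge_zero)

lemma schwartz_seminorm_scale_le:
  assumes f: "schwartz f" and c: "c > 0"
  shows "schwartz_seminorm k n (\<lambda>x. f (c * x)) \<le> c ^ n / c ^ k * schwartz_seminorm k n f"
  unfolding schwartz_seminorm_def[of k n "\<lambda>x. f (c * x)"]
proof (rule cSUP_least)
  fix x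
  have "x ^ k * (deriv ^^ n) (\<lambda>x. f (c * x)) x = c ^ n / c ^ k * ((c * x) ^ k * (deriv ^^ n) f (c * x))"
    using c by (simp add: deriv_funpow_scale[OF f] power_mult_distrib)
  then show "\<bar>x ^ k * (deriv ^^ n) (\<lambda>x. f (c * x)) x\<bar> \<le> c ^ n / c ^ k * schwartz_seminorm k n f"
    using c by (simp only: abs_mult[of "c ^ n / c ^ k"])
      (auto intro!: mult_left_mono divide_right_mono schwartz_seminorm_upper f)
qed simp

text \<open>The opposite inequality is the same estimate for the inverse dilation, applied to the
  dilated function. Equality is what carries integrability in time over to dilated trajectories,
  where a bound would leave measurability open.\<close>

lemma schwartz_seminorm_scale:
  assumes f: "schwartz f" and c: "c > 0"
  shows "schwartz_seminorm k n (\<lambda>x. f (c * x)) = c ^ n / c ^ k * schwartz_seminorm k n f"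
proof (rule antisym)
  have "schwartz_seminorm k n (\<lambda>x. f (c * (1 / c * x))) \<le>
      (1 / c) ^ n / (1 / c) ^ k * schwartz_seminorm k n (\<lambda>x. f (c * x))"
    using c by (intro schwartz_seminorm_scale_le[of "\<lambda>x. f (c * x)"] schwartz_scale f) auto
  moreover have "(\<lambda>x. f (c * (1 / c * x))) = f"
    using c by simp
  ultimately have "schwartz_seminorm k n f
    \<le> (1 / c) ^ n / (1 / c) ^ k * schwartz_seminorm k n (\<lambda>x. f (c * x))" by simp
  then show "c ^ n / c ^ k * schwartz_seminorm k n f \<le> schwartz_seminorm k n (\<lambda>x. f (c * x))"
    using c by (simp add: field_simps)
qed (rule schwartz_seminorm_scale_le[OF assms])

section \<open>L2 norms, decay and integrability of Schwartz functions\<close>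

lemma L2_norm_sq_scale:
  assumes "c > 0"
  shows "L2_norm_sq (\<lambda>x. f (c * x)) = L2_norm_sq f / c"
  using lborel_integral_real_affine[of c "\<lambda>x. (f x)\<^sup>2" 0] assms
  by (simp add: L2_norm_sq_def)

lemma L2_norm_sq_nonneg: "0 \<le> L2_norm_sq f"
  by (simp add: L2_norm_sq_def)

text \<open>The weight 1 + x^2 costs the seminorms with k = 0 and k = 2 at derivative order 0. This
  decay suffices both for integrability and for vanishing at infinity.\<close>

lemma schwartz_decay:
  assumes "schwartz f"
  obtains C where "\<And>x. \<bar>f x\<bar> \<le> C / (1 + x\<^sup>2)"
proof -
  have "(1 + x\<^sup>2) * \<bar>f x\<bar> \<le> schwartz_seminorm 0 0 f + schwartz_seminorm 2 0 f" for x
    using schwartz_seminorm_upper[OF assms, of x 0 0] schwartz_seminorm_upper[OF assms, of x 2 0]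
    by (simp add: abs_mult algebra_simps)
  then have "\<bar>f x\<bar> \<le> (schwartz_seminorm 0 0 f + schwartz_seminorm 2 0 f) / (1 + x\<^sup>2)" for x
    by (simp add: pos_le_divide_eq sum_power2_gt_zero_iff add_pos_nonneg mult.commute)
  then show ?thesis by (rule that)
qed

lemma integrable_inverse_quadratic: "integrable lborel (\<lambda>x::real. 1 / (1 + x\<^sup>2))"
  using integrable_inverse_1_plus_square
  by (simp add: set_integrable_def einterval_def inverse_eq_divide)

lemma schwartz_integrable:
  assumes "schwartz f"
  shows "integrable lborel f"
proof -
  obtain C where C: "\<And>x. \<bar>f x\<bar> \<le> C / (1 + x\<^sup>2)" using schwartz_decay[OF assms] by blast
  have "integrable lborel (\<lambda>x. C * (1 / (1 + x\<^sup>2)))"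
    using integrable_inverse_quadratic by (rule integrable_mult_right)
  then show ?thesis
  proof (rule Bochner_Integration.integrable_bound)
    show "AE x in lborel. norm (f x) \<le> norm (C * (1 / (1 + x\<^sup>2)))"
    proof (rule AE_I2)
      fix x
      show "norm (f x) \<le> norm (C * (1 / (1 + x\<^sup>2)))"
        using C[of x] abs_ge_self[of "C / (1 + x\<^sup>2)"] by simp
    qed
  qed (use schwartz_measurable[OF assms] in simp)
qed

text \<open>One factor is bounded by its supremum, the other is integrable.\<close>

lemma schwartz_square_integrable:
  assumes "schwartz f"
  shows "integrable lborel (\<lambda>x. (f x)\<^sup>2)"
proof -
  have "\<bar>f x\<bar> \<le> schwartz_seminorm 0 0 f" for x
    using schwartz_seminorm_upper[OF assms, of x 0 0] by simp
  then have "norm ((f x)\<^sup>2) \<le> norm (schwartz_seminorm 0 0 f * f x)" for x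
    by (simp only: power2_eq_square abs_mult real_norm_def)
      (metis abs_ge_self abs_ge_zero mult_right_mono order_trans)
  then show ?thesis
    using schwartz_measurable[OF assms]
    by (intro Bochner_Integration.integrable_bound[OF integrable_mult_right[OF schwartz_integrable[OF assms]]])
       auto
qed

text \<open>Stating the hypothesis through x^2 treats both ends of the line at once.\<close>

lemma schwartz_tendsto_0:
  assumes "schwartz f" and "filterlim (\<lambda>x::real. x\<^sup>2) at_top F"
  shows "(f \<longlongrightarrow> 0) F"
proof -
  obtain C where C: "\<And>x. \<bar>f x\<bar> \<le> C / (1 + x\<^sup>2)" using schwartz_decay[OF assms(1)] by blast
  have "((\<lambda>x. C / (1 + x\<^sup>2)) \<longlongrightarrow> 0) F"
    by (rule tendsto_divide_0[OF tendsto_const filterlim_at_top_imp_at_infinity])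
      (intro filterlim_tendsto_add_at_top[OF tendsto_const] assms)
  then show ?thesis
    by (rule Lim_null_comparison[rotated]) (use C in auto)
qed

text \<open>The fundamental theorem of calculus on the whole line, with both boundary values 0 by
  decay.\<close>

lemma schwartz_integral_deriv:
  assumes "schwartz f"
  shows "(LBINT x. deriv f x) = 0"
proof -
  have "(LBINT x=-\<infinity>..\<infinity>. deriv f x) = 0 - 0"
  proof (rule interval_integral_FTC_integrable[where F = f])
    show "(f has_vector_derivative deriv f x) (at x)" for x
      using schwartz_DERIV[OF assms] by (simp add: has_real_derivative_iff_has_vector_derivative)
    show "isCont (deriv f) x" for x
      using DERIV_isCont[OF schwartz_DERIV[OF schwartz_deriv[OF assms]]] .
    show "set_integrable lborel (einterval (- \<infinity>) \<infinity>) (deriv f)"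
      using schwartz_integrable[OF schwartz_deriv[OF assms]] by (simp add: set_integrable_def einterval_def)
    have "(f \<longlongrightarrow> 0) at_bot" "(f \<longlongrightarrow> 0) at_top"
      by (rule schwartz_tendsto_0[OF assms], real_asymp)+
    then show "((f \<circ> real_of_ereal) \<longlongrightarrow> 0) (at_right (- \<infinity>))" "((f \<circ> real_of_ereal) \<longlongrightarrow> 0) (at_left \<infinity>)"
      by (simp_all add: ereal_tendsto_simps)
  qed simp
  then show ?thesis
    by (simp add: interval_lebesgue_integral_def einterval_def set_lebesgue_integral_def)
qed

section \<open>Homogeneity of the operator and dilated trajectories\<close>

lemma deriv_scale:
  assumes "schwartz f"
  shows "deriv (\<lambda>x. f (c * x)) x = c * deriv f (c * x)"
  using fun_cong[OF deriv_funpow_scale[OF assms, of 1 c], of x] by simp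

text \<open>Substitute e y for y: the kernel is homogeneous of degree -(1 + \<alpha>), the jump
  coefficient sees only the sign of y, and the Taylor remainder of the dilated function at x is that
  of f at e x. The resulting power of e is placed inside the test function as a divisor, so that
  both sides agree as functions.\<close>

lemma levy_op_scale:
  assumes f: "schwartz f" and e: "e > 0"
  shows "levy_op \<alpha> cp cm \<rho> (\<lambda>x. f (e * x) / e powr \<alpha>) x = levy_op \<alpha> cp cm \<rho> f (e * x)"
proof -
  define F where "F y = jump_coeff cp cm \<rho> y / \<bar>y\<bar> powr (1 + \<alpha>) *
    (f (e * x + y) - f (e * x) - y * deriv f (e * x))" for y
  have d: "deriv (\<lambda>x. f (e * x) / e powr \<alpha>) x = e * deriv f (e * x) / e powr \<alpha>"
    using fun_cong[OF deriv_funpow_lincomb[OF schwartz_scale[OF f] schwartz_scale[OF f], of e e 1 "1 / e powr \<alpha>" 0], of x] e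
    by (simp add: deriv_scale[OF f])
  have "(LBINT y. F y) = e * (LBINT y. F (e * y))"
    using lborel_integral_real_affine[of e F 0] e by simp
  also have "\<dots> = (LBINT y. e * F (e * y))" by simp
  also have "(\<lambda>y. e * F (e * y)) = (\<lambda>y. jump_coeff cp cm \<rho> y / \<bar>y\<bar> powr (1 + \<alpha>) *
    (f (e * (x + y)) / e powr \<alpha> - f (e * x) / e powr \<alpha> - y * (e * deriv f (e * x) / e powr \<alpha>)))"
  proof
    fix y
    have [simp]: "jump_coeff cp cm \<rho> (e * y) = jump_coeff cp cm \<rho> y"
      using e by (simp add: jump_coeff_def zero_le_mult_iff)
    have "\<bar>e * y\<bar> powr (1 + \<alpha>) = e * e powr \<alpha> * \<bar>y\<bar> powr (1 + \<alpha>)"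
      using e by (simp add: abs_mult powr_mult powr_add)
    then show "e * F (e * y) = jump_coeff cp cm \<rho> y / \<bar>y\<bar> powr (1 + \<alpha>) *
    (f (e * (x + y)) / e powr \<alpha> - f (e * x) / e powr \<alpha> - y * (e * deriv f (e * x) / e powr \<alpha>))"
      using e by (simp add: F_def diff_divide_distrib[symmetric] distrib_left mult_ac)
  qed
  finally show ?thesis unfolding levy_op_def d F_def by simp
qed

text \<open>The factor 1/\<tau> cancels the chain-rule factor \<tau>, so the derivative of the
  rescaled trajectory carries none: its difference quotient at u is exactly that of f at \<tau> u,
  dilated in space, and each seminorm only changes by e^n/e^k.\<close>

lemma schwartz_trajectory_scale:
  assumes tr: "schwartz_trajectory T f f'" and e: "e > 0" and \<tau>: "\<tau> > 0"
  shows "schwartz_trajectory (T / \<tau>) (\<lambda>u x. f (\<tau> * u) (e * x) / \<tau>) (\<lambda>u x. f' (\<tau> * u) (e * x))"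
proof -
  have mem: "\<tau> * u \<in> {0..T}" if "u \<in> {0..T / \<tau>}" for u
    using that \<tau> by (auto simp: field_simps)
  note sf = tr[unfolded schwartz_trajectory_def]
  have s: "schwartz (f (\<tau> * u))" "schwartz (f' (\<tau> * u))" if "u \<in> {0..T / \<tau>}" for u
    using sf mem[OF that] by auto
  have lim: "((\<lambda>s. schwartz_seminorm k n
      (\<lambda>x. (f (\<tau> * s) (e * x) / \<tau> - f (\<tau> * t) (e * x) / \<tau>) / (s - t) - f' (\<tau> * t) (e * x))) \<longlongrightarrow> 0)
          (at t within {0..T / \<tau>})" if t: "t \<in> {0..T / \<tau>}" for t k n
  proof -
    let ?q = "\<lambda>s. schwartz_seminorm k n (\<lambda>x. (f s x - f (\<tau> * t) x) / (s - \<tau> * t) - f' (\<tau> * t) x)"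
    have "(?q \<longlongrightarrow> 0) (at (\<tau> * t) within {0..T})"
      using sf mem[OF t] by auto
    moreover have "filterlim (\<lambda>s. \<tau> * s) (at (\<tau> * t) within {0..T}) (at t within {0..T / \<tau>})"
      unfolding filterlim_at using mem \<tau>
      by (auto intro!: tendsto_eq_intros simp: eventually_at_filter)
    ultimately have "((\<lambda>s. e ^ n / e ^ k * ?q (\<tau> * s)) \<longlongrightarrow> e ^ n / e ^ k * 0) (at t within {0..T / \<tau>})"
      by (intro tendsto_mult_left) (rule filterlim_compose)
    moreover have "\<forall>\<^sub>F s in at t within {0..T / \<tau>}. e ^ n / e ^ k * ?q (\<tau> * s) =
       schwartz_seminorm k n
      (\<lambda>x. (f (\<tau> * s) (e * x) / \<tau> - f (\<tau> * t) (e * x) / \<tau>) / (s - t) - f' (\<tau> * t) (e * x))"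
      unfolding eventually_at_filter
    proof (intro always_eventually allI impI)
      fix u assume u: "u \<in> {0..T / \<tau>}"
      have "schwartz (\<lambda>x. (f (\<tau> * u) x - f (\<tau> * t) x) / (\<tau> * u - \<tau> * t) - f' (\<tau> * t) x)"
        by (intro schwartz_diff schwartz_divide s u t)
      from schwartz_seminorm_scale[OF this e, of k n]
      show "e ^ n / e ^ k * ?q (\<tau> * u) = schwartz_seminorm k n
      (\<lambda>x. (f (\<tau> * u) (e * x) / \<tau> - f (\<tau> * t) (e * x) / \<tau>) / (u - t) - f' (\<tau> * t) (e * x))"
        using \<tau> by (simp add: right_diff_distrib[symmetric] diff_divide_distrib[symmetric] mult.commute)
    qed
    ultimately show ?thesis
      using tendsto_cong by force
  qed
  have int: "set_integrable lborel {0..T / \<tau>} (\<lambda>s. schwartz_seminorm k n (\<lambda>x. f' (\<tau> * s) (e * x)))" for k n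
  proof -
    have "integrable lborel (\<lambda>s. indicator {0..T} s *\<^sub>R schwartz_seminorm k n (f' s))"
      using sf by (simp add: set_integrable_def)
    from integrable_mult_right[OF lborel_integrable_real_affine[OF this, of \<tau> 0], of "e ^ n / e ^ k"] \<tau>
    have "integrable lborel (\<lambda>s. e ^ n / e ^ k * (indicator {0..T} (\<tau> * s) *\<^sub>R schwartz_seminorm k n (f' (\<tau> * s))))"
      by simp
    also have "(\<lambda>s. e ^ n / e ^ k * (indicator {0..T} (\<tau> * s) *\<^sub>R schwartz_seminorm k n (f' (\<tau> * s)))) =
      (\<lambda>s. indicator {0..T / \<tau>} s *\<^sub>R schwartz_seminorm k n (\<lambda>x. f' (\<tau> * s) (e * x)))"
    proof
      fix u
      have i: "indicator {0..T} (\<tau> * u) = (indicator {0..T / \<tau>} u :: real)"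
        using \<tau> by (auto simp: indicator_def field_simps zero_le_mult_iff)
      show "e ^ n / e ^ k * (indicator {0..T} (\<tau> * u) *\<^sub>R schwartz_seminorm k n (f' (\<tau> * u))) =
        indicator {0..T / \<tau>} u *\<^sub>R schwartz_seminorm k n (\<lambda>x. f' (\<tau> * u) (e * x))"
        unfolding i using schwartz_seminorm_scale[OF s(2) e] by (auto simp: indicator_def)
    qed
    finally show ?thesis by (simp add: set_integrable_def)
  qed
  show ?thesis
    unfolding schwartz_trajectory_def
  proof (intro conjI ballI allI)
    fix t assume t: "t \<in> {0..T / \<tau>}"
    show "schwartz (\<lambda>x. f (\<tau> * t) (e * x) / \<tau>)"
      using schwartz_divide[OF schwartz_scale[OF s(1)[OF t]], of e \<tau>] e by simp
    show "schwartz (\<lambda>x. f' (\<tau> * t) (e * x))"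
      using schwartz_scale[OF s(2)[OF t], of e] e by simp
  qed (fact lim int)+
qed

subsection \<open>Centered Gaussian variables\<close>

lemma char_distr:
  assumes "X \<in> borel_measurable M"
  shows "char (distr M borel X) t = (CLINT \<omega>|M. iexp (t * X \<omega>))"
  using assms unfolding char_def by (subst integral_distr) auto

lemma centered_gaussian_var_nonneg: "centered_gaussian M X v \<Longrightarrow> 0 \<le> v"
  by (auto simp: centered_gaussian_def split: if_splits)

lemma centered_gaussian_measurable: "centered_gaussian M X v \<Longrightarrow> X \<in> borel_measurable M"
  by (simp add: centered_gaussian_def)

text \<open>A single formula covers both branches of \<open>centered_gaussian\<close>, the point
  mass for v = 0 and the density for v > 0. Laws can then be passed to limits even where a variance
  degenerates, as it does for the difference of two equal evaluations.\<close>

lemma (in prob_space) char_centered_gaussian: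
  assumes "centered_gaussian M X v"
  shows "char (distr M borel X) t = complex_of_real (exp (- (v * t\<^sup>2 / 2)))"
proof (cases "v = 0")
  case True
  have [measurable]: "X \<in> borel_measurable M" and "AE \<omega> in M. X \<omega> = 0"
    using assms True by (auto simp: centered_gaussian_def)
  then have "(CLINT \<omega>|M. iexp (t * X \<omega>)) = (CLINT \<omega>|M. 1)"
    by (intro integral_cong_AE) auto
  then show ?thesis
    using True by (simp add: char_distr prob_space)
next
  case False
  then have v: "0 < v" and [measurable]: "X \<in> borel_measurable M"
    and d: "distributed M lborel X (normal_density 0 (sqrt v))"
    using assms by (auto simp: centered_gaussian_def)
  have "distributed M lborel (\<lambda>x. X x / sqrt v) std_normal_density"
    using normal_standard_normal_convert[of "sqrt v" X 0] d v by simp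
  then have "distr M lborel (\<lambda>x. X x / sqrt v) = std_normal_distribution"
    by (rule distributed_distr_eq_density)
  then have "distr M borel (\<lambda>x. X x / sqrt v) = std_normal_distribution"
    by (simp cong: distr_cong)
  then have "char (distr M borel (\<lambda>x. X x / sqrt v)) (t * sqrt v) = exp (- (t * sqrt v)\<^sup>2 / 2)"
    by (simp add: char_std_normal_distribution)
  then show ?thesis
    using v by (simp add: char_distr power_mult_distrib mult.commute)
qed

text \<open>Levy's uniqueness theorem, against the point mass at 0 if v = 0 and against the standard
  normal law after division by sqrt v otherwise.\<close>

lemma (in prob_space) centered_gaussianI_char:
  assumes X[measurable]: "X \<in> borel_measurable M" and v: "0 \<le> v"
    and ch: "\<And>t. char (distr M borel X) t = complex_of_real (exp (- (v * t\<^sup>2 / 2)))"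
  shows "centered_gaussian M X v"
proof (cases "v = 0")
  case True
  interpret D: prob_space "distr M borel X" by (rule prob_space_distr) simp
  have "distr M borel X = return borel 0"
  proof (rule Levy_uniqueness)
    show "real_distribution (distr M borel X)" by simp
    show "real_distribution (return borel 0)"
      by (auto simp: real_distribution_def real_distribution_axioms_def intro!: prob_space_return)
    show "char (distr M borel X) = char (return borel 0)"
    proof
      fix t
      have "char (return borel 0) t = 1"
        unfolding char_def by (subst integral_return) auto
      then show "char (distr M borel X) t = char (return borel 0) t"
        using True by (simp add: ch)
    qed
  qed
  then have "AE x in distr M borel X. x = 0"
    by (simp only:) (simp add: AE_return)
  then have "AE \<omega> in M. X \<omega> = 0"
    by (subst (asm) AE_distr_iff) auto
  then show ?thesis using True by (simp add: centered_gaussian_def)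
next
  case False
  then have v: "0 < v" using v by simp
  have "distr M borel (\<lambda>x. X x / sqrt v) = std_normal_distribution"
  proof (rule Levy_uniqueness)
    show "real_distribution (distr M borel (\<lambda>x. X x / sqrt v))" by simp
    show "char (distr M borel (\<lambda>x. X x / sqrt v)) = char std_normal_distribution"
    proof
      fix t
      have "char (distr M borel (\<lambda>x. X x / sqrt v)) t = char (distr M borel X) (t / sqrt v)"
        by (simp add: char_distr)
      then show "char (distr M borel (\<lambda>x. X x / sqrt v)) t = char std_normal_distribution t"
        using v by (simp add: ch char_std_normal_distribution power_divide)
    qed
  qed (rule real_dist_normal_dist)
  then have "distr M lborel (\<lambda>x. X x / sqrt v) = std_normal_distribution"
    by (simp cong: distr_cong)
  then have "distributed M lborel (\<lambda>x. X x / sqrt v) std_normal_density"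
    by (simp add: distributed_def)
  then have "distributed M lborel X (normal_density 0 (sqrt v))"
    using normal_standard_normal_convert[of "sqrt v" X 0] v by simp
  then show ?thesis using v by (simp add: centered_gaussian_def)
qed

section \<open>Gaussian laws under mean-square limits\<close>

lemma norm_iexp_diff_le: "norm (iexp a - iexp b) \<le> \<bar>a - b\<bar>"
proof -
  have "iexp a - iexp b = iexp b * (iexp (a - b) - 1)"
    by (simp add: algebra_simps exp_add[symmetric])
  then show ?thesis
    using iexp_approx1[of "a - b" 0] by (simp add: norm_mult)
qed

text \<open>The exponential is Lipschitz in its phase, and Jensen's inequality moves the square
  inside the expectation. The bound lives in \<open>ennreal\<close>, so it makes sense before X - Z
  is known to be square integrable, and it matches the form of \<open>L2_lim\<close>.\<close>

lemma (in prob_space) norm_char_diff_le: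
  assumes [measurable]: "X \<in> borel_measurable M" "Z \<in> borel_measurable M"
  shows "ennreal ((norm (char (distr M borel X) t - char (distr M borel Z) t))\<^sup>2)
    \<le> ennreal (t\<^sup>2) * (\<integral>\<^sup>+\<omega>. ennreal ((X \<omega> - Z \<omega>)\<^sup>2) \<partial>M)"
proof -
  define w where "w \<omega> = norm (iexp (t * X \<omega>) - iexp (t * Z \<omega>))" for \<omega>
  have [measurable]: "w \<in> borel_measurable M" unfolding w_def by measurable
  have w2: "\<bar>w \<omega>\<bar> \<le> 2" for \<omega>
    using norm_triangle_ineq4[of "iexp (t * X \<omega>)" "iexp (t * Z \<omega>)"] by (simp add: w_def)
  have iw: "integrable M w"
    by (rule integrable_const_bound[of _ 2]) (use w2 in auto)
  have iw2: "integrable M (\<lambda>\<omega>. (w \<omega>)\<^sup>2)"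
  proof (rule integrable_const_bound[of _ 4])
    have "(w \<omega>)\<^sup>2 \<le> 2\<^sup>2" for \<omega>
      using power_mono[OF w2[of \<omega>], of 2] by simp
    then show "AE x in M. norm ((w x)\<^sup>2) \<le> 4" by simp
  qed simp
  have ie: "integrable M (\<lambda>\<omega>. iexp (t * U \<omega>))" if "U \<in> borel_measurable M" for U
    using that by (intro integrable_const_bound[of _ 1]) auto
  have "char (distr M borel X) t - char (distr M borel Z) t
     = (CLINT \<omega>|M. iexp (t * X \<omega>) - iexp (t * Z \<omega>))"
    unfolding char_distr[OF assms(1)] char_distr[OF assms(2)]
    by (rule Bochner_Integration.integral_diff[symmetric]) (intro ie assms)+
  then have "norm (char (distr M borel X) t - char (distr M borel Z) t) \<le> expectation w"
    unfolding w_def by (simp add: integral_norm_bound)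
  then have "(norm (char (distr M borel X) t - char (distr M borel Z) t))\<^sup>2 \<le> (expectation w)\<^sup>2"
    by (intro power_mono) auto
  \<comment> \<open>Jensen's inequality for the square, read as nonnegativity of the variance of
    w.\<close>
  also have "\<dots> \<le> expectation (\<lambda>\<omega>. (w \<omega>)\<^sup>2)"
    using variance_eq[OF iw iw2] variance_positive[of w] by simp
  finally have "ennreal ((norm (char (distr M borel X) t - char (distr M borel Z) t))\<^sup>2)
    \<le> ennreal (expectation (\<lambda>\<omega>. (w \<omega>)\<^sup>2))" by (rule ennreal_leI)
  also have "\<dots> = (\<integral>\<^sup>+\<omega>. ennreal ((w \<omega>)\<^sup>2) \<partial>M)"
    by (rule nn_integral_eq_integral[symmetric]) (use iw2 in auto)
  also have "\<dots> \<le> (\<integral>\<^sup>+\<omega>. ennreal (t\<^sup>2) * ennreal ((X \<omega> - Z \<omega>)\<^sup>2) \<partial>M)"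
  proof (rule nn_integral_mono)
    fix \<omega>
    have "(w \<omega>)\<^sup>2 \<le> \<bar>t * X \<omega> - t * Z \<omega>\<bar>\<^sup>2"
      unfolding w_def by (intro power_mono norm_iexp_diff_le) simp
    also have "\<dots> = t\<^sup>2 * (X \<omega> - Z \<omega>)\<^sup>2"
      by (simp add: right_diff_distrib[symmetric] power_mult_distrib)
    finally show "ennreal ((w \<omega>)\<^sup>2) \<le> ennreal (t\<^sup>2) * ennreal ((X \<omega> - Z \<omega>)\<^sup>2)"
      by (simp add: ennreal_mult[symmetric] ennreal_leI)
  qed
  also have "\<dots> = ennreal (t\<^sup>2) * (\<integral>\<^sup>+\<omega>. ennreal ((X \<omega> - Z \<omega>)\<^sup>2) \<partial>M)"
    by (rule nn_integral_cmult) simp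
  finally show ?thesis .
qed

lemma tendsto_0_ennreal_le:
  fixes u h :: "'i \<Rightarrow> ennreal"
  assumes "(h \<longlongrightarrow> 0) F" and "\<And>i. u i \<le> h i"
  shows "(u \<longlongrightarrow> 0) F"
  by (rule tendsto_sandwich[OF _ _ tendsto_const assms(1)]) (simp_all add: assms(2))

text \<open>Mean-square convergence forces pointwise convergence of the characteristic functions,
  and these are explicit in the variances v n. So the limit has the characteristic function of
  variance w, with w = 0 allowed.\<close>

lemma (in prob_space) L2_lim_centered_gaussian:
  assumes lim: "L2_lim M X Z sequentially"
    and X: "\<And>n. centered_gaussian M (X n) (v n)" and v: "v \<longlonglongrightarrow> w"
  shows "centered_gaussian M Z w"
proof (rule centered_gaussianI_char)
  show Z[measurable]: "Z \<in> borel_measurable M" using lim by (simp add: L2_lim_def)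
  note [measurable] = centered_gaussian_measurable[OF X]
  show "0 \<le> w"
    using v centered_gaussian_var_nonneg[OF X] by (intro LIMSEQ_le_const) auto
  fix t
  let ?D = "\<lambda>n. norm (char (distr M borel (X n)) t - char (distr M borel Z) t)"
  have "(\<lambda>n. \<integral>\<^sup>+\<omega>. ennreal ((X n \<omega> - Z \<omega>)\<^sup>2) \<partial>M) \<longlonglongrightarrow> 0"
    using lim by (simp only: L2_lim_def)
  from ennreal_tendsto_cmult[OF _ this, of "ennreal (t\<^sup>2)"]
  have "(\<lambda>n. ennreal (t\<^sup>2) * (\<integral>\<^sup>+\<omega>. ennreal ((X n \<omega> - Z \<omega>)\<^sup>2) \<partial>M)) \<longlonglongrightarrow> 0"
    by simp
  then have "(\<lambda>n. ennreal ((?D n)\<^sup>2)) \<longlonglongrightarrow> 0"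
    by (rule tendsto_0_ennreal_le) (rule norm_char_diff_le[OF centered_gaussian_measurable[OF X] Z])
  then have "(\<lambda>n. ennreal ((?D n)\<^sup>2)) \<longlonglongrightarrow> ennreal 0"
    by (simp only: ennreal_0)
  from tendsto_ennrealD[OF this] have "(\<lambda>n. (?D n)\<^sup>2) \<longlonglongrightarrow> 0"
    by simp
  then have "(\<lambda>n. sqrt ((norm (char (distr M borel (X n)) t - char (distr M borel Z) t))\<^sup>2)) \<longlonglongrightarrow> sqrt 0"
    by (intro tendsto_intros)
  then have "(\<lambda>n. char (distr M borel (X n)) t) \<longlonglongrightarrow> char (distr M borel Z) t"
    by (simp add: LIM_zero_iff tendsto_norm_zero_iff)
  moreover have "(\<lambda>n. char (distr M borel (X n)) t) \<longlonglongrightarrow> complex_of_real (exp (- (w * t\<^sup>2 / 2)))"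
    unfolding char_centered_gaussian[OF X] by (intro tendsto_intros v) simp
  ultimately show "char (distr M borel Z) t = complex_of_real (exp (- (w * t\<^sup>2 / 2)))"
    by (rule LIMSEQ_unique)
qed

lemma (in prob_space) centered_gaussian_moments:
  assumes "centered_gaussian M X v"
  shows "integrable M (\<lambda>\<omega>. (X \<omega>)\<^sup>2)" "integrable M (\<lambda>\<omega>. (X \<omega>)^4)"
    and "expectation (\<lambda>\<omega>. (X \<omega>)\<^sup>2) = v" "expectation (\<lambda>\<omega>. (X \<omega>)^4) = 3 * v\<^sup>2"
proof -
  note [measurable] = centered_gaussian_measurable[OF assms]
  have "has_bochner_integral M (\<lambda>\<omega>. (X \<omega>)\<^sup>2) v \<and> has_bochner_integral M (\<lambda>\<omega>. (X \<omega>)^4) (3 * v\<^sup>2)"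
  proof (cases "v = 0")
    case True
    then have "AE \<omega> in M. X \<omega> = 0"
      using assms by (simp add: centered_gaussian_def)
    then have "AE \<omega> in M. (X \<omega>)^k = 0" if "k > 0" for k
      using \<open>AE \<omega> in M. X \<omega> = 0\<close> that by simp
    then have "has_bochner_integral M (\<lambda>\<omega>. (X \<omega>)^k) 0" if "k > 0" for k
      using has_bochner_integral_cong_AE[of "\<lambda>\<omega>. (X \<omega>)^k" M "\<lambda>_. 0" 0] that
        has_bochner_integral_zero[of M] by simp
    then show ?thesis using True by simp
  next
    case False
    then have v: "0 < v"
      and d: "distributed M lborel X (normal_density 0 (sqrt v))"
      using assms by (auto simp: centered_gaussian_def)
    \<comment> \<open>The even moments are (2k)!/((2/v)^k k!), which is v for k = 1 and 3 v^2 for k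
      = 2.\<close>
    have *: "has_bochner_integral M (\<lambda>\<omega>. (X \<omega>)^(2*k)) (fact (2 * k) / ((2 / v)^k * fact k))" for k
      using normal_moment_even[of "sqrt v" 0 k] v
        distributed_integrable[OF d, of "\<lambda>x. x^(2*k)"] distributed_integral[OF d, of "\<lambda>x. x^(2*k)"]
      by (simp add: has_bochner_integral_iff)
    show ?thesis
      using *[of 1] *[of 2] v by (simp add: fact_numeral power2_eq_square field_simps)
  qed
  then show "integrable M (\<lambda>\<omega>. (X \<omega>)\<^sup>2)" "integrable M (\<lambda>\<omega>. (X \<omega>)^4)"
    "expectation (\<lambda>\<omega>. (X \<omega>)\<^sup>2) = v" "expectation (\<lambda>\<omega>. (X \<omega>)^4) = 3 * v\<^sup>2"
    by (auto simp: has_bochner_integral_iff)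
qed

lemma integrable_mult_of_squares:
  fixes f g :: "'a \<Rightarrow> real"
  assumes [measurable]: "f \<in> borel_measurable M" "g \<in> borel_measurable M"
    and "integrable M (\<lambda>x. (f x)\<^sup>2)" "integrable M (\<lambda>x. (g x)\<^sup>2)"
  shows "integrable M (\<lambda>x. f x * g x)"
proof (rule Bochner_Integration.integrable_bound)
  show "integrable M (\<lambda>x. (f x)\<^sup>2 + (g x)\<^sup>2)" using assms by simp
  have "\<bar>f x * g x\<bar> \<le> (f x)\<^sup>2 + (g x)\<^sup>2" for x
    using sum_squares_bound[of "f x" "g x"] sum_squares_bound[of "f x" "- g x"]
    by (simp add: abs_le_iff)
  then show "AE x in M. norm (f x * g x) \<le> norm ((f x)\<^sup>2 + (g x)\<^sup>2)" by simp
qed simp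

text \<open>Wick's formula for \<open>E[X\<^sup>2 Z\<^sup>2]\<close>, read off from the fourth moments of \<open>X \<plusminus> Z\<close>.\<close>

lemma (in prob_space) gaussian_covariance_squares:
  assumes X: "centered_gaussian M X a" and Z: "centered_gaussian M Z a"
    and p: "centered_gaussian M (\<lambda>\<omega>. X \<omega> + Z \<omega>) (2 * a + 2 * k)"
    and m: "centered_gaussian M (\<lambda>\<omega>. X \<omega> - Z \<omega>) (2 * a - 2 * k)"
  shows "integrable M (\<lambda>\<omega>. ((X \<omega>)\<^sup>2 - a) * ((Z \<omega>)\<^sup>2 - a))"
    and "expectation (\<lambda>\<omega>. ((X \<omega>)\<^sup>2 - a) * ((Z \<omega>)\<^sup>2 - a)) = 2 * k\<^sup>2"
proof -
  note X = centered_gaussian_moments[OF X] and Z = centered_gaussian_moments[OF Z]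
    and p = centered_gaussian_moments[OF p] and m = centered_gaussian_moments[OF m]
  \<comment> \<open>(X + Z)^4 + (X - Z)^4 = 2 X^4 + 12 X^2 Z^2 + 2 Z^4 expresses the mixed product
    through moments of single variables.\<close>
  have eq: "((X \<omega>)\<^sup>2 - a) * ((Z \<omega>)\<^sup>2 - a) = ((X \<omega> + Z \<omega>)^4 + (X \<omega> - Z \<omega>)^4) / 12
    - ((X \<omega>)^4 + (Z \<omega>)^4) / 6 - a * (X \<omega>)\<^sup>2 - a * (Z \<omega>)\<^sup>2 + a\<^sup>2" for \<omega>
    by (simp add: power2_eq_square power4_eq_xxxx algebra_simps)
  show "integrable M (\<lambda>\<omega>. ((X \<omega>)\<^sup>2 - a) * ((Z \<omega>)\<^sup>2 - a))"
    unfolding eq using X Z p m by auto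
  \<comment> \<open>The moments add up to (3 (2a + 2k)^2 + 3 (2a - 2k)^2)/12 - a^2 - 2 a^2 + a^2 = 2
    k^2.\<close>
  show "expectation (\<lambda>\<omega>. ((X \<omega>)\<^sup>2 - a) * ((Z \<omega>)\<^sup>2 - a)) = 2 * k\<^sup>2"
    unfolding eq using X Z p m
    by (simp add: prob_space) (simp add: power2_eq_square algebra_simps)
qed

subsection \<open>Limits and second moments in mean square\<close>

text \<open>\<open>L2_lim\<close> asserts convergence only. That the limit is square integrable
  follows from one index at finite distance and g^2 \<le> 2 \<phi>^2 + 2 (\<phi> - g)^2, whose two
  sides differ by (2 \<phi> - g)^2.\<close>

lemma L2_lim_square_integrable:
  assumes lim: "L2_lim N \<phi> g sequentially"
    and [measurable]: "\<And>n. \<phi> n \<in> borel_measurable N"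
    and int: "\<And>n. integrable N (\<lambda>x. (\<phi> n x)\<^sup>2)"
  shows "integrable N (\<lambda>x. (g x)\<^sup>2)"
proof -
  have [measurable]: "g \<in> borel_measurable N"
    and l: "(\<lambda>n. \<integral>\<^sup>+x. ennreal ((\<phi> n x - g x)\<^sup>2) \<partial>N) \<longlonglongrightarrow> 0"
    using lim by (simp_all add: L2_lim_def)
  have "\<forall>\<^sub>F n in sequentially. (\<integral>\<^sup>+x. ennreal ((\<phi> n x - g x)\<^sup>2) \<partial>N) < 1"
    using l by (rule order_tendstoD) simp
  then obtain n where "(\<integral>\<^sup>+x. ennreal ((\<phi> n x - g x)\<^sup>2) \<partial>N) < 1"
    by (auto dest: eventually_happens)
  then have "integrable N (\<lambda>x. (\<phi> n x - g x)\<^sup>2)"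
    by (intro integrableI_nonneg) (auto intro: less_trans)
  then have "integrable N (\<lambda>x. 2 * (\<phi> n x)\<^sup>2 + 2 * (\<phi> n x - g x)\<^sup>2)"
    using int by simp
  moreover have "(g x)\<^sup>2 \<le> 2 * (\<phi> n x)\<^sup>2 + 2 * (\<phi> n x - g x)\<^sup>2" for x
  proof -
    have "0 \<le> (2 * \<phi> n x - g x)\<^sup>2" by simp
    then show ?thesis by (simp add: power2_eq_square algebra_simps)
  qed
  ultimately show ?thesis
    by (intro Bochner_Integration.integrable_bound[of N _ "\<lambda>x. (g x)\<^sup>2"]) auto
qed

text \<open>Writing \<phi> = (\<phi> - g) + g, the squared norms differ by at most D + 2 sqrt D sqrt
  G by Cauchy-Schwarz, with D the squared distance and G the squared norm of g.\<close>

lemma tendsto_integral_square_L2_lim: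
  assumes lim: "L2_lim N \<phi> g sequentially"
    and [measurable]: "\<And>n. \<phi> n \<in> borel_measurable N"
    and int: "\<And>n. integrable N (\<lambda>x. (\<phi> n x)\<^sup>2)"
  shows "(\<lambda>n. \<integral>x. (\<phi> n x)\<^sup>2 \<partial>N) \<longlonglongrightarrow> (\<integral>x. (g x)\<^sup>2 \<partial>N)"
proof -
  have [measurable]: "g \<in> borel_measurable N"
    and l: "(\<lambda>n. \<integral>\<^sup>+x. ennreal ((\<phi> n x - g x)\<^sup>2) \<partial>N) \<longlonglongrightarrow> 0"
    using lim by (simp_all add: L2_lim_def)
  have g: "integrable N (\<lambda>x. (g x)\<^sup>2)"
    by (rule L2_lim_square_integrable[OF assms])
  have d: "integrable N (\<lambda>x. (\<phi> n x - g x)\<^sup>2)" for n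
  proof -
    have "integrable N (\<lambda>x. (\<phi> n x)\<^sup>2 + (g x)\<^sup>2 - 2 * (\<phi> n x * g x))"
      using int g integrable_mult_of_squares[of "\<phi> n" N g] by auto
    then show ?thesis by (simp add: power2_diff algebra_simps)
  qed
  define D where "D n = (\<integral>x. (\<phi> n x - g x)\<^sup>2 \<partial>N)" for n
  define G where "G = (\<integral>x. (g x)\<^sup>2 \<partial>N)"
  have "(\<lambda>n. ennreal (D n)) \<longlonglongrightarrow> ennreal 0"
    using l unfolding D_def by (simp add: nn_integral_eq_integral d)
  then have D0: "D \<longlonglongrightarrow> 0"
    by (rule tendsto_ennrealD) (simp_all add: D_def)
  have bound: "\<bar>(\<integral>x. (\<phi> n x)\<^sup>2 \<partial>N) - G\<bar> \<le> D n + 2 * (sqrt (D n) * sqrt G)" for n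
  proof -
    have gd: "integrable N (\<lambda>x. g x * (\<phi> n x - g x))"
      by (rule integrable_mult_of_squares) (use g d in auto)
    have "(\<integral>x. (\<phi> n x)\<^sup>2 \<partial>N) = (\<integral>x. (\<phi> n x - g x)\<^sup>2 + 2 * (g x * (\<phi> n x - g x)) + (g x)\<^sup>2 \<partial>N)"
      by (intro Bochner_Integration.integral_cong refl) (simp add: power2_eq_square algebra_simps)
    also have "\<dots> = D n + 2 * (\<integral>x. g x * (\<phi> n x - g x) \<partial>N) + G"
      using gd d g by (simp add: D_def G_def)
    finally have 1: "(\<integral>x. (\<phi> n x)\<^sup>2 \<partial>N) - G = D n + 2 * (\<integral>x. g x * (\<phi> n x - g x) \<partial>N)" by simp
    have "\<bar>\<integral>x. g x * (\<phi> n x - g x) \<partial>N\<bar>\<^sup>2 \<le> D n * G"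
    proof -
      have "ennreal (\<bar>\<integral>x. g x * (\<phi> n x - g x) \<partial>N\<bar>\<^sup>2) \<le> (ennreal (\<integral>x. \<bar>g x\<bar> * \<bar>\<phi> n x - g x\<bar> \<partial>N))\<^sup>2"
        using integral_abs_bound[of N "\<lambda>x. g x * (\<phi> n x - g x)"]
        by (subst ennreal_power, simp, intro ennreal_leI power_mono) (simp_all add: abs_mult)
      also have "ennreal (\<integral>x. \<bar>g x\<bar> * \<bar>\<phi> n x - g x\<bar> \<partial>N) =
          (\<integral>\<^sup>+x. ennreal \<bar>g x\<bar> * ennreal \<bar>\<phi> n x - g x\<bar> \<partial>N)"
        using integrable_abs[OF gd]
        by (subst nn_integral_eq_integral[symmetric]) (auto simp: abs_mult ennreal_mult)
      also have "\<dots>\<^sup>2 \<le> (\<integral>\<^sup>+x. (ennreal \<bar>g x\<bar>)\<^sup>2 \<partial>N) * (\<integral>\<^sup>+x. (ennreal \<bar>\<phi> n x - g x\<bar>)\<^sup>2 \<partial>N)"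
        by (rule Cauchy_Schwarz_nn_integral) auto
      also have "\<dots> = ennreal G * ennreal (D n)"
        using g d by (simp add: ennreal_power nn_integral_eq_integral G_def D_def)
      also have "\<dots> = ennreal (D n * G)"
        by (simp add: ennreal_mult' G_def D_def mult.commute)
      finally show ?thesis
        by (subst (asm) ennreal_le_iff) (auto simp: G_def D_def)
    qed
    then have "\<bar>\<integral>x. g x * (\<phi> n x - g x) \<partial>N\<bar> \<le> sqrt (D n) * sqrt G"
      using real_le_rsqrt by (simp add: real_sqrt_mult[symmetric])
    moreover have "0 \<le> D n" by (simp add: D_def)
    ultimately show ?thesis unfolding 1 by (simp add: abs_le_iff)
  qed
  have "(\<lambda>n. D n + 2 * (sqrt (D n) * sqrt G)) \<longlonglongrightarrow> 0"
    by (rule tendsto_eq_intros D0 refl | simp)+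
  then have "(\<lambda>n. (\<integral>x. (\<phi> n x)\<^sup>2 \<partial>N) - G) \<longlonglongrightarrow> 0"
    by (rule Lim_null_comparison[rotated]) (simp add: bound)
  then show ?thesis unfolding G_def by (simp add: LIM_zero_iff)
qed

text \<open>The bound (u + c v)^2 \<le> 2 u^2 + 2 c^2 v^2, applied to the two errors.\<close>

lemma L2_lim_lincomb:
  fixes Z Z' :: "'w \<Rightarrow> real"
  assumes "L2_lim N X Z F" "L2_lim N X' Z' F"
    and [measurable]: "\<And>i. X i \<in> borel_measurable N" "\<And>i. X' i \<in> borel_measurable N"
  shows "L2_lim N (\<lambda>i \<omega>. X i \<omega> + c * X' i \<omega>) (\<lambda>\<omega>. Z \<omega> + c * Z' \<omega>) F"
proof -
  have [measurable]: "Z \<in> borel_measurable N" "Z' \<in> borel_measurable N"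
    and l: "((\<lambda>i. \<integral>\<^sup>+x. ennreal ((X i x - Z x)\<^sup>2) \<partial>N) \<longlongrightarrow> 0) F"
     "((\<lambda>i. \<integral>\<^sup>+x. ennreal ((X' i x - Z' x)\<^sup>2) \<partial>N) \<longlongrightarrow> 0) F"
    using assms by (simp_all add: L2_lim_def)
  let ?h = "\<lambda>i. ennreal 2 * (\<integral>\<^sup>+x. ennreal ((X i x - Z x)\<^sup>2) \<partial>N)
      + ennreal (2 * c\<^sup>2) * (\<integral>\<^sup>+x. ennreal ((X' i x - Z' x)\<^sup>2) \<partial>N)"
  have "(?h \<longlongrightarrow> ennreal 2 * 0 + ennreal (2 * c\<^sup>2) * 0) F"
    by (rule tendsto_add[OF ennreal_tendsto_cmult[OF _ l(1)] ennreal_tendsto_cmult[OF _ l(2)]]) simp_all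
  then have h: "(?h \<longlongrightarrow> 0) F" by simp
  have b: "(\<integral>\<^sup>+\<omega>. ennreal ((X i \<omega> + c * X' i \<omega> - (Z \<omega> + c * Z' \<omega>))\<^sup>2) \<partial>N) \<le> ?h i" for i
  proof -
    have "(X i \<omega> + c * X' i \<omega> - (Z \<omega> + c * Z' \<omega>))\<^sup>2
      \<le> 2 * (X i \<omega> - Z \<omega>)\<^sup>2 + 2 * c\<^sup>2 * (X' i \<omega> - Z' \<omega>)\<^sup>2" for \<omega>
    proof -
      have "0 \<le> ((X i \<omega> - Z \<omega>) - c * (X' i \<omega> - Z' \<omega>))\<^sup>2" by simp
      then show ?thesis by (simp add: power2_eq_square algebra_simps)
    qed
    then have "(\<integral>\<^sup>+\<omega>. ennreal ((X i \<omega> + c * X' i \<omega> - (Z \<omega> + c * Z' \<omega>))\<^sup>2) \<partial>N)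
      \<le> (\<integral>\<^sup>+\<omega>. ennreal (2 * (X i \<omega> - Z \<omega>)\<^sup>2 + 2 * c\<^sup>2 * (X' i \<omega> - Z' \<omega>)\<^sup>2) \<partial>N)"
      by (intro nn_integral_mono ennreal_leI)
    also have "\<dots> = (\<integral>\<^sup>+\<omega>. ennreal 2 * ennreal ((X i \<omega> - Z \<omega>)\<^sup>2)
        + ennreal (2 * c\<^sup>2) * ennreal ((X' i \<omega> - Z' \<omega>)\<^sup>2) \<partial>N)"
      by (simp add: ennreal_plus ennreal_mult')
    also have "\<dots> = ?h i"
      by (simp add: nn_integral_add nn_integral_cmult)
    finally show ?thesis .
  qed
  show ?thesis
    unfolding L2_lim_def using tendsto_0_ennreal_le[OF h b] by simp
qed

text \<open>A Schur test. The square of the integral becomes a double integral, Fubini brings in the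
  covariance C, and |g x g y| \<le> ((g x)^2 + (g y)^2)/2 with C nonnegative and symmetric leaves
  the bound B on its row integrals. The uniform bound D on the second moments provides the absolute
  convergence behind Fubini and does not enter the estimate.\<close>

lemma (in prob_space) second_moment_integral_le:
  fixes X :: "real \<Rightarrow> 'a \<Rightarrow> real" and g :: "real \<Rightarrow> real"
  assumes [measurable]: "(\<lambda>(\<omega>, x). X x \<omega>) \<in> borel_measurable (M \<Otimes>\<^sub>M lborel)"
    and g: "integrable lborel g"
    and X2: "\<And>x. integrable M (\<lambda>\<omega>. (X x \<omega>)\<^sup>2)" "\<And>x. expectation (\<lambda>\<omega>. (X x \<omega>)\<^sup>2) \<le> D"
    and nonneg: "\<And>x y. 0 \<le> expectation (\<lambda>\<omega>. X x \<omega> * X y \<omega>)"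
    and B: "\<And>x. (\<integral>\<^sup>+y. ennreal (expectation (\<lambda>\<omega>. X x \<omega> * X y \<omega>)) \<partial>lborel) \<le> B"
  shows "AE \<omega> in M. integrable lborel (\<lambda>x. X x \<omega> * g x)"
    and "(\<integral>\<^sup>+\<omega>. ennreal ((\<integral>x. X x \<omega> * g x \<partial>lborel)\<^sup>2) \<partial>M) \<le> B * (\<integral>\<^sup>+x. ennreal ((g x)\<^sup>2) \<partial>lborel)"
proof -
  interpret P: pair_sigma_finite M lborel ..
  interpret Q: pair_sigma_finite M "lborel \<Otimes>\<^sub>M (lborel :: real measure)" ..
  have [measurable]: "g \<in> borel_measurable borel" using g by auto
  have mX[measurable]: "X x \<in> borel_measurable M" for x
    using measurable_Pair1[OF assms(1)] by simp
  have D: "0 \<le> D" using order_trans[OF _ X2(2)[of 0]] by simp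
  define C where "C x y = expectation (\<lambda>\<omega>. X x \<omega> * X y \<omega>)" for x y
  have iXX: "integrable M (\<lambda>\<omega>. X x \<omega> * X y \<omega>)" for x y
    by (rule integrable_mult_of_squares) (use X2 in auto)
  have absXX: "(\<integral>\<^sup>+\<omega>. ennreal \<bar>X x \<omega> * X y \<omega>\<bar> \<partial>M) \<le> ennreal D" for x y
  proof -
    have "\<bar>X x \<omega> * X y \<omega>\<bar> \<le> ((X x \<omega>)\<^sup>2 + (X y \<omega>)\<^sup>2) / 2" for \<omega>
      using sum_squares_bound[of "X x \<omega>" "X y \<omega>"] sum_squares_bound[of "X x \<omega>" "- X y \<omega>"]
      by (simp add: abs_le_iff)
    then have "(\<integral>\<^sup>+\<omega>. ennreal \<bar>X x \<omega> * X y \<omega>\<bar> \<partial>M) \<le> (\<integral>\<^sup>+\<omega>. ennreal (((X x \<omega>)\<^sup>2 + (X y \<omega>)\<^sup>2) / 2) \<partial>M)"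
      by (intro nn_integral_mono ennreal_leI)
    also have "\<dots> = ennreal (expectation (\<lambda>\<omega>. ((X x \<omega>)\<^sup>2 + (X y \<omega>)\<^sup>2) / 2))"
      using X2 by (intro nn_integral_eq_integral) auto
    also have "\<dots> \<le> ennreal D"
      using X2(1) X2(2)[of x] X2(2)[of y] by (intro ennreal_leI) simp
    finally show ?thesis .
  qed
  define I where "I = (\<integral>\<^sup>+x. ennreal \<bar>g x\<bar> \<partial>lborel)"
  have I: "I < \<infinity>"
    using g by (simp add: I_def integrable_iff_bounded)
  \<comment> \<open>Only second moments of X x are controlled; |X| \<le> 1 + X^2 supplies the first
    ones.\<close>
  have "integrable (M \<Otimes>\<^sub>M lborel) (\<lambda>(\<omega>, x). X x \<omega> * g x)"
  proof (rule integrableI_bounded)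
    have "(\<integral>\<^sup>+p. ennreal (norm (case p of (\<omega>, x) \<Rightarrow> X x \<omega> * g x)) \<partial>(M \<Otimes>\<^sub>M lborel))
      = (\<integral>\<^sup>+x. \<integral>\<^sup>+\<omega>. ennreal \<bar>X x \<omega> * g x\<bar> \<partial>M \<partial>lborel)"
      by (subst P.nn_integral_snd[symmetric]) auto
    also have "\<dots> \<le> (\<integral>\<^sup>+x. ennreal (1 + D) * ennreal \<bar>g x\<bar> \<partial>lborel)"
    proof (rule nn_integral_mono)
      fix x
      have b: "\<bar>X x \<omega>\<bar> \<le> 1 + \<bar>X x \<omega> * X x \<omega>\<bar>" for \<omega>
        using sum_squares_bound[of "\<bar>X x \<omega>\<bar>" "1"] by (simp add: power2_eq_square)
      have "(\<integral>\<^sup>+\<omega>. ennreal \<bar>X x \<omega> * g x\<bar> \<partial>M) = (\<integral>\<^sup>+\<omega>. ennreal \<bar>X x \<omega>\<bar> * ennreal \<bar>g x\<bar> \<partial>M)"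
        by (simp add: abs_mult ennreal_mult)
      also have "\<dots> \<le> (\<integral>\<^sup>+\<omega>. (1 + ennreal \<bar>X x \<omega> * X x \<omega>\<bar>) * ennreal \<bar>g x\<bar> \<partial>M)"
        using ennreal_leI[OF b] by (intro nn_integral_mono mult_right_mono) (auto simp: ennreal_plus)
      also have "\<dots> = (\<integral>\<^sup>+\<omega>. 1 + ennreal \<bar>X x \<omega> * X x \<omega>\<bar> \<partial>M) * ennreal \<bar>g x\<bar>"
        by (rule nn_integral_multc) simp
      also have "(\<integral>\<^sup>+\<omega>. 1 + ennreal \<bar>X x \<omega> * X x \<omega>\<bar> \<partial>M) = 1 + (\<integral>\<^sup>+\<omega>. ennreal \<bar>X x \<omega> * X x \<omega>\<bar> \<partial>M)"
        by (subst nn_integral_add) (auto simp: emeasure_space_1)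
      also have "\<dots> \<le> ennreal (1 + D)"
        using absXX[of x x] D by (simp add: ennreal_plus)
      finally show "(\<integral>\<^sup>+\<omega>. ennreal \<bar>X x \<omega> * g x\<bar> \<partial>M) \<le> ennreal (1 + D) * ennreal \<bar>g x\<bar>"
        by (simp add: mult_right_mono)
    qed
    also have "\<dots> = ennreal (1 + D) * I"
      unfolding I_def by (rule nn_integral_cmult) simp
    also have "\<dots> < \<infinity>" using I by (simp add: ennreal_mult_less_top)
    finally show "(\<integral>\<^sup>+p. ennreal (norm (case p of (\<omega>, x) \<Rightarrow> X x \<omega> * g x)) \<partial>(M \<Otimes>\<^sub>M lborel)) < \<infinity>" .
  qed simp
  from P.AE_integrable_fst'[OF this]
  show AE1: "AE \<omega> in M. integrable lborel (\<lambda>x. X x \<omega> * g x)" by simp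

  \<comment> \<open>The absolute integral of G over the triple product is at most D times the
    squared L1 norm of g, which licenses exchanging the expectation with the double
    integral.\<close>
  define G where "G = (\<lambda>(\<omega>, x, y). (X x \<omega> * g x) * (X y \<omega> * g y))"
  have [measurable]: "G \<in> borel_measurable (M \<Otimes>\<^sub>M (lborel \<Otimes>\<^sub>M lborel))"
    unfolding G_def by measurable
  have "(\<integral>\<^sup>+q. ennreal (norm (G q)) \<partial>(M \<Otimes>\<^sub>M (lborel \<Otimes>\<^sub>M lborel)))
      = (\<integral>\<^sup>+p. \<integral>\<^sup>+\<omega>. ennreal (norm (G (\<omega>, p))) \<partial>M \<partial>(lborel \<Otimes>\<^sub>M lborel))"
    by (subst Q.nn_integral_snd[symmetric]) auto
  also have "\<dots> \<le> (\<integral>\<^sup>+p. ennreal D * (ennreal \<bar>g (fst p)\<bar> * ennreal \<bar>g (snd p)\<bar>) \<partial>(lborel \<Otimes>\<^sub>M lborel))"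
  proof (rule nn_integral_mono)
    fix p :: "real \<times> real"
    obtain x y where p: "p = (x, y)" by (cases p)
    have "(\<integral>\<^sup>+\<omega>. ennreal (norm (G (\<omega>, p))) \<partial>M)
        = (\<integral>\<^sup>+\<omega>. ennreal \<bar>X x \<omega> * X y \<omega>\<bar> * (ennreal \<bar>g x\<bar> * ennreal \<bar>g y\<bar>) \<partial>M)"
      by (simp add: G_def p abs_mult ennreal_mult[symmetric] mult_ac)
    also have "\<dots> = (\<integral>\<^sup>+\<omega>. ennreal \<bar>X x \<omega> * X y \<omega>\<bar> \<partial>M) * (ennreal \<bar>g x\<bar> * ennreal \<bar>g y\<bar>)"
      by (rule nn_integral_multc) simp
    also have "\<dots> \<le> ennreal D * (ennreal \<bar>g x\<bar> * ennreal \<bar>g y\<bar>)"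
      by (intro mult_right_mono absXX) simp
    finally show "(\<integral>\<^sup>+\<omega>. ennreal (norm (G (\<omega>, p))) \<partial>M)
        \<le> ennreal D * (ennreal \<bar>g (fst p)\<bar> * ennreal \<bar>g (snd p)\<bar>)" by (simp add: p)
  qed
  also have "\<dots> = ennreal D * (I * I)"
    by (subst lborel.nn_integral_fst[symmetric])
       (simp_all add: nn_integral_cmult nn_integral_multc I_def)
  also have "\<dots> < \<infinity>"
    using I by (simp add: ennreal_mult_less_top)
  finally have iG: "integrable (M \<Otimes>\<^sub>M (lborel \<Otimes>\<^sub>M lborel)) G"
    by (intro integrableI_bounded) auto

  have "AE \<omega> in M. integrable (lborel \<Otimes>\<^sub>M lborel) (\<lambda>p. G (\<omega>, p))"
    by (rule Q.AE_integrable_fst'[OF iG])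
  then have sq: "AE \<omega> in M. (\<integral>p. G (\<omega>, p) \<partial>(lborel \<Otimes>\<^sub>M lborel)) = (\<integral>x. X x \<omega> * g x \<partial>lborel)\<^sup>2"
  proof eventually_elim
    case (elim \<omega>)
    have "(\<integral>p. G (\<omega>, p) \<partial>(lborel \<Otimes>\<^sub>M lborel)) = (\<integral>x. \<integral>y. (X x \<omega> * g x) * (X y \<omega> * g y) \<partial>lborel \<partial>lborel)"
      using lborel_pair.integral_fst'[OF elim] by (simp add: G_def)
    then show ?case by (simp add: power2_eq_square)
  qed
  have iU: "integrable M (\<lambda>\<omega>. \<integral>p. G (\<omega>, p) \<partial>(lborel \<Otimes>\<^sub>M lborel))"
    by (rule Q.integrable_fst'[OF iG])
  have Cm[measurable]: "(\<lambda>p. C (fst p) (snd p)) \<in> borel_measurable (lborel \<Otimes>\<^sub>M lborel)"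
    unfolding C_def by measurable
  have Csym: "C x y = C y x" for x y by (simp add: C_def mult.commute)
  have C0: "0 \<le> C x y" for x y using nonneg by (simp add: C_def)
  have EG: "expectation (\<lambda>\<omega>. G (\<omega>, p)) = C (fst p) (snd p) * (g (fst p) * g (snd p))" for p
  proof -
    have "expectation (\<lambda>\<omega>. G (\<omega>, p))
      = expectation (\<lambda>\<omega>. (X (fst p) \<omega> * X (snd p) \<omega>) * (g (fst p) * g (snd p)))"
      by (simp add: G_def case_prod_beta mult_ac)
    then show ?thesis by (simp add: C_def)
  qed
  have iC: "integrable (lborel \<Otimes>\<^sub>M lborel) (\<lambda>p. C (fst p) (snd p) * (g (fst p) * g (snd p)))"
  proof -
    have "integrable (M \<Otimes>\<^sub>M (lborel \<Otimes>\<^sub>M lborel)) (case_prod (\<lambda>\<omega> p. G (\<omega>, p)))" using iG by simp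
    from Q.integrable_snd[OF this] show ?thesis by (simp add: EG)
  qed
  have "(\<integral>\<^sup>+\<omega>. ennreal ((\<integral>x. X x \<omega> * g x \<partial>lborel)\<^sup>2) \<partial>M)
      = (\<integral>\<^sup>+\<omega>. ennreal (\<integral>p. G (\<omega>, p) \<partial>(lborel \<Otimes>\<^sub>M lborel)) \<partial>M)"
    using sq by (intro nn_integral_cong_AE) (auto elim!: eventually_mono)
  also have "\<dots> = ennreal (expectation (\<lambda>\<omega>. \<integral>p. G (\<omega>, p) \<partial>(lborel \<Otimes>\<^sub>M lborel)))"
    using iU sq by (intro nn_integral_eq_integral) (auto elim!: eventually_mono)
  also have "expectation (\<lambda>\<omega>. \<integral>p. G (\<omega>, p) \<partial>(lborel \<Otimes>\<^sub>M lborel))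
      = (\<integral>p. expectation (\<lambda>\<omega>. G (\<omega>, p)) \<partial>(lborel \<Otimes>\<^sub>M lborel))"
    using Q.Fubini_integral[of "\<lambda>\<omega> p. G (\<omega>, p)"] iG by simp
  also have "ennreal \<dots> \<le> ennreal (\<integral>p. \<bar>C (fst p) (snd p) * (g (fst p) * g (snd p))\<bar> \<partial>(lborel \<Otimes>\<^sub>M lborel))"
    unfolding EG using iC by (intro ennreal_leI integral_mono) auto
  also have "\<dots> = (\<integral>\<^sup>+p. ennreal \<bar>C (fst p) (snd p) * (g (fst p) * g (snd p))\<bar> \<partial>(lborel \<Otimes>\<^sub>M lborel))"
    using iC by (intro nn_integral_eq_integral[symmetric]) auto
  \<comment> \<open>The Schur step: each half of the symmetric bound keeps the full weight C and the
    square of only one of the two values of g.\<close>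
  also have "\<dots> \<le> (\<integral>\<^sup>+p. ennreal (C (fst p) (snd p)) * ennreal ((g (fst p))\<^sup>2 / 2)
      + ennreal (C (fst p) (snd p)) * ennreal ((g (snd p))\<^sup>2 / 2) \<partial>(lborel \<Otimes>\<^sub>M lborel))"
  proof (rule nn_integral_mono)
    fix p :: "real \<times> real"
    have "\<bar>g (fst p) * g (snd p)\<bar> \<le> (g (fst p))\<^sup>2 / 2 + (g (snd p))\<^sup>2 / 2"
      using sum_squares_bound[of "g (fst p)" "g (snd p)"] sum_squares_bound[of "g (fst p)" "- g (snd p)"]
      by (simp add: abs_le_iff)
    then have "\<bar>C (fst p) (snd p) * (g (fst p) * g (snd p))\<bar>
        \<le> C (fst p) (snd p) * ((g (fst p))\<^sup>2 / 2) + C (fst p) (snd p) * ((g (snd p))\<^sup>2 / 2)"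
      using C0 by (simp only: abs_mult[of "C (fst p) (snd p)"] abs_of_nonneg distrib_left[symmetric] mult_left_mono)
    from ennreal_leI[OF this]
    show "ennreal \<bar>C (fst p) (snd p) * (g (fst p) * g (snd p))\<bar>
        \<le> ennreal (C (fst p) (snd p)) * ennreal ((g (fst p))\<^sup>2 / 2)
          + ennreal (C (fst p) (snd p)) * ennreal ((g (snd p))\<^sup>2 / 2)"
      using C0 by (simp add: ennreal_plus ennreal_mult[symmetric])
  qed
  also have "\<dots> = (\<integral>\<^sup>+x. \<integral>\<^sup>+y. ennreal (C x y) * ennreal ((g x)\<^sup>2 / 2) \<partial>lborel \<partial>lborel)
      + (\<integral>\<^sup>+y. \<integral>\<^sup>+x. ennreal (C x y) * ennreal ((g y)\<^sup>2 / 2) \<partial>lborel \<partial>lborel)"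
  proof -
    have m: "(\<lambda>p. ennreal (C (fst p) (snd p)) * ennreal ((g (fst p))\<^sup>2 / 2)) \<in> borel_measurable (lborel \<Otimes>\<^sub>M lborel)"
      "(\<lambda>(x, y). ennreal (C x y) * ennreal ((g y)\<^sup>2 / 2)) \<in> borel_measurable (lborel \<Otimes>\<^sub>M lborel)"
      using Cm by (simp_all add: case_prod_beta)
    then show ?thesis
      using lborel.nn_integral_fst[OF m(1)] lborel_pair.nn_integral_snd[OF m(2)]
      by (simp add: nn_integral_add split_beta')
  qed
  also have "\<dots> = (\<integral>\<^sup>+x. \<integral>\<^sup>+y. ennreal (C x y) * ennreal ((g x)\<^sup>2 / 2) \<partial>lborel \<partial>lborel)
      + (\<integral>\<^sup>+x. \<integral>\<^sup>+y. ennreal (C x y) * ennreal ((g x)\<^sup>2 / 2) \<partial>lborel \<partial>lborel)"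
    by (simp only: Csym)
  also have "\<dots> \<le> (\<integral>\<^sup>+x. B * ennreal ((g x)\<^sup>2 / 2) \<partial>lborel) + (\<integral>\<^sup>+x. B * ennreal ((g x)\<^sup>2 / 2) \<partial>lborel)"
  proof -
    have [measurable]: "(\<lambda>y. C x y) \<in> borel_measurable borel" for x
      using measurable_Pair2[OF Cm] by simp
    have "(\<integral>\<^sup>+y. ennreal (C x y) * ennreal ((g x)\<^sup>2 / 2) \<partial>lborel) \<le> B * ennreal ((g x)\<^sup>2 / 2)" for x
      using B[of x] by (subst nn_integral_multc) (auto simp: C_def intro!: mult_right_mono)
    then show ?thesis by (intro add_mono nn_integral_mono)
  qed
  also have "\<dots> = B * (\<integral>\<^sup>+x. ennreal ((g x)\<^sup>2 / 2) + ennreal ((g x)\<^sup>2 / 2) \<partial>lborel)"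
    by (simp add: nn_integral_cmult nn_integral_add distrib_left)
  also have "(\<integral>\<^sup>+x. ennreal ((g x)\<^sup>2 / 2) + ennreal ((g x)\<^sup>2 / 2) \<partial>lborel) = (\<integral>\<^sup>+x. ennreal ((g x)\<^sup>2) \<partial>lborel)"
    by (simp add: ennreal_plus[symmetric] del: ennreal_plus)
  finally show "(\<integral>\<^sup>+\<omega>. ennreal ((\<integral>x. X x \<omega> * g x \<partial>lborel)\<^sup>2) \<partial>M)
      \<le> B * (\<integral>\<^sup>+x. ennreal ((g x)\<^sup>2) \<partial>lborel)" .
qed

subsection \<open>White noise\<close>

text \<open>Only one-dimensional laws are prescribed. Since every realization is linear on Schwartz
  functions, they already determine the joint Gaussian moments used below.\<close>

definition white_noise ::
    "'w measure \<Rightarrow> real \<Rightarrow> ('w \<Rightarrow> (real \<Rightarrow> real) \<Rightarrow> real) \<Rightarrow> bool" where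
  "white_noise M v \<Lambda> \<longleftrightarrow> (\<forall>\<omega>\<in>space M. tempered_distribution (\<Lambda> \<omega>)) \<and>
     (\<forall>f. schwartz f \<longrightarrow> centered_gaussian M (\<lambda>\<omega>. \<Lambda> \<omega> f) (v * L2_norm_sq f))"

lemma tempered_distribution_lincomb:
  assumes "tempered_distribution \<Lambda>" "schwartz f" "schwartz g"
  shows "\<Lambda> (\<lambda>x. f x + c * g x) = \<Lambda> f + c * \<Lambda> g"
proof -
  have "\<Lambda> (\<lambda>x. f x + c * g x) = \<Lambda> f + \<Lambda> (\<lambda>x. c * g x)"
    using assms schwartz_cmult[OF assms(3), of c] unfolding tempered_distribution_def by metis
  then show ?thesis
    using assms unfolding tempered_distribution_def by simp
qed

lemma tempered_distribution_cmult:
  "tempered_distribution \<Lambda> \<Longrightarrow> schwartz f \<Longrightarrow> \<Lambda> (\<lambda>x. c * f x) = c * \<Lambda> f"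
  unfolding tempered_distribution_def by blast

lemma tempered_distribution_divide:
  "tempered_distribution \<Lambda> \<Longrightarrow> schwartz f \<Longrightarrow> \<Lambda> (\<lambda>x. f x / c) = \<Lambda> f / c"
  using tempered_distribution_cmult[of \<Lambda> f "1 / c"] by simp

lemma L2_lim_cong:
  assumes "\<And>i \<omega>. \<omega> \<in> space M \<Longrightarrow> X i \<omega> = X' i \<omega>" "L2_lim M X Z F"
  shows "L2_lim M X' Z F"
proof -
  have "(\<integral>\<^sup>+\<omega>. ennreal ((X' i \<omega> - Z \<omega>)\<^sup>2) \<partial>M) = (\<integral>\<^sup>+\<omega>. ennreal ((X i \<omega> - Z \<omega>)\<^sup>2) \<partial>M)" for i
    using assms(1) by (intro nn_integral_cong) simp
  then show ?thesis using assms(2) by (simp add: L2_lim_def)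
qed

lemma white_noise_measurable:
  "white_noise M v \<Lambda> \<Longrightarrow> schwartz f \<Longrightarrow> (\<lambda>\<omega>. \<Lambda> \<omega> f) \<in> borel_measurable M"
  by (simp add: white_noise_def centered_gaussian_def)

text \<open>Linearity of \<Lambda> is available on Schwartz functions only, so it is applied to the
  approximants of g and g' before the limit.\<close>

lemma L2_extension_lincomb:
  assumes w: "white_noise M v \<Lambda>"
    and "L2_extension M \<Lambda> g Z" "L2_extension M \<Lambda> g' Z'"
  shows "L2_extension M \<Lambda> (\<lambda>x. g x + c * g' x) (\<lambda>\<omega>. Z \<omega> + c * Z' \<omega>)"
proof -
  obtain \<phi> \<phi>' where s: "\<And>n::nat. schwartz (\<phi> n)" "\<And>n::nat. schwartz (\<phi>' n)"
    and l: "L2_lim lborel \<phi> g sequentially" "L2_lim lborel \<phi>' g' sequentially"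
      "L2_lim M (\<lambda>n \<omega>. \<Lambda> \<omega> (\<phi> n)) Z sequentially" "L2_lim M (\<lambda>n \<omega>. \<Lambda> \<omega> (\<phi>' n)) Z' sequentially"
    using assms(2,3) unfolding L2_extension_def by metis
  have "L2_lim lborel (\<lambda>n x. \<phi> n x + c * \<phi>' n x) (\<lambda>x. g x + c * g' x) sequentially"
    using schwartz_measurable[OF s(1)] schwartz_measurable[OF s(2)] l(1,2) by (intro L2_lim_lincomb) auto
  moreover have "L2_lim M (\<lambda>n \<omega>. \<Lambda> \<omega> (\<phi> n) + c * \<Lambda> \<omega> (\<phi>' n)) (\<lambda>\<omega>. Z \<omega> + c * Z' \<omega>) sequentially"
    using l(3,4) by (intro L2_lim_lincomb white_noise_measurable[OF w] s)
  then have "L2_lim M (\<lambda>n \<omega>. \<Lambda> \<omega> (\<lambda>x. \<phi> n x + c * \<phi>' n x)) (\<lambda>\<omega>. Z \<omega> + c * Z' \<omega>) sequentially"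
    using w s by (elim L2_lim_cong[rotated])
      (simp add: white_noise_def tempered_distribution_lincomb)
  moreover have "schwartz (\<lambda>x. \<phi> n x + c * \<phi>' n x)" for n
    using schwartz_lincomb[OF s(1)[of n] s(2)[of n], of 1 c] by simp
  ultimately show ?thesis
    unfolding L2_extension_def by (intro exI[of _ "\<lambda>n x. \<phi> n x + c * \<phi>' n x"]) auto
qed

lemma L2_extension_square_integrable:
  assumes "L2_extension M \<Lambda> g Z"
  shows "g \<in> borel_measurable borel" "integrable lborel (\<lambda>x. (g x)\<^sup>2)"
proof -
  obtain \<phi> where s: "\<And>n::nat. schwartz (\<phi> n)" and l: "L2_lim lborel \<phi> g sequentially"
    using assms unfolding L2_extension_def by metis
  show "g \<in> borel_measurable borel" using l by (simp add: L2_lim_def)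
  show "integrable lborel (\<lambda>x. (g x)\<^sup>2)"
    by (rule L2_lim_square_integrable[OF l])
      (use schwartz_measurable[OF s] schwartz_square_integrable[OF s] in auto)
qed

text \<open>The approximating evaluations are Gaussian with variance v times the squared norms of
  the approximants, and these norms converge.\<close>

lemma (in prob_space) L2_extension_centered_gaussian:
  assumes w: "white_noise M v \<Lambda>" and "L2_extension M \<Lambda> g Z"
  shows "centered_gaussian M Z (v * L2_norm_sq g)"
proof -
  obtain \<phi> where s: "\<And>n::nat. schwartz (\<phi> n)"
    and l: "L2_lim lborel \<phi> g sequentially" "L2_lim M (\<lambda>n \<omega>. \<Lambda> \<omega> (\<phi> n)) Z sequentially"
    using assms(2) unfolding L2_extension_def by metis
  have "(\<lambda>n. L2_norm_sq (\<phi> n)) \<longlonglongrightarrow> L2_norm_sq g"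
    unfolding L2_norm_sq_def
    by (rule tendsto_integral_square_L2_lim[OF l(1)])
      (use schwartz_measurable[OF s] schwartz_square_integrable[OF s] in auto)
  from tendsto_mult_left[OF this, of v]
  show ?thesis
    by (rule L2_lim_centered_gaussian[OF l(2), rotated]) (use w s in \<open>simp add: white_noise_def\<close>)
qed

text \<open>Z + Z' and Z - Z' extend \<Lambda> at g + g' and g - g', hence are Gaussian with
  variances v (2 H + 2 <g, g'>) and v (2 H - 2 <g, g'>). This stands in for joint Gaussianity and is
  what Wick's formula asks for.\<close>

lemma (in prob_space) L2_extension_square_covariance:
  assumes w: "white_noise M v \<Lambda>" and g: "L2_extension M \<Lambda> g Z" and g': "L2_extension M \<Lambda> g' Z'"
    and H: "L2_norm_sq g = H" "L2_norm_sq g' = H"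
  shows "integrable M (\<lambda>\<omega>. ((Z \<omega>)\<^sup>2 - v * H) * ((Z' \<omega>)\<^sup>2 - v * H))"
    and "expectation (\<lambda>\<omega>. ((Z \<omega>)\<^sup>2 - v * H) * ((Z' \<omega>)\<^sup>2 - v * H)) = 2 * (v * L2_inner g g')\<^sup>2"
proof -
  note i = L2_extension_square_integrable[OF g] L2_extension_square_integrable[OF g']
  have gg: "integrable lborel (\<lambda>x. g x * g' x)"
    by (rule integrable_mult_of_squares) (use i in auto)
  have "L2_norm_sq (\<lambda>x. g x + c * g' x) = H + c\<^sup>2 * H + 2 * c * L2_inner g g'" for c
  proof -
    have "L2_norm_sq (\<lambda>x. g x + c * g' x) = (LBINT x. (g x)\<^sup>2 + c\<^sup>2 * (g' x)\<^sup>2 + 2 * c * (g x * g' x))"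
      unfolding L2_norm_sq_def
      by (intro Bochner_Integration.integral_cong) (simp_all add: power2_eq_square algebra_simps)
    also have "\<dots> = H + c\<^sup>2 * H + 2 * c * L2_inner g g'"
      using i gg H by (simp add: L2_norm_sq_def L2_inner_def)
    finally show ?thesis .
  qed
  from this[of 1] this[of "-1"] have N: "L2_norm_sq (\<lambda>x. g x + g' x) = 2 * H + 2 * L2_inner g g'"
    "L2_norm_sq (\<lambda>x. g x - g' x) = 2 * H - 2 * L2_inner g g'" by simp_all
  note E = L2_extension_centered_gaussian[OF w g] L2_extension_centered_gaussian[OF w g']
   L2_extension_centered_gaussian[OF w L2_extension_lincomb[OF w g g', of 1]]
   L2_extension_centered_gaussian[OF w L2_extension_lincomb[OF w g g', of "-1"]]
  have *: "centered_gaussian M Z (v * H)" "centered_gaussian M Z' (v * H)"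
    "centered_gaussian M (\<lambda>\<omega>. Z \<omega> + Z' \<omega>) (2 * (v * H) + 2 * (v * L2_inner g g'))"
    "centered_gaussian M (\<lambda>\<omega>. Z \<omega> - Z' \<omega>) (2 * (v * H) - 2 * (v * L2_inner g g'))"
    using E by (simp_all add: N H algebra_simps)
  show "integrable M (\<lambda>\<omega>. ((Z \<omega>)\<^sup>2 - v * H) * ((Z' \<omega>)\<^sup>2 - v * H))"
    "expectation (\<lambda>\<omega>. ((Z \<omega>)\<^sup>2 - v * H) * ((Z' \<omega>)\<^sup>2 - v * H)) = 2 * (v * L2_inner g g')\<^sup>2"
    using gaussian_covariance_squares[OF *] by simp_all
qed

text \<open>Both variables are needed: together, the mass in the centre y and the mass in z give the
  correlation function of the mollifier total integral 1.\<close>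

lemma nn_integral_mollifier:
  assumes h: "mollifier h" and e: "\<epsilon> > 0"
  shows "(\<integral>\<^sup>+y. ennreal (h ((z - y) / \<epsilon>) / \<epsilon>) \<partial>lborel) = 1"
    and "(\<integral>\<^sup>+z. ennreal (h ((z - y) / \<epsilon>) / \<epsilon>) \<partial>lborel) = 1"
proof -
  have h0: "\<And>x. 0 \<le> h x" and ih: "integrable lborel h" and h1: "(LBINT x. h x) = 1"
    using h by (auto simp: mollifier_def)
  have [measurable]: "h \<in> borel_measurable borel" using ih by auto
  have "(\<integral>\<^sup>+x. ennreal (h x) \<partial>lborel) = 1"
    using ih h0 h1 by (simp add: nn_integral_eq_integral)
  then have c: "\<bar>c\<bar> * (\<integral>\<^sup>+x. ennreal (h (t + c * x)) \<partial>lborel) = 1" if "c \<noteq> 0" for c t :: real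
    using nn_integral_real_affine[of "\<lambda>x. ennreal (h x)" c t] that by simp
  have d: "(\<integral>\<^sup>+y. ennreal (h (l y) / \<epsilon>) \<partial>lborel) = ennreal (1 / \<epsilon>) * (\<integral>\<^sup>+y. ennreal (h (l y)) \<partial>lborel)"
    if [measurable]: "l \<in> borel_measurable borel" for l :: "real \<Rightarrow> real"
    using e by (subst nn_integral_cmult[symmetric]) (auto simp: ennreal_mult[symmetric] h0)
  show "(\<integral>\<^sup>+y. ennreal (h ((z - y) / \<epsilon>) / \<epsilon>) \<partial>lborel) = 1"
    using c[of "- 1 / \<epsilon>" "z / \<epsilon>"] e by (simp add: d diff_divide_distrib)
  show "(\<integral>\<^sup>+z. ennreal (h ((z - y) / \<epsilon>) / \<epsilon>) \<partial>lborel) = 1"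
    using c[of "1 / \<epsilon>" "- y / \<epsilon>"] e by (simp add: d diff_divide_distrib)
qed

lemma L2_norm_sq_mollifier:
  assumes e: "\<epsilon> > 0"
  shows "L2_norm_sq (\<lambda>z. h ((z - x) / \<epsilon>) / \<epsilon>) = L2_norm_sq h / \<epsilon>"
proof -
  have "L2_norm_sq h = (1 / \<epsilon>) * (LBINT z. (h ((z - x) / \<epsilon>))\<^sup>2)"
    using lborel_integral_real_affine[of "1 / \<epsilon>" "\<lambda>x. (h x)\<^sup>2" "- x / \<epsilon>"] e
    by (simp add: L2_norm_sq_def diff_divide_distrib)
  then show ?thesis
    using e by (simp add: L2_norm_sq_def power_divide power2_eq_square)
qed

text \<open>The mean of \<open>(W x)\<^sup>2\<close> does not depend on \<open>x\<close>, so it drops out against the derivative of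
  \<open>f\<close>; by Wick's formula the covariance that is left is the square of the
  correlation function of the mollifier.\<close>

lemma (in prob_space) mollified_square_variance:
  assumes h: "mollifier h" and e: "\<epsilon> > 0" and w: "white_noise M v \<Lambda>" and f: "schwartz f"
    and [measurable]: "(\<lambda>(\<omega>, x). W x \<omega>) \<in> borel_measurable (M \<Otimes>\<^sub>M lborel)"
    and W: "\<And>x. L2_extension M \<Lambda> (\<lambda>z. h ((z - x) / \<epsilon>) / \<epsilon>) (W x)"
  shows "(\<integral>\<^sup>+\<omega>. ennreal ((LBINT x. (W x \<omega>)\<^sup>2 * deriv f x)\<^sup>2) \<partial>M)
    \<le> ennreal (2 * v\<^sup>2 * (L2_norm_sq h / \<epsilon>) * L2_norm_sq (deriv f))"
proof -
  \<comment> \<open>\<open>k x\<close> is the mollifier centred at x. Translation invariance makes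
    its squared norm H independent of x, so every W x has the same variance v * H.\<close>
  define k where "k x z = h ((z - x) / \<epsilon>) / \<epsilon>" for x z
  define H where "H = L2_norm_sq h / \<epsilon>"
  define K where "K x y = L2_inner (k x) (k y)" for x y
  have kH: "L2_norm_sq (k x) = H" for x
    unfolding k_def H_def using e by (rule L2_norm_sq_mollifier)
  have k0: "0 \<le> k x z" for x z using h e by (simp add: k_def mollifier_def)
  have [measurable]: "h \<in> borel_measurable borel" using h by (auto simp: mollifier_def)
  have [measurable]: "case_prod k \<in> borel_measurable (lborel \<Otimes>\<^sub>M lborel)"
    unfolding k_def by measurable
  have W': "L2_extension M \<Lambda> (k x) (W x)" for x unfolding k_def by (rule W)
  note k2 = L2_extension_square_integrable[OF W']
  have ikk: "integrable lborel (\<lambda>z. k x z * k y z)" for x y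
    by (rule integrable_mult_of_squares) (use k2 in auto)
  have K0: "0 \<le> K x y" for x y by (simp add: K_def L2_inner_def k0)
  have KH: "K x y \<le> H" for x y
  proof -
    have "K x y \<le> (LBINT z. ((k x z)\<^sup>2 + (k y z)\<^sup>2) / 2)"
      unfolding K_def L2_inner_def
    proof (rule integral_mono)
      show "k x z * k y z \<le> ((k x z)\<^sup>2 + (k y z)\<^sup>2) / 2" for z
        using sum_squares_bound[of "k x z" "k y z"] by simp
    qed (use k2 ikk in auto)
    also have "\<dots> = H"
      using k2 kH by (simp add: L2_norm_sq_def)
    finally show ?thesis .
  qed
  have H0: "0 \<le> H" using K0 KH order_trans by blast
  \<comment> \<open>Tonelli: integrating out the centre y leaves the mass of
    \<open>k x\<close>.\<close>
  have K1: "(\<integral>\<^sup>+y. ennreal (K x y) \<partial>lborel) = 1" for x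
  proof -
    have "(\<integral>\<^sup>+y. ennreal (K x y) \<partial>lborel) = (\<integral>\<^sup>+y. \<integral>\<^sup>+z. ennreal (k x z) * ennreal (k y z) \<partial>lborel \<partial>lborel)"
      unfolding K_def L2_inner_def using ikk k0
      by (intro nn_integral_cong) (simp add: nn_integral_eq_integral ennreal_mult[symmetric])
    also have "\<dots> = (\<integral>\<^sup>+z. \<integral>\<^sup>+y. ennreal (k x z) * ennreal (k y z) \<partial>lborel \<partial>lborel)"
      by (rule lborel_pair.Fubini'[symmetric]) measurable
    also have "\<dots> = (\<integral>\<^sup>+z. ennreal (k x z) * (\<integral>\<^sup>+y. ennreal (k y z) \<partial>lborel) \<partial>lborel)"
      by (intro nn_integral_cong nn_integral_cmult) measurable
    also have "\<dots> = 1"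
      unfolding k_def using nn_integral_mollifier[OF h e] by simp
    finally show ?thesis .
  qed
  define X where "X x \<omega> = (W x \<omega>)\<^sup>2 - v * H" for x \<omega>
  note cov = L2_extension_square_covariance[OF w W' W' kH kH, folded K_def X_def]
  have mX: "(\<lambda>(\<omega>, x). X x \<omega>) \<in> borel_measurable (M \<Otimes>\<^sub>M lborel)"
    unfolding X_def by measurable
  have "K x x = H" for x
    unfolding kH[symmetric, of x] by (simp add: K_def L2_inner_def L2_norm_sq_def power2_eq_square)
  then have X2: "integrable M (\<lambda>\<omega>. (X x \<omega>)\<^sup>2)" "expectation (\<lambda>\<omega>. (X x \<omega>)\<^sup>2) \<le> 2 * (v * H)\<^sup>2" for x
    using cov[of x x] by (simp_all add: power2_eq_square)
  \<comment> \<open>Origin of the constant: the covariance 2 (v K)^2 is at most 2 v^2 H times K, and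
    K has total integral 1.\<close>
  have B: "(\<integral>\<^sup>+y. ennreal (expectation (\<lambda>\<omega>. X x \<omega> * X y \<omega>)) \<partial>lborel) \<le> ennreal (2 * v\<^sup>2 * H)" for x
  proof -
    have [measurable]: "K x \<in> borel_measurable borel"
      unfolding K_def L2_inner_def by measurable
    have "ennreal (expectation (\<lambda>\<omega>. X x \<omega> * X y \<omega>)) \<le> ennreal (2 * v\<^sup>2 * H) * ennreal (K x y)" for y
    proof -
      have "2 * (v * K x y)\<^sup>2 = 2 * v\<^sup>2 * (K x y * K x y)" by (simp add: power2_eq_square)
      also have "\<dots> \<le> 2 * v\<^sup>2 * (H * K x y)"
        by (intro mult_left_mono mult_right_mono KH K0) simp
      finally show ?thesis
        using H0 K0[of x y] by (simp add: cov ennreal_mult[symmetric] ennreal_leI mult.assoc)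
    qed
    then have "(\<integral>\<^sup>+y. ennreal (expectation (\<lambda>\<omega>. X x \<omega> * X y \<omega>)) \<partial>lborel)
        \<le> (\<integral>\<^sup>+y. ennreal (2 * v\<^sup>2 * H) * ennreal (K x y) \<partial>lborel)"
      by (intro nn_integral_mono)
    also have "\<dots> = ennreal (2 * v\<^sup>2 * H)"
      by (subst nn_integral_cmult) (simp_all add: K1)
    finally show ?thesis .
  qed
  have f': "integrable lborel (deriv f)" "integrable lborel (\<lambda>x. (deriv f x)\<^sup>2)"
    by (intro schwartz_integrable schwartz_square_integrable schwartz_deriv f)+
  have pos: "0 \<le> expectation (\<lambda>\<omega>. X x \<omega> * X y \<omega>)" for x y by (simp add: cov)
  note S = second_moment_integral_le[OF mX f'(1) X2 pos B]
  \<comment> \<open>Almost sure integrability of X against the derivative of f allows the constant v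
    * H to be split off; its integral against that derivative is 0.\<close>
  have "AE \<omega> in M. (LBINT x. (W x \<omega>)\<^sup>2 * deriv f x) = (LBINT x. X x \<omega> * deriv f x)"
    using S(1)
  proof eventually_elim
    case (elim \<omega>)
    then have "(LBINT x. X x \<omega> * deriv f x + v * H * deriv f x) = (LBINT x. X x \<omega> * deriv f x)"
      using f'(1) schwartz_integral_deriv[OF f] by simp
    then show ?case by (simp add: X_def algebra_simps)
  qed
  then have "(\<integral>\<^sup>+\<omega>. ennreal ((LBINT x. (W x \<omega>)\<^sup>2 * deriv f x)\<^sup>2) \<partial>M)
      = (\<integral>\<^sup>+\<omega>. ennreal ((LBINT x. X x \<omega> * deriv f x)\<^sup>2) \<partial>M)"
    by (intro nn_integral_cong_AE) (auto elim!: eventually_mono)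
  also have "\<dots> \<le> ennreal (2 * v\<^sup>2 * H) * (\<integral>\<^sup>+x. ennreal ((deriv f x)\<^sup>2) \<partial>lborel)"
    by (rule S(2))
  also have "\<dots> = ennreal (2 * v\<^sup>2 * H * L2_norm_sq (deriv f))"
    using f' H0 by (simp add: nn_integral_eq_integral L2_norm_sq_def ennreal_mult[symmetric])
  finally show ?thesis by (simp add: H_def)
qed

subsection \<open>The energy estimate at all scales\<close>

text \<open>Shaped for the telescoping A_\<epsilon> - A_\<eta> + (A_\<eta> - A_\<delta>) through an
  intermediate scale, whose first two terms are bounded separately and whose last is kept as a
  difference.\<close>

lemma nn_integral_square_sum3_le:
  fixes a b c :: "'w \<Rightarrow> real"
  assumes [measurable]: "a \<in> borel_measurable M" "b \<in> borel_measurable M" "c \<in> borel_measurable M"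
  shows "(\<integral>\<^sup>+\<omega>. ennreal ((a \<omega> - b \<omega> + c \<omega>)\<^sup>2) \<partial>M) \<le> 3 * ((\<integral>\<^sup>+\<omega>. ennreal ((a \<omega>)\<^sup>2) \<partial>M)
    + (\<integral>\<^sup>+\<omega>. ennreal ((b \<omega>)\<^sup>2) \<partial>M) + (\<integral>\<^sup>+\<omega>. ennreal ((c \<omega>)\<^sup>2) \<partial>M))"
proof -
  have "(a \<omega> - b \<omega> + c \<omega>)\<^sup>2 \<le> 3 * ((a \<omega>)\<^sup>2 + (b \<omega>)\<^sup>2 + (c \<omega>)\<^sup>2)" for \<omega>
  proof -
    have "0 \<le> (a \<omega> + b \<omega>)\<^sup>2 + (a \<omega> - c \<omega>)\<^sup>2 + (b \<omega> + c \<omega>)\<^sup>2" by simp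
    then show ?thesis by (simp add: power2_eq_square algebra_simps)
  qed
  from ennreal_leI[OF this] have "(\<integral>\<^sup>+\<omega>. ennreal ((a \<omega> - b \<omega> + c \<omega>)\<^sup>2) \<partial>M)
    \<le> (\<integral>\<^sup>+\<omega>. 3 * (ennreal ((a \<omega>)\<^sup>2) + ennreal ((b \<omega>)\<^sup>2) + ennreal ((c \<omega>)\<^sup>2)) \<partial>M)"
    by (intro nn_integral_mono) (simp add: ennreal_mult' ennreal_plus)
  also have "\<dots> = 3 * ((\<integral>\<^sup>+\<omega>. ennreal ((a \<omega>)\<^sup>2) \<partial>M)
    + (\<integral>\<^sup>+\<omega>. ennreal ((b \<omega>)\<^sup>2) \<partial>M) + (\<integral>\<^sup>+\<omega>. ennreal ((c \<omega>)\<^sup>2) \<partial>M))"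
    by (simp add: nn_integral_cmult nn_integral_add)
  finally show ?thesis .
qed

text \<open>Cauchy-Schwarz in time against the indicator of [s, t].\<close>

lemma nn_integral_square_set_integral_le:
  fixes U :: "real \<Rightarrow> real"
  assumes [measurable]: "U \<in> borel_measurable borel" and "s \<le> t"
  shows "ennreal ((LBINT r:{s..t}. U r)\<^sup>2)
    \<le> ennreal (t - s) * (\<integral>\<^sup>+r. ennreal ((U r)\<^sup>2) * indicator {s..t} r \<partial>lborel)"
proof -
  let ?i = "\<lambda>r. indicator {s..t} r :: ennreal"
  have "ennreal \<bar>LBINT r:{s..t}. U r\<bar> \<le> (\<integral>\<^sup>+r. ?i r * (ennreal \<bar>U r\<bar> * ?i r) \<partial>lborel)"
  proof (cases "set_integrable lborel {s..t} U")
    case True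
    then have "ennreal (norm (LBINT r:{s..t}. U r)) \<le> (\<integral>\<^sup>+r. ennreal (norm (indicator {s..t} r *\<^sub>R U r)) \<partial>lborel)"
      unfolding set_integrable_def set_lebesgue_integral_def by (rule integral_norm_bound_ennreal)
    also have "\<dots> = (\<integral>\<^sup>+r. ?i r * (ennreal \<bar>U r\<bar> * ?i r) \<partial>lborel)"
      by (intro nn_integral_cong) (simp add: indicator_def)
    finally show ?thesis by simp
  next
    \<comment> \<open>Without integrability the Bochner integral is 0 by convention and the bound is
      trivial.\<close>
    case False
    then show ?thesis
      by (simp add: set_integrable_def set_lebesgue_integral_def not_integrable_integral_eq)
  qed
  then have "(ennreal \<bar>LBINT r:{s..t}. U r\<bar>)\<^sup>2 \<le> (\<integral>\<^sup>+r. ?i r * (ennreal \<bar>U r\<bar> * ?i r) \<partial>lborel)\<^sup>2"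
    by (rule power_mono) simp
  also have "\<dots> \<le> (\<integral>\<^sup>+r. (?i r)\<^sup>2 \<partial>lborel) * (\<integral>\<^sup>+r. (ennreal \<bar>U r\<bar> * ?i r)\<^sup>2 \<partial>lborel)"
    by (rule Cauchy_Schwarz_nn_integral) simp_all
  also have "(\<integral>\<^sup>+r. (?i r)\<^sup>2 \<partial>lborel) = (\<integral>\<^sup>+r. ?i r \<partial>lborel)"
    by (intro nn_integral_cong) (simp add: indicator_def)
  also have "(\<integral>\<^sup>+r. (ennreal \<bar>U r\<bar> * ?i r)\<^sup>2 \<partial>lborel) = (\<integral>\<^sup>+r. ennreal ((U r)\<^sup>2) * ?i r \<partial>lborel)"
    by (intro nn_integral_cong) (simp add: indicator_def ennreal_power)
  finally show ?thesis
    using \<open>s \<le> t\<close> by (simp add: ennreal_power)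
qed

text \<open>Cauchy-Schwarz in time yields one factor t - s, and integrating the fixed-time bound
  over [s, t] yields the other. Only the law at each single time enters, not the dynamics.\<close>

lemma (in prob_space) energy_field_second_moment:
  assumes h: "mollifier h" and e: "\<epsilon> > 0" and w: "\<And>r. r \<in> {0..T} \<Longrightarrow> white_noise M v (Y r)"
    and V: "mollification M T h Y V" and f: "schwartz f" and st: "0 \<le> s" "s \<le> t" "t \<le> T"
  shows "energy_field V \<epsilon> s t (\<lambda>_. f) \<in> borel_measurable M"
    and "(\<integral>\<^sup>+\<omega>. ennreal ((energy_field V \<epsilon> s t (\<lambda>_. f) \<omega>)\<^sup>2) \<partial>M)
      \<le> ennreal (2 * v\<^sup>2 * (L2_norm_sq h / \<epsilon>) * L2_norm_sq (deriv f) * (t - s)\<^sup>2)"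
proof -
  interpret P: pair_sigma_finite M lborel ..
  \<comment> \<open>V is only known to be measurable for times in [0, T]. Clamping the time gives a
    version defined for all real times, so that product measurability and Fubini over the whole line
    apply; on [s, t] nothing changes.\<close>
  define cl where "cl r = max 0 (min T r)" for r :: real
  have clT: "cl r \<in> {0..T}" for r using st by (simp add: cl_def)
  have "cl \<in> borel_measurable borel"
    unfolding cl_def[abs_def] by measurable
  then have [measurable]: "cl \<in> borel \<rightarrow>\<^sub>M restrict_space borel {0..T}"
    by (intro measurable_restrict_space2) (use clT in auto)
  define W where "W r x \<omega> = V \<epsilon> (cl r) x \<omega>" for r x \<omega>
  have mV: "(\<lambda>(s, x, \<omega>). V \<epsilon> s x \<omega>)
      \<in> borel_measurable (restrict_space borel {0..T} \<Otimes>\<^sub>M (borel \<Otimes>\<^sub>M M))"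
    using V e by (simp add: mollification_def)
  have "(\<lambda>p. (cl (snd (fst p)), snd p, fst (fst p)))
      \<in> (M \<Otimes>\<^sub>M lborel) \<Otimes>\<^sub>M lborel \<rightarrow>\<^sub>M restrict_space borel {0..T} \<Otimes>\<^sub>M (borel \<Otimes>\<^sub>M M)"
    by measurable
  from measurable_compose[OF this mV]
  have mW: "(\<lambda>p. W (snd (fst p)) (snd p) (fst (fst p))) \<in> borel_measurable ((M \<Otimes>\<^sub>M lborel) \<Otimes>\<^sub>M lborel)"
    by (simp add: W_def)
  have "(\<lambda>p. deriv f (snd p)) \<in> borel_measurable ((M \<Otimes>\<^sub>M lborel) \<Otimes>\<^sub>M lborel)"
    by (rule measurable_compose[OF measurable_snd]) (simp add: schwartz_measurable schwartz_deriv f)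
  from borel_measurable_times[OF borel_measurable_power[OF mW, of 2] this]
  have mW2: "(\<lambda>(p, x). (W (snd p) x (fst p))\<^sup>2 * deriv f x) \<in> borel_measurable ((M \<Otimes>\<^sub>M lborel) \<Otimes>\<^sub>M lborel)"
    by (simp add: split_beta')
  define U where "U r \<omega> = (LBINT x. (W r x \<omega>)\<^sup>2 * deriv f x)" for r \<omega>
  have [measurable]: "(\<lambda>(\<omega>, r). U r \<omega>) \<in> borel_measurable (M \<Otimes>\<^sub>M lborel)"
    using lborel.borel_measurable_lebesgue_integral[OF mW2] by (simp add: U_def split_beta')
  define B where "B = 2 * v\<^sup>2 * (L2_norm_sq h / \<epsilon>) * L2_norm_sq (deriv f)"
  have B0: "0 \<le> B" using e by (simp add: B_def L2_norm_sq_nonneg)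
  have EU: "(\<integral>\<^sup>+\<omega>. ennreal ((U r \<omega>)\<^sup>2) \<partial>M) \<le> ennreal B" for r
    unfolding U_def B_def
  proof (rule mollified_square_variance[OF h e w[OF clT] f])
    have "(\<lambda>p. ((fst p, r), snd p)) \<in> M \<Otimes>\<^sub>M lborel \<rightarrow>\<^sub>M (M \<Otimes>\<^sub>M lborel) \<Otimes>\<^sub>M lborel"
      by measurable
    from measurable_compose[OF this mW]
    show "(\<lambda>(\<omega>, x). W r x \<omega>) \<in> borel_measurable (M \<Otimes>\<^sub>M lborel)" by (simp add: split_beta')
    show "L2_extension M (Y (cl r)) (\<lambda>z. h ((z - x) / \<epsilon>) / \<epsilon>) (W r x)" for x
      using V e clT[of r] by (simp add: mollification_def W_def[abs_def])
  qed
  have field: "energy_field V \<epsilon> s t (\<lambda>_. f) \<omega> = (LBINT r:{s..t}. U r \<omega>)" for \<omega>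
    unfolding energy_field_def
    by (rule set_lebesgue_integral_cong) (use st in \<open>auto simp: U_def W_def cl_def\<close>)
  have "(\<lambda>\<omega>. LBINT r:{s..t}. U r \<omega>) \<in> borel_measurable M"
    unfolding set_lebesgue_integral_def by measurable
  then show "energy_field V \<epsilon> s t (\<lambda>_. f) \<in> borel_measurable M"
    by (simp add: field[abs_def])
  have "(\<integral>\<^sup>+\<omega>. ennreal ((energy_field V \<epsilon> s t (\<lambda>_. f) \<omega>)\<^sup>2) \<partial>M)
      \<le> (\<integral>\<^sup>+\<omega>. ennreal (t - s) * (\<integral>\<^sup>+r. ennreal ((U r \<omega>)\<^sup>2) * indicator {s..t} r \<partial>lborel) \<partial>M)"
  proof (rule nn_integral_mono)
    fix \<omega> assume "\<omega> \<in> space M"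
    then have "(\<lambda>r. U r \<omega>) \<in> borel_measurable borel"
      using measurable_Pair2[of "\<lambda>(\<omega>, r). U r \<omega>" M lborel borel \<omega>] by simp
    then show "ennreal ((energy_field V \<epsilon> s t (\<lambda>_. f) \<omega>)\<^sup>2)
        \<le> ennreal (t - s) * (\<integral>\<^sup>+r. ennreal ((U r \<omega>)\<^sup>2) * indicator {s..t} r \<partial>lborel)"
      unfolding field using st by (intro nn_integral_square_set_integral_le)
  qed
  also have "\<dots> = ennreal (t - s) * (\<integral>\<^sup>+\<omega>. \<integral>\<^sup>+r. ennreal ((U r \<omega>)\<^sup>2) * indicator {s..t} r \<partial>lborel \<partial>M)"
    by (rule nn_integral_cmult) measurable
  also have "(\<integral>\<^sup>+\<omega>. \<integral>\<^sup>+r. ennreal ((U r \<omega>)\<^sup>2) * indicator {s..t} r \<partial>lborel \<partial>M)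
      = (\<integral>\<^sup>+r. \<integral>\<^sup>+\<omega>. ennreal ((U r \<omega>)\<^sup>2) * indicator {s..t} r \<partial>M \<partial>lborel)"
    by (rule P.Fubini'[symmetric]) measurable
  also have "\<dots> \<le> (\<integral>\<^sup>+r. ennreal B * indicator {s..t} r \<partial>lborel)"
  proof (rule nn_integral_mono)
    fix r
    have [measurable]: "U r \<in> borel_measurable M"
      using measurable_Pair1[of "\<lambda>(\<omega>, r). U r \<omega>" M lborel borel r] by simp
    show "(\<integral>\<^sup>+\<omega>. ennreal ((U r \<omega>)\<^sup>2) * indicator {s..t} r \<partial>M) \<le> ennreal B * indicator {s..t} r"
      using EU[of r] by (simp add: nn_integral_multc mult_right_mono)
  qed
  also have "\<dots> = ennreal B * ennreal (t - s)"
    using st by (simp add: nn_integral_cmult)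
  finally show "(\<integral>\<^sup>+\<omega>. ennreal ((energy_field V \<epsilon> s t (\<lambda>_. f) \<omega>)\<^sup>2) \<partial>M)
      \<le> ennreal (2 * v\<^sup>2 * (L2_norm_sq h / \<epsilon>) * L2_norm_sq (deriv f) * (t - s)\<^sup>2)"
    unfolding B_def[symmetric] using st B0
    by (simp add: ennreal_mult[symmetric] power2_eq_square mult_ac mult_left_mono mult_right_mono)
qed

text \<open>The renormalization moves the range \<open>\<epsilon> < 1\<close> of the energy estimate. At stationarity nothing
  is lost, because the energy field of a white noise is bounded at every fixed scale.\<close>

lemma (in prob_space) energy_estimate_all_scales:
  assumes h: "mollifier h" and w: "\<And>r. r \<in> {0..T} \<Longrightarrow> white_noise M v (Y r)"
    and V: "mollification M T h Y V" and EE: "energy_estimate M T V"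
  shows "\<exists>\<kappa>>0. \<exists>\<beta>\<in>{0<..<1::real}. \<forall>f \<epsilon> \<delta> s t.
    schwartz f \<longrightarrow> 0 < \<delta> \<longrightarrow> \<delta> < \<epsilon> \<longrightarrow> 0 \<le> s \<longrightarrow> s < t \<longrightarrow> t \<le> T \<longrightarrow>
    (\<integral>\<^sup>+\<omega>. ennreal ((energy_field V \<epsilon> s t (\<lambda>_. f) \<omega> - energy_field V \<delta> s t (\<lambda>_. f) \<omega>)\<^sup>2) \<partial>M)
      \<le> ennreal (\<kappa> * \<epsilon> * (t - s) powr \<beta> * L2_norm_sq (deriv f))"
proof -
  obtain \<kappa>0 \<beta> where \<kappa>0: "\<kappa>0 > 0" and \<beta>: "\<beta> \<in> {0<..<1}" and
    E0: "\<And>f \<epsilon> \<delta> s t. schwartz f \<Longrightarrow> 0 < \<delta> \<Longrightarrow> \<delta> < \<epsilon> \<Longrightarrow> \<epsilon> < 1 \<Longrightarrow> 0 \<le> s \<Longrightarrow> s < t \<Longrightarrow> t \<le> T \<Longrightarrow>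
    (\<integral>\<^sup>+\<omega>. ennreal ((energy_field V \<epsilon> s t (\<lambda>_. f) \<omega> - energy_field V \<delta> s t (\<lambda>_. f) \<omega>)\<^sup>2) \<partial>M)
      \<le> ennreal (\<kappa>0 * \<epsilon> * (t - s) powr \<beta> * L2_norm_sq (deriv f))"
    using EE unfolding energy_estimate_def by blast
  \<comment> \<open>At a scale \<eta> \<ge> 1/2 the factor 2 v^2 |h|^2/\<eta> is at most 4 v^2
    |h|^2, with |h| the L2 norm, and (t - s)^2 is traded for T^(2 - \<beta>) (t - s)^\<beta>. In
    \<kappa> the 3 comes from the three-term square, in which L occurs for two fields.\<close>
  define L where "L = 4 * v\<^sup>2 * L2_norm_sq h * T powr (2 - \<beta>)"
  define \<kappa> where "\<kappa> = 6 * L + 3 * \<kappa>0"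
  have L0: "0 \<le> L" by (simp add: L_def L2_norm_sq_nonneg)
  have "(\<integral>\<^sup>+\<omega>. ennreal ((energy_field V \<epsilon> s t (\<lambda>_. f) \<omega> - energy_field V \<delta> s t (\<lambda>_. f) \<omega>)\<^sup>2) \<partial>M)
      \<le> ennreal (\<kappa> * \<epsilon> * (t - s) powr \<beta> * L2_norm_sq (deriv f))"
    if f: "schwartz f" and d: "0 < \<delta>" "\<delta> < \<epsilon>" and st: "0 \<le> s" "s < t" "t \<le> T" for f \<epsilon> \<delta> s t
  proof -
    let ?A = "\<lambda>\<epsilon>. energy_field V \<epsilon> s t (\<lambda>_. f)"
    define R where "R = (t - s) powr \<beta> * L2_norm_sq (deriv f)"
    have R0: "0 \<le> R" by (simp add: R_def L2_norm_sq_nonneg)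
    have m[measurable]: "?A \<eta> \<in> borel_measurable M" if "\<eta> > 0" for \<eta>
      using energy_field_second_moment(1)[OF h that w V f] st by simp
    have big: "(\<integral>\<^sup>+\<omega>. ennreal ((?A \<eta> \<omega>)\<^sup>2) \<partial>M) \<le> ennreal (L * R)" if "\<eta> \<ge> 1 / 2" for \<eta>
    proof -
      have "(\<integral>\<^sup>+\<omega>. ennreal ((?A \<eta> \<omega>)\<^sup>2) \<partial>M)
        \<le> ennreal (2 * v\<^sup>2 * (L2_norm_sq h / \<eta>) * L2_norm_sq (deriv f) * (t - s)\<^sup>2)"
        using energy_field_second_moment(2)[OF h _ w V f] st that by simp
      also have "\<dots> \<le> ennreal (L * R)"
      proof (rule ennreal_leI)
        have "(t - s)\<^sup>2 = (t - s) powr (2 - \<beta>) * (t - s) powr \<beta>"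
          using st by (simp add: powr_add[symmetric])
        also have "\<dots> \<le> T powr (2 - \<beta>) * (t - s) powr \<beta>"
          using st \<beta> by (intro mult_right_mono powr_mono2) auto
        finally have 1: "(t - s)\<^sup>2 \<le> T powr (2 - \<beta>) * (t - s) powr \<beta>" .
        have "L2_norm_sq h / \<eta> \<le> L2_norm_sq h / (1 / 2)"
          using that by (intro divide_left_mono L2_norm_sq_nonneg) auto
        then have "2 * v\<^sup>2 * (L2_norm_sq h / \<eta>) * L2_norm_sq (deriv f) * (t - s)\<^sup>2
          \<le> 2 * v\<^sup>2 * (L2_norm_sq h / (1 / 2)) * L2_norm_sq (deriv f) * (T powr (2 - \<beta>) * (t - s) powr \<beta>)"
          by (intro mult_mono order.refl 1 mult_nonneg_nonneg L2_norm_sq_nonneg)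
            (use that in \<open>auto simp: L2_norm_sq_nonneg\<close>)
        then show "2 * v\<^sup>2 * (L2_norm_sq h / \<eta>) * L2_norm_sq (deriv f) * (t - s)\<^sup>2 \<le> L * R"
          by (simp add: L_def R_def mult_ac)
      qed
      finally show ?thesis .
    qed
    have main: "(\<integral>\<^sup>+\<omega>. ennreal ((?A \<epsilon> \<omega> - ?A \<delta> \<omega>)\<^sup>2) \<partial>M) \<le> ennreal (\<kappa> * \<epsilon> * R)"
    proof (cases "\<epsilon> < 1")
      case True
      have "(\<integral>\<^sup>+\<omega>. ennreal ((?A \<epsilon> \<omega> - ?A \<delta> \<omega>)\<^sup>2) \<partial>M) \<le> ennreal (\<kappa>0 * \<epsilon> * R)"
        using E0[OF f d True st] by (simp add: R_def mult.assoc)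
      also have "\<dots> \<le> ennreal (\<kappa> * \<epsilon> * R)"
        using d \<kappa>0 L0 R0 by (intro ennreal_leI mult_right_mono) (auto simp: \<kappa>_def)
      finally show ?thesis .
    next
      case False
      \<comment> \<open>Intermediate scale: if \<delta> < 1/2, the pair of scales 1/2 and \<delta>
        is within reach of the hypothesis; otherwise \<delta> itself counts as large and the last
        difference vanishes.\<close>
      define \<eta> where "\<eta> = (if \<delta> < 1 / 2 then 1 / 2 else \<delta>)"
      have \<eta>: "1 / 2 \<le> \<eta>" by (simp add: \<eta>_def)
      have small: "(\<integral>\<^sup>+\<omega>. ennreal ((?A \<eta> \<omega> - ?A \<delta> \<omega>)\<^sup>2) \<partial>M) \<le> ennreal (\<kappa>0 * R)"
      proof (cases "\<delta> < 1 / 2")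
        case True
        then have "(\<integral>\<^sup>+\<omega>. ennreal ((?A \<eta> \<omega> - ?A \<delta> \<omega>)\<^sup>2) \<partial>M) \<le> ennreal (\<kappa>0 * (1 / 2) * R)"
          using E0[OF f d(1) True _ st] by (simp add: R_def \<eta>_def mult.assoc)
        also have "\<dots> \<le> ennreal (\<kappa>0 * R)"
          using \<kappa>0 R0 by (intro ennreal_leI mult_right_mono) auto
        finally show ?thesis .
      qed (simp add: \<eta>_def)
      have "(\<integral>\<^sup>+\<omega>. ennreal ((?A \<epsilon> \<omega> - ?A \<delta> \<omega>)\<^sup>2) \<partial>M)
        = (\<integral>\<^sup>+\<omega>. ennreal ((?A \<epsilon> \<omega> - ?A \<eta> \<omega> + (?A \<eta> \<omega> - ?A \<delta> \<omega>))\<^sup>2) \<partial>M)" by simp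
      also have "\<dots> \<le> 3 * ((\<integral>\<^sup>+\<omega>. ennreal ((?A \<epsilon> \<omega>)\<^sup>2) \<partial>M) + (\<integral>\<^sup>+\<omega>. ennreal ((?A \<eta> \<omega>)\<^sup>2) \<partial>M)
          + (\<integral>\<^sup>+\<omega>. ennreal ((?A \<eta> \<omega> - ?A \<delta> \<omega>)\<^sup>2) \<partial>M))"
        using d \<eta> by (intro nn_integral_square_sum3_le borel_measurable_diff m) auto
      also have "\<dots> \<le> 3 * (ennreal (L * R) + ennreal (L * R) + ennreal (\<kappa>0 * R))"
        using False \<eta> by (intro mult_left_mono add_mono big small) auto
      also have "\<dots> = ennreal (3 * (L * R + L * R + \<kappa>0 * R))"
      proof -
        have "ennreal (L * R) + ennreal (L * R) + ennreal (\<kappa>0 * R) = ennreal (L * R + L * R + \<kappa>0 * R)"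
          using L0 R0 \<kappa>0 by (simp del: ennreal_plus add: ennreal_plus[symmetric])
        then show ?thesis
          using ennreal_mult'[of 3 "L * R + L * R + \<kappa>0 * R"] by (simp only: ennreal_numeral)
      qed
      also have "\<dots> \<le> ennreal (\<kappa> * \<epsilon> * R)"
      proof (rule ennreal_leI)
        \<comment> \<open>The bound so far lacks the factor \<epsilon>; since \<epsilon> \<ge> 1
          here, it can be inserted.\<close>
        have "\<kappa> * 1 * R \<le> \<kappa> * \<epsilon> * R"
          using False L0 \<kappa>0 R0 by (intro mult_right_mono mult_left_mono) (auto simp: \<kappa>_def)
        then show "3 * (L * R + L * R + \<kappa>0 * R) \<le> \<kappa> * \<epsilon> * R"
          by (simp add: \<kappa>_def algebra_simps)
      qed
      finally show ?thesis .
    qed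
    then show ?thesis by (simp add: R_def mult.assoc)
  qed
  moreover have "\<kappa> > 0" using L0 \<kappa>0 by (simp add: \<kappa>_def)
  ultimately show ?thesis using \<beta> by blast
qed

subsection \<open>Change of scale\<close>

text \<open>The library rule \<open>nn_integral_cmult\<close> asks for a measurable integrand, but the time integrals whose
  \<open>L\<^sup>2\<close> limits define the drift are not known to be random variables.\<close>

lemma nn_integral_cmult_const:
  assumes "0 < c"
  shows "(\<integral>\<^sup>+x. ennreal c * f x \<partial>M) = ennreal c * (\<integral>\<^sup>+x. f x \<partial>M)"
proof -
  have inv: "ennreal c * (ennreal (1 / c) * y) = y" if "0 < c" for c y
    using that by (simp add: mult.assoc[symmetric] ennreal_mult[symmetric])
  \<comment> \<open>A simple function below \<open>ennreal c * f\<close> is measurable, so the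
    constant can be pulled out of its integral, and 1/c times it lies below f. Applied to 1/c, the
    inequality also gives the reverse one.\<close>
  have *: "(\<integral>\<^sup>+x. ennreal c * f x \<partial>M) \<le> ennreal c * (\<integral>\<^sup>+x. f x \<partial>M)" if c: "0 < c" for c f
  proof -
    have "integral\<^sup>S M g \<le> ennreal c * (\<integral>\<^sup>+x. f x \<partial>M)"
      if g: "simple_function M g" and le: "g \<le> (\<lambda>x. ennreal c * f x)" for g
    proof -
      have "integral\<^sup>S M g = (\<integral>\<^sup>+x. ennreal c * (ennreal (1 / c) * g x) \<partial>M)"
        by (simp add: nn_integral_eq_simple_integral[OF g] inv[OF c])
      also have "\<dots> = ennreal c * (\<integral>\<^sup>+x. ennreal (1 / c) * g x \<partial>M)"
        using borel_measurable_simple_function[OF g] by (intro nn_integral_cmult) simp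
      also have "\<dots> \<le> ennreal c * (\<integral>\<^sup>+x. f x \<partial>M)"
      proof (intro mult_left_mono nn_integral_mono)
        fix x
        have "ennreal (1 / c) * g x \<le> ennreal (1 / c) * (ennreal c * f x)"
          using le by (intro mult_left_mono) (auto simp: le_fun_def)
        also have "\<dots> = f x"
          using inv[of "1 / c" "f x"] c by simp
        finally show "ennreal (1 / c) * g x \<le> f x" .
      qed simp
      finally show ?thesis .
    qed
    then show ?thesis
      unfolding nn_integral_def[of M "\<lambda>x. ennreal c * f x"] by (intro SUP_least) auto
  qed
  show ?thesis
  proof (rule antisym)
    show "(\<integral>\<^sup>+x. ennreal c * f x \<partial>M) \<le> ennreal c * (\<integral>\<^sup>+x. f x \<partial>M)" by (rule *[OF assms])
    have "(\<integral>\<^sup>+x. ennreal (1 / c) * (ennreal c * f x) \<partial>M) \<le> ennreal (1 / c) * (\<integral>\<^sup>+x. ennreal c * f x \<partial>M)"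
      by (rule *) (use assms in simp)
    then have "(\<integral>\<^sup>+x. f x \<partial>M) \<le> ennreal (1 / c) * (\<integral>\<^sup>+x. ennreal c * f x \<partial>M)"
      using inv[of "1 / c"] assms by simp
    then have "ennreal c * (\<integral>\<^sup>+x. f x \<partial>M) \<le> ennreal c * (ennreal (1 / c) * (\<integral>\<^sup>+x. ennreal c * f x \<partial>M))"
      by (intro mult_left_mono) auto
    then show "ennreal c * (\<integral>\<^sup>+x. f x \<partial>M) \<le> (\<integral>\<^sup>+x. ennreal c * f x \<partial>M)"
      by (simp add: inv[OF assms])
  qed
qed

lemma nn_integral_square_cmult:
  fixes X :: "'w \<Rightarrow> real"
  assumes "c \<noteq> 0"
  shows "(\<integral>\<^sup>+\<omega>. ennreal ((c * X \<omega>)\<^sup>2) \<partial>M) = ennreal (c\<^sup>2) * (\<integral>\<^sup>+\<omega>. ennreal ((X \<omega>)\<^sup>2) \<partial>M)"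
proof -
  have "(\<integral>\<^sup>+\<omega>. ennreal ((c * X \<omega>)\<^sup>2) \<partial>M) = (\<integral>\<^sup>+\<omega>. ennreal (c\<^sup>2) * ennreal ((X \<omega>)\<^sup>2) \<partial>M)"
    by (simp add: power_mult_distrib ennreal_mult)
  then show ?thesis using assms by (simp add: nn_integral_cmult_const)
qed

lemma L2_lim_cmult:
  assumes "c \<noteq> 0" "L2_lim M X Z F"
  shows "L2_lim M (\<lambda>i \<omega>. c * X i \<omega>) (\<lambda>\<omega>. c * Z \<omega>) F"
proof -
  have "((\<lambda>i. ennreal (c\<^sup>2) * (\<integral>\<^sup>+\<omega>. ennreal ((X i \<omega> - Z \<omega>)\<^sup>2) \<partial>M)) \<longlongrightarrow> ennreal (c\<^sup>2) * 0) F"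
    using assms by (intro ennreal_tendsto_cmult) (auto simp: L2_lim_def)
  then show ?thesis
    using assms unfolding L2_lim_def
    by (auto simp: right_diff_distrib[symmetric] nn_integral_square_cmult intro!: borel_measurable_times)
qed

lemma L2_lim_compose:
  "L2_lim M X Z F \<Longrightarrow> filterlim g F G \<Longrightarrow> L2_lim M (\<lambda>i. X (g i)) Z G"
  unfolding L2_lim_def by (auto intro: filterlim_compose)

lemma filterlim_cmult_at_right_0:
  fixes c :: real
  assumes "c > 0"
  shows "filterlim (\<lambda>x. c * x) (at_right 0) (at_right 0)"
  unfolding filterlim_at using assms
  by (auto intro!: tendsto_eq_intros simp: eventually_at_filter)

lemma L2_lim_lborel_scale:
  fixes \<phi> :: "'i \<Rightarrow> real \<Rightarrow> real"
  assumes c: "c > 0" and l: "L2_lim lborel \<phi> g F" and [measurable]: "\<And>i. \<phi> i \<in> borel_measurable borel"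
  shows "L2_lim lborel (\<lambda>i x. \<phi> i (x / c)) (\<lambda>x. g (x / c)) F"
proof -
  have [measurable]: "g \<in> borel_measurable borel" using l by (simp add: L2_lim_def)
  have "(\<integral>\<^sup>+x. ennreal ((\<phi> i (x / c) - g (x / c))\<^sup>2) \<partial>lborel)
      = ennreal c * (\<integral>\<^sup>+x. ennreal ((\<phi> i x - g x)\<^sup>2) \<partial>lborel)" for i
    using c nn_integral_real_affine[of "\<lambda>x. ennreal ((\<phi> i (x / c) - g (x / c))\<^sup>2)" c 0] by simp
  moreover have "((\<lambda>i. ennreal c * (\<integral>\<^sup>+x. ennreal ((\<phi> i x - g x)\<^sup>2) \<partial>lborel)) \<longlongrightarrow> ennreal c * 0) F"
    using l by (intro ennreal_tendsto_cmult) (auto simp: L2_lim_def)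
  ultimately show ?thesis by (simp add: L2_lim_def)
qed

text \<open>The dilation inside the rescaled functional undoes that of the approximants, so
  \<Lambda> sees b times the original ones, and b comes out by linearity on Schwartz functions. The
  factor b is there to carry the normalization of a rescaled mollifier.\<close>

lemma L2_extension_scale:
  assumes t: "\<forall>\<omega>\<in>space M. tempered_distribution (\<Lambda> \<omega>)" and l: "L2_extension M \<Lambda> g Z"
    and c: "c > 0" and ab: "a \<noteq> 0" "b \<noteq> 0"
  shows "L2_extension M (\<lambda>\<omega> f. a * \<Lambda> \<omega> (\<lambda>x. f (c * x))) (\<lambda>z. b * g (z / c)) (\<lambda>\<omega>. a * b * Z \<omega>)"
proof -
  obtain \<phi> where s: "\<And>n::nat. schwartz (\<phi> n)"
    and l: "L2_lim lborel \<phi> g sequentially" "L2_lim M (\<lambda>n \<omega>. \<Lambda> \<omega> (\<phi> n)) Z sequentially"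
    using l unfolding L2_extension_def by metis
  have "schwartz (\<lambda>x. b * \<phi> n (x / c))" for n
    using schwartz_cmult[OF schwartz_scale[OF s[of n], of "1 / c"], of b] c by simp
  moreover have "L2_lim lborel (\<lambda>n x. b * \<phi> n (x / c)) (\<lambda>x. b * g (x / c)) sequentially"
    by (intro L2_lim_cmult ab L2_lim_lborel_scale c l schwartz_measurable s)
  moreover have "L2_lim M (\<lambda>n \<omega>. a * \<Lambda> \<omega> (\<lambda>x. b * \<phi> n (c * x / c))) (\<lambda>\<omega>. a * b * Z \<omega>) sequentially"
    using L2_lim_cmult[OF _ l(2), of "a * b"] ab c t s
    by (auto simp: tempered_distribution_cmult intro: L2_lim_cong[rotated])
  ultimately show ?thesis
    unfolding L2_extension_def by (intro exI[of _ "\<lambda>n x. b * \<phi> n (x / c)"]) simp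
qed

lemma set_lborel_integral_scale:
  fixes F :: "real \<Rightarrow> real"
  assumes "c > 0"
  shows "(LBINT s:{l..u}. F (s / c)) = c * (LBINT s:{l / c..u / c}. F s)"
proof -
  have "(LBINT s:{l..u}. F (s / c)) = c * (LBINT s. indicator {l..u} (c * s) * F s)"
    unfolding set_lebesgue_integral_def
    using lborel_integral_real_affine[of c "\<lambda>s. indicator {l..u} s * F (s / c)" 0] assms by simp
  also have "(\<lambda>s. indicator {l..u} (c * s) * F s) = (\<lambda>s. indicator {l / c..u / c} s * F s)"
    using assms by (auto simp: fun_eq_iff indicator_def field_simps)
  finally show ?thesis by (simp add: set_lebesgue_integral_def)
qed

lemma (in prob_space) centered_gaussian_cmult:
  assumes "centered_gaussian M X v"
  shows "centered_gaussian M (\<lambda>\<omega>. c * X \<omega>) (c\<^sup>2 * v)"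
proof (rule centered_gaussianI_char)
  note [measurable] = centered_gaussian_measurable[OF assms]
  show "(\<lambda>\<omega>. c * X \<omega>) \<in> borel_measurable M" by measurable
  show "0 \<le> c\<^sup>2 * v" using centered_gaussian_var_nonneg[OF assms] by simp
  fix t
  have "char (distr M borel (\<lambda>\<omega>. c * X \<omega>)) t = char (distr M borel X) (t * c)"
    by (simp add: char_distr mult.assoc)
  then show "char (distr M borel (\<lambda>\<omega>. c * X \<omega>)) t = complex_of_real (exp (- (c\<^sup>2 * v * t\<^sup>2 / 2)))"
    by (simp add: char_centered_gaussian[OF assms] power_mult_distrib mult_ac)
qed

lemma tempered_distribution_scale:
  assumes L: "tempered_distribution \<Lambda>" and c: "c > 0"
  shows "tempered_distribution (\<lambda>f. a * \<Lambda> (\<lambda>x. f (c * x)))"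
  unfolding tempered_distribution_def
proof (intro conjI allI impI)
  fix f g assume "schwartz f" "schwartz g"
  then show "a * \<Lambda> (\<lambda>x. f (c * x) + g (c * x)) = a * \<Lambda> (\<lambda>x. f (c * x)) + a * \<Lambda> (\<lambda>x. g (c * x))"
    using tempered_distribution_lincomb[OF L schwartz_scale schwartz_scale, of f c g c 1] c
    by (simp add: distrib_left)
next
  fix f d assume "schwartz f"
  then show "a * \<Lambda> (\<lambda>x. d * f (c * x)) = d * (a * \<Lambda> (\<lambda>x. f (c * x)))"
    using tempered_distribution_cmult[OF L schwartz_scale, of f c d] c by simp
next
  fix f and e :: real assume f: "schwartz f" and e: "0 < e"
  \<comment> \<open>The + 1 keeps the divisor positive when a = 0.\<close>
  define e' where "e' = e / (\<bar>a\<bar> + 1)"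
  have e': "0 < e'" using e by (simp add: e'_def)
  have sf: "schwartz (\<lambda>x. f (c * x))" using schwartz_scale[OF f] c by simp
  from L[unfolded tempered_distribution_def, THEN conjunct2, THEN conjunct2, rule_format, OF sf e']
  obtain N d where d: "d > 0" and N: "\<And>g. schwartz g \<Longrightarrow>
      (\<forall>k\<le>N. \<forall>n\<le>N. schwartz_seminorm k n (\<lambda>x. g x - f (c * x)) < d) \<Longrightarrow> \<bar>\<Lambda> g - \<Lambda> (\<lambda>x. f (c * x))\<bar> < e'"
    by blast
  \<comment> \<open>Bounds c^n/c^k for all k, n \<le> N at once, whether c is above or below
    1.\<close>
  define m where "m = max 1 c ^ N * max 1 (1 / c) ^ N"
  have m: "m \<ge> 1" unfolding m_def by (intro mult_ge1_I one_le_power) auto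
  have "\<bar>a * \<Lambda> (\<lambda>x. g (c * x)) - a * \<Lambda> (\<lambda>x. f (c * x))\<bar> < e"
    if g: "schwartz g" and small: "\<forall>k\<le>N. \<forall>n\<le>N. schwartz_seminorm k n (\<lambda>x. g x - f x) < d / m" for g
  proof -
    have "schwartz_seminorm k n (\<lambda>x. g (c * x) - f (c * x)) < d" if kn: "k \<le> N" "n \<le> N" for k n
    proof -
      have "schwartz_seminorm k n (\<lambda>x. g (c * x) - f (c * x)) =
        c ^ n / c ^ k * schwartz_seminorm k n (\<lambda>x. g x - f x)"
        by (rule schwartz_seminorm_scale[OF schwartz_diff[OF g f] c])
      also have "\<dots> \<le> m * schwartz_seminorm k n (\<lambda>x. g x - f x)"
      proof (rule mult_right_mono)
        have 1: "c ^ n \<le> max 1 c ^ N"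
          using c kn by (intro order_trans[OF power_mono power_increasing]) auto
        have 2: "(1 / c) ^ k \<le> max 1 (1 / c) ^ N"
          using c kn by (intro order_trans[OF power_mono power_increasing]) auto
        have "c ^ n / c ^ k = c ^ n * (1 / c) ^ k" by (simp add: power_divide)
        also have "\<dots> \<le> m"
          unfolding m_def using c by (intro mult_mono 1 2) auto
        finally show "c ^ n / c ^ k \<le> m" .
      qed (rule schwartz_seminorm_nonneg[OF schwartz_diff[OF g f]])
      also have "\<dots> < m * (d / m)"
        using small kn m by (intro mult_strict_left_mono) auto
      finally show ?thesis using m by simp
    qed
    then have "\<bar>\<Lambda> (\<lambda>x. g (c * x)) - \<Lambda> (\<lambda>x. f (c * x))\<bar> < e'"
      using N[OF schwartz_scale[OF g, of c]] c by simp
    then have "(\<bar>a\<bar> + 1) * \<bar>\<Lambda> (\<lambda>x. g (c * x)) - \<Lambda> (\<lambda>x. f (c * x))\<bar> < (\<bar>a\<bar> + 1) * e'"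
      by (intro mult_strict_left_mono) auto
    then have "(\<bar>a\<bar> + 1) * \<bar>\<Lambda> (\<lambda>x. g (c * x)) - \<Lambda> (\<lambda>x. f (c * x))\<bar> < e"
      by (simp add: e'_def)
    moreover have "\<bar>a * \<Lambda> (\<lambda>x. g (c * x)) - a * \<Lambda> (\<lambda>x. f (c * x))\<bar>
        \<le> (\<bar>a\<bar> + 1) * \<bar>\<Lambda> (\<lambda>x. g (c * x)) - \<Lambda> (\<lambda>x. f (c * x))\<bar>"
      by (simp add: right_diff_distrib[symmetric] abs_mult mult_right_mono)
    ultimately show ?thesis by linarith
  qed
  then show "\<exists>N. \<exists>d>0. \<forall>g. schwartz g \<longrightarrow> (\<forall>k\<le>N. \<forall>n\<le>N. schwartz_seminorm k n (\<lambda>x. g x - f x) < d) \<longrightarrow>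
      \<bar>a * \<Lambda> (\<lambda>x. g (c * x)) - a * \<Lambda> (\<lambda>x. f (c * x))\<bar> < e"
    using d m by (intro exI[of _ N] exI[of _ "d / m"]) auto
qed

section \<open>Paths, filtrations, martingales and quadratic variation under a linear time
  change\<close>

lemma continuous_paths_rescale:
  assumes X: "continuous_paths M (T / \<tau>) X" and \<tau>: "\<tau> > 0"
    and eq: "\<And>t \<omega>. t \<in> {0..T} \<Longrightarrow> \<omega> \<in> space M \<Longrightarrow> X' t \<omega> = c * X (t / \<tau>) \<omega>"
  shows "continuous_paths M T X'"
  unfolding continuous_paths_def
  using X[unfolded continuous_paths_def] AE_space
proof eventually_elim
  case (elim \<omega>)
  have "continuous_on {0..T} (\<lambda>t. c * X (t / \<tau>) \<omega>)"
    by (intro continuous_intros continuous_on_compose2[OF elim(1)]) (use \<tau> in \<open>auto simp: divide_right_mono\<close>)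
  then show ?case
    using eq elim(2) continuous_on_cong[of "{0..T}" "{0..T}" "\<lambda>t. c * X (t / \<tau>) \<omega>" "\<lambda>t. X' t \<omega>"]
    by simp
qed

lemma space_process_filtration: "space (process_filtration M Y t) = space M"
  unfolding process_filtration_def
  by (rule space_measure_of) (auto dest: sets.sets_into_space)

lemma subalgebra_process_filtration:
  assumes "\<And>s f. s \<in> {0..t} \<Longrightarrow> schwartz f \<Longrightarrow> (\<lambda>\<omega>. Y s \<omega> f) \<in> borel_measurable M"
  shows "subalgebra M (process_filtration M Y t)"
proof -
  define G where "G = {(\<lambda>\<omega>. Y s \<omega> f) -` B \<inter> space M |s f B. s \<in> {0..t} \<and> schwartz f \<and> B \<in> sets borel}
      \<union> null_sets M"
  have G: "G \<subseteq> sets M"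
  proof
    fix A assume "A \<in> G"
    then consider s f B where "A = (\<lambda>\<omega>. Y s \<omega> f) -` B \<inter> space M" "s \<in> {0..t}" "schwartz f" "B \<in> sets borel"
      | "A \<in> null_sets M"
      unfolding G_def by blast
    then show "A \<in> sets M"
      by cases (auto intro: measurable_sets[OF assms])
  qed
  then have "sets (process_filtration M Y t) = sigma_sets (space M) G"
    unfolding process_filtration_def G_def[symmetric]
    by (intro sets_measure_of) (auto dest: sets.sets_into_space)
  then show ?thesis
    unfolding subalgebra_def space_process_filtration using sets.sigma_sets_subset[OF G] by simp
qed

text \<open>Dilation permutes the Schwartz functions and multiplication by a positive constant
  permutes the Borel sets, so up to the change of time both filtrations have the same generators.
  The null sets do not depend on the process.\<close>

lemma process_filtration_renormalize:
  assumes "\<epsilon> > 0"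
  shows "process_filtration M (renormalize \<epsilon> Y) t = process_filtration M Y (t / \<epsilon> powr (3/2))"
proof -
  define a where "a = \<epsilon> powr (1/2)"
  define \<tau> where "\<tau> = \<epsilon> powr (3/2)"
  have a: "a > 0" and \<tau>: "\<tau> > 0" using assms by (simp_all add: a_def \<tau>_def)
  have "{(\<lambda>\<omega>. renormalize \<epsilon> Y s \<omega> f) -` B \<inter> space M |s f B. s \<in> {0..t} \<and> schwartz f \<and> B \<in> sets borel}
    = {(\<lambda>\<omega>. Y s \<omega> f) -` B \<inter> space M |s f B. s \<in> {0..t / \<tau>} \<and> schwartz f \<and> B \<in> sets borel}"
    (is "?L = ?R")
  proof (intro antisym subsetI)
    fix A assume "A \<in> ?L"
    then obtain s f B where A: "A = (\<lambda>\<omega>. renormalize \<epsilon> Y s \<omega> f) -` B \<inter> space M"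
      and s: "s \<in> {0..t}" "schwartz f" "B \<in> sets borel" by blast
    have "A = (\<lambda>\<omega>. Y (s / \<tau>) \<omega> (\<lambda>x. f (\<epsilon> * x))) -` ((\<lambda>x. a * x) -` B) \<inter> space M"
      unfolding A renormalize_def a_def \<tau>_def by auto
    moreover have "(\<lambda>x. a * x) -` B \<in> sets borel"
      using measurable_sets[of "\<lambda>x. a * x" borel borel B] s by simp
    moreover have "schwartz (\<lambda>x. f (\<epsilon> * x))" "s / \<tau> \<in> {0..t / \<tau>}"
      using s \<tau> assms by (auto intro!: schwartz_scale[OF s(2)] simp: divide_right_mono)
    ultimately show "A \<in> ?R" by blast
  next
    fix A assume "A \<in> ?R"
    then obtain s f B where A: "A = (\<lambda>\<omega>. Y s \<omega> f) -` B \<inter> space M"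
      and s: "s \<in> {0..t / \<tau>}" "schwartz f" "B \<in> sets borel" by blast
    have "A = (\<lambda>\<omega>. renormalize \<epsilon> Y (s * \<tau>) \<omega> (\<lambda>x. f (1 / \<epsilon> * x))) -` ((\<lambda>x. x / a) -` B) \<inter> space M"
      unfolding A renormalize_def a_def[symmetric] \<tau>_def[symmetric] using a \<tau> assms by auto
    moreover have "(\<lambda>x. x / a) -` B \<in> sets borel"
      using measurable_sets[of "\<lambda>x. x / a" borel borel B] s by simp
    moreover have "schwartz (\<lambda>x. f (1 / \<epsilon> * x))" "s * \<tau> \<in> {0..t}"
      using s \<tau> assms schwartz_scale[OF s(2), of "1 / \<epsilon>"] by (auto simp: field_simps)
    ultimately show "A \<in> ?L" by blast
  qed
  then show ?thesis
    unfolding process_filtration_def \<tau>_def by simp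
qed

text \<open>The relation between X' and X is assumed only on \<open>space M\<close>, because
  linearity of the process is known only for realizations there. Measurability and conditional
  expectations are therefore transferred by congruence before the constant c is pulled out.\<close>

lemma (in prob_space) martingale_on_rescale:
  assumes X: "martingale_on M F (T / \<tau>) X" and \<tau>: "\<tau> > 0"
    and F: "\<And>t. t \<in> {0..T / \<tau>} \<Longrightarrow> subalgebra M (F t)"
    and eq: "\<And>t \<omega>. t \<in> {0..T} \<Longrightarrow> \<omega> \<in> space M \<Longrightarrow> X' t \<omega> = c * X (t / \<tau>) \<omega>"
    and G: "\<And>t. G t = F (t / \<tau>)"
  shows "martingale_on M G T X'"
  unfolding martingale_on_def G
proof (intro conjI ballI allI impI)
  have mem: "t / \<tau> \<in> {0..T / \<tau>}" if "t \<in> {0..T}" for t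
    using that \<tau> by (auto simp: divide_right_mono)
  have M: "X (t / \<tau>) \<in> borel_measurable (F (t / \<tau>))" "integrable M (X (t / \<tau>))" if "t \<in> {0..T}" for t
    using X mem[OF that] by (auto simp: martingale_on_def)
  fix t assume t: "t \<in> {0..T}"
  have "(\<lambda>\<omega>. c * X (t / \<tau>) \<omega>) \<in> borel_measurable (F (t / \<tau>))"
    using M[OF t] by simp
  then show "X' t \<in> borel_measurable (F (t / \<tau>))"
    using F[OF mem[OF t]] eq[OF t] by (subst measurable_cong) (auto simp: subalgebra_def)
  show "integrable M (X' t)"
    using M[OF t] eq[OF t] by (simp cong: Bochner_Integration.integrable_cong)
next
  fix s t assume st: "0 \<le> s \<and> s \<le> t \<and> t \<le> T"
  have st': "s / \<tau> \<in> {0..T / \<tau>}" "t / \<tau> \<in> {0..T / \<tau>}" "s / \<tau> \<le> t / \<tau>" "t \<in> {0..T}" "s \<in> {0..T}"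
    using st \<tau> by (auto simp: divide_right_mono)
  interpret S: finite_measure_subalgebra M "F (s / \<tau>)"
    by unfold_locales (rule F[OF st'(1)])
  have i: "integrable M (X (t / \<tau>))" and m: "AE \<omega> in M. real_cond_exp M (F (s / \<tau>)) (X (t / \<tau>)) \<omega> = X (s / \<tau>) \<omega>"
    using X st' by (auto simp: martingale_on_def)
  have [measurable]: "X (t / \<tau>) \<in> borel_measurable M" using i by auto
  have [measurable]: "X' t \<in> borel_measurable M"
    using eq st' by (subst measurable_cong[where g = "\<lambda>\<omega>. c * X (t / \<tau>) \<omega>"]) auto
  have "AE \<omega> in M. real_cond_exp M (F (s / \<tau>)) (X' t) \<omega> = real_cond_exp M (F (s / \<tau>)) (\<lambda>\<omega>. c * X (t / \<tau>) \<omega>) \<omega>"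
    using eq st' by (intro S.real_cond_exp_cong) auto
  then show "AE \<omega> in M. real_cond_exp M (F (s / \<tau>)) (X' t) \<omega> = X' s \<omega>"
    using S.real_cond_exp_cmult[OF i, of c] m AE_space
  proof eventually_elim
    case (elim \<omega>)
    then show ?case using eq[OF st'(5), of \<omega>] by simp
  qed
qed

text \<open>Dividing a partition of [0, t] with steps below \<tau> d by \<tau> gives one of
  [0, t/\<tau>] with steps below d, and squared increments change by c^2. The two deviation events
  coincide once the threshold e is replaced by e/c^2.\<close>

lemma quadratic_variation_rescale:
  assumes X: "quadratic_variation M (T / \<tau>) X q" and \<tau>: "\<tau> > 0" and c: "c \<noteq> 0"
    and eq: "\<And>t \<omega>. t \<in> {0..T} \<Longrightarrow> \<omega> \<in> space M \<Longrightarrow> X' t \<omega> = c * X (t / \<tau>) \<omega>"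
    and q: "\<And>t. t \<in> {0..T} \<Longrightarrow> q' t = c\<^sup>2 * q (t / \<tau>)"
  shows "quadratic_variation M T X' q'"
  unfolding quadratic_variation_def
proof (intro ballI allI impI)
  fix t e \<eta> :: real assume t: "t \<in> {0..T}" and e: "0 < e" and \<eta>: "0 < \<eta>"
  have t': "t / \<tau> \<in> {0..T / \<tau>}" using t \<tau> by (auto simp: divide_right_mono)
  have "0 < e / c\<^sup>2" using e c by simp
  from X[unfolded quadratic_variation_def, rule_format, OF t' this \<eta>]
  obtain d where d: "d > 0" and D: "\<And>(n::nat) p. p 0 = 0 \<and> p n = t / \<tau> \<and>
      (\<forall>i<n. p i \<le> p (Suc i) \<and> p (Suc i) - p i < d) \<Longrightarrow>
      measure M {\<omega>\<in>space M. \<bar>(\<Sum>i<n. (X (p (Suc i)) \<omega> - X (p i) \<omega>)\<^sup>2) - q (t / \<tau>)\<bar> > e / c\<^sup>2} < \<eta>"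
    by blast
  have "measure M {\<omega>\<in>space M. \<bar>(\<Sum>i<n. (X' (p (Suc i)) \<omega> - X' (p i) \<omega>)\<^sup>2) - q' t\<bar> > e} < \<eta>"
    if p: "p 0 = 0" "p n = t" "\<forall>i<n. p i \<le> p (Suc i) \<and> p (Suc i) - p i < \<tau> * d" for n :: nat and p
  proof -
    have lo: "0 \<le> p i" if "i \<le> n" for i
      using that p by (induction i) (auto intro: order_trans)
    \<comment> \<open>Downward induction from p n = t: the partition points have to stay in [0, T],
      where X' is given by X.\<close>
    have "p (n - i) \<le> t" for i
    proof (induction i)
      case (Suc i)
      show ?case
      proof (cases "i < n")
        case True
        then have "p (n - Suc i) \<le> p (Suc (n - Suc i))" using p by auto
        then show ?thesis using Suc True by (simp add: Suc_diff_Suc)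
      qed (use Suc in simp)
    qed (use p in simp)
    then have hi: "p i \<le> t" if "i \<le> n" for i using that by (metis diff_diff_cancel)
    have pT: "p i \<in> {0..T}" if "i \<le> n" for i
      using lo[OF that] hi[OF that] t by auto
    define P where "P i = p i / \<tau>" for i
    have P: "P 0 = 0 \<and> P n = t / \<tau> \<and> (\<forall>i<n. P i \<le> P (Suc i) \<and> P (Suc i) - P i < d)"
      using p \<tau> by (simp add: P_def divide_right_mono diff_divide_distrib[symmetric] pos_divide_less_eq mult.commute)
    have "{\<omega>\<in>space M. \<bar>(\<Sum>i<n. (X' (p (Suc i)) \<omega> - X' (p i) \<omega>)\<^sup>2) - q' t\<bar> > e}
      = {\<omega>\<in>space M. \<bar>(\<Sum>i<n. (X (P (Suc i)) \<omega> - X (P i) \<omega>)\<^sup>2) - q (t / \<tau>)\<bar> > e / c\<^sup>2}"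
    proof (intro Collect_cong conj_cong refl)
      fix \<omega> assume \<omega>: "\<omega> \<in> space M"
      have "(\<Sum>i<n. (X' (p (Suc i)) \<omega> - X' (p i) \<omega>)\<^sup>2) - q' t
        = c\<^sup>2 * ((\<Sum>i<n. (X (P (Suc i)) \<omega> - X (P i) \<omega>)\<^sup>2) - q (t / \<tau>))"
        unfolding right_diff_distrib sum_distrib_left q[OF t]
      proof (intro arg_cong2[where f = "(-)"] sum.cong refl)
        fix i assume "i \<in> {..<n}"
        then show "(X' (p (Suc i)) \<omega> - X' (p i) \<omega>)\<^sup>2 = c\<^sup>2 * (X (P (Suc i)) \<omega> - X (P i) \<omega>)\<^sup>2"
          using eq[OF pT \<omega>] by (simp add: P_def right_diff_distrib[symmetric] power_mult_distrib)
      qed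
      then show "(\<bar>(\<Sum>i<n. (X' (p (Suc i)) \<omega> - X' (p i) \<omega>)\<^sup>2) - q' t\<bar> > e)
        = (\<bar>(\<Sum>i<n. (X (P (Suc i)) \<omega> - X (P i) \<omega>)\<^sup>2) - q (t / \<tau>)\<bar> > e / c\<^sup>2)"
        using c by (simp add: abs_mult pos_divide_less_eq mult.commute)
    qed
    then show ?thesis using D[OF P] by simp
  qed
  then show "\<exists>d>0. \<forall>(n::nat) p. p 0 = 0 \<and> p n = t \<and> (\<forall>i<n. p i \<le> p (Suc i) \<and> p (Suc i) - p i < d) \<longrightarrow>
      measure M {\<omega>\<in>space M. \<bar>(\<Sum>i<n. (X' (p (Suc i)) \<omega> - X' (p i) \<omega>)\<^sup>2) - q' t\<bar> > e} < \<eta>"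
    using d \<tau> by (intro exI[of _ "\<tau> * d"]) auto
qed

subsection \<open>The renormalized process\<close>

lemma deriv_scale_divide:
  assumes "schwartz f"
  shows "deriv (\<lambda>x. f (c * x) / d) x = c * deriv f (c * x) / d"
  using deriv_scale[OF schwartz_divide[OF assms, of d], of c x]
    fun_cong[OF deriv_funpow_lincomb[OF assms assms, of 1 "1 / d" 0], of "c * x"]
  by simp

lemma powr_half_power:
  fixes \<epsilon> :: real
  assumes "\<epsilon> > 0"
  shows "(\<epsilon> powr (1/2))\<^sup>2 = \<epsilon>" "(\<epsilon> powr (3/2))\<^sup>2 = \<epsilon> ^ 3" "\<epsilon> powr (1/2) * \<epsilon> powr (3/2) = \<epsilon>\<^sup>2"
proof -
  show "(\<epsilon> powr (1/2))\<^sup>2 = \<epsilon>"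
    using assms by (simp add: power2_eq_square powr_add[symmetric])
  show "(\<epsilon> powr (3/2))\<^sup>2 = \<epsilon> ^ 3"
    using assms powr_realpow[of \<epsilon> 3] by (simp add: power2_eq_square powr_add[symmetric])
  show "\<epsilon> powr (1/2) * \<epsilon> powr (3/2) = \<epsilon>\<^sup>2"
    using assms powr_realpow[of \<epsilon> 2] by (simp add: powr_add[symmetric])
qed

lemma set_lborel_integral_time_change:
  fixes F G :: "real \<Rightarrow> real"
  assumes c: "c > 0" and F: "\<And>s. s \<in> {l..u} \<Longrightarrow> F s = k * G (s / c)"
  shows "(LBINT s:{l..u}. F s) = k * c * (LBINT s:{l / c..u / c}. G s)"
proof -
  have "(LBINT s:{l..u}. F s) = (LBINT s:{l..u}. k * G (s / c))"
    by (rule set_lebesgue_integral_cong) (use F in auto)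
  also have "\<dots> = c * (LBINT s:{l / c..u / c}. k * G s)"
    by (rule set_lborel_integral_scale[OF c])
  finally show ?thesis by simp
qed

lemma divide_mem_scaled_interval: "t \<in> {0..T} \<Longrightarrow> \<tau> > 0 \<Longrightarrow> t / \<tau> \<in> {0..T / (\<tau>::real)}"
  by (auto simp: divide_right_mono)

lemma measurable_divide_scaled_interval:
  "\<tau> > 0 \<Longrightarrow> (\<lambda>s. s / \<tau>) \<in> restrict_space borel {0..T} \<rightarrow>\<^sub>M restrict_space borel {0..T / (\<tau>::real)}"
  by (rule measurable_restrict_space3) (auto simp: divide_right_mono)

section \<open>Regularity and mollification of the renormalized process\<close>

lemma distribution_process_renormalize:
  assumes e: "\<epsilon> > 0" and Y: "distribution_process M (T / \<epsilon> powr (3/2)) Y"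
  shows "distribution_process M T (renormalize \<epsilon> Y)"
  unfolding distribution_process_def
proof (intro conjI ballI allI impI)
  let ?\<tau> = "\<epsilon> powr (3/2)"
  have \<tau>: "?\<tau> > 0" using e by simp
  show "tempered_distribution (renormalize \<epsilon> Y t \<omega>)" if "t \<in> {0..T}" "\<omega> \<in> space M" for t \<omega>
    using tempered_distribution_scale[of "Y (t / ?\<tau>) \<omega>" \<epsilon> "\<epsilon> powr (1/2)"] Y that e
      divide_mem_scaled_interval[OF that(1) \<tau>]
    by (simp add: renormalize_def[abs_def] distribution_process_def)
  fix f assume "schwartz f"
  then have "schwartz (\<lambda>x. f (\<epsilon> * x))" using e by (intro schwartz_scale) auto
  then have Yf: "(\<lambda>(t, \<omega>). Y t \<omega> (\<lambda>x. f (\<epsilon> * x))) \<in> borel_measurable (restrict_space borel {0..T / ?\<tau>} \<Otimes>\<^sub>M M)"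
    using Y by (simp add: distribution_process_def)
  note [measurable] = measurable_divide_scaled_interval[OF \<tau>, of T]
  have "(\<lambda>p. (fst p / ?\<tau>, snd p)) \<in> restrict_space borel {0..T} \<Otimes>\<^sub>M M \<rightarrow>\<^sub>M restrict_space borel {0..T / ?\<tau>} \<Otimes>\<^sub>M M"
    by measurable
  from borel_measurable_times[OF borel_measurable_const measurable_compose[OF this Yf], of "\<epsilon> powr (1/2)"]
  show "(\<lambda>(t, \<omega>). renormalize \<epsilon> Y t \<omega> f) \<in> borel_measurable (restrict_space borel {0..T} \<Otimes>\<^sub>M M)"
    by (simp only: renormalize_def split_beta' fst_conv snd_conv)
qed

text \<open>The \<epsilon> from the squared prefactor meets the 1/\<epsilon> from the dilated norm,
  so the constant K is unchanged.\<close>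

lemma usc_process_renormalize:
  assumes e: "\<epsilon> > 0" and Y: "usc_process M (T / \<epsilon> powr (3/2)) Y"
  shows "usc_process M T (renormalize \<epsilon> Y)"
proof -
  let ?\<tau> = "\<epsilon> powr (3/2)"
  obtain K where K: "\<And>f t. schwartz f \<Longrightarrow> t \<in> {0..T / ?\<tau>} \<Longrightarrow>
      (\<integral>\<^sup>+\<omega>. ennreal ((Y t \<omega> f)\<^sup>2) \<partial>M) \<le> ennreal (K * L2_norm_sq f)"
    using Y unfolding usc_process_def by blast
  have "(\<integral>\<^sup>+\<omega>. ennreal ((renormalize \<epsilon> Y t \<omega> f)\<^sup>2) \<partial>M) \<le> ennreal (K * L2_norm_sq f)"
    if f: "schwartz f" and t: "t \<in> {0..T}" for f t
  proof -
    have "(\<integral>\<^sup>+\<omega>. ennreal ((renormalize \<epsilon> Y t \<omega> f)\<^sup>2) \<partial>M)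
        = ennreal \<epsilon> * (\<integral>\<^sup>+\<omega>. ennreal ((Y (t / ?\<tau>) \<omega> (\<lambda>x. f (\<epsilon> * x)))\<^sup>2) \<partial>M)"
      unfolding renormalize_def using e by (subst nn_integral_square_cmult) (simp_all add: powr_half_power)
    also have "\<dots> \<le> ennreal \<epsilon> * ennreal (K * (L2_norm_sq f / \<epsilon>))"
      using K[OF schwartz_scale[OF f] divide_mem_scaled_interval[OF t], of \<epsilon>] e
      by (intro mult_left_mono) (simp_all add: L2_norm_sq_scale)
    also have "\<dots> = ennreal (K * L2_norm_sq f)"
      using e by (simp add: ennreal_mult'[symmetric])
    finally show ?thesis .
  qed
  then show ?thesis unfolding usc_process_def by blast
qed

text \<open>Dilating the mollifier of scale \<delta> centred at x by \<epsilon> gives 1/\<epsilon>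
  times the mollifier of scale \<delta>/\<epsilon> centred at x/\<epsilon>. Hence the explicit
  family, with \<epsilon>^(1/2) from the process and 1/\<epsilon> from the mollifier.\<close>

lemma mollification_renormalize:
  assumes e: "\<epsilon> > 0" and Y: "distribution_process M (T / \<epsilon> powr (3/2)) Y"
    and V: "mollification M (T / \<epsilon> powr (3/2)) h Y V"
  shows "mollification M T h (renormalize \<epsilon> Y)
    (\<lambda>\<delta> s x \<omega>. \<epsilon> powr (1/2) * (1 / \<epsilon>) * V (\<delta> / \<epsilon>) (s / \<epsilon> powr (3/2)) (x / \<epsilon>) \<omega>)"
  unfolding mollification_def
proof (intro conjI ballI allI impI)
  let ?\<tau> = "\<epsilon> powr (3/2)"
  have \<tau>: "?\<tau> > 0" using e by simp
  fix \<delta> :: real assume d: "0 < \<delta>"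
  then have de: "0 < \<delta> / \<epsilon>" using e by simp
  note V = V[unfolded mollification_def, rule_format, OF de]
  note [measurable] = measurable_divide_scaled_interval[OF \<tau>, of T]
  have "(\<lambda>p. (fst p / ?\<tau>, fst (snd p) / \<epsilon>, snd (snd p))) \<in> restrict_space borel {0..T} \<Otimes>\<^sub>M (borel \<Otimes>\<^sub>M M)
      \<rightarrow>\<^sub>M restrict_space borel {0..T / ?\<tau>} \<Otimes>\<^sub>M (borel \<Otimes>\<^sub>M M)"
    by measurable
  from borel_measurable_times[OF borel_measurable_const measurable_compose[OF this V[THEN conjunct1]],
      of "\<epsilon> powr (1/2) * (1 / \<epsilon>)"]
  show "(\<lambda>(s, x, \<omega>). \<epsilon> powr (1/2) * (1 / \<epsilon>) * V (\<delta> / \<epsilon>) (s / ?\<tau>) (x / \<epsilon>) \<omega>)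
      \<in> borel_measurable (restrict_space borel {0..T} \<Otimes>\<^sub>M (borel \<Otimes>\<^sub>M M))"
    by (simp only: split_beta' fst_conv snd_conv)
  fix s x assume "s \<in> {0..T}"
  then have s: "s / ?\<tau> \<in> {0..T / ?\<tau>}" by (rule divide_mem_scaled_interval[OF _ \<tau>])
  have "\<forall>\<omega>\<in>space M. tempered_distribution (Y (s / ?\<tau>) \<omega>)"
    using Y s unfolding distribution_process_def by blast
  from L2_extension_scale[OF this V[THEN conjunct2, rule_format, OF s, of "x / \<epsilon>"] e, of "\<epsilon> powr (1/2)" "1 / \<epsilon>"]
  have "L2_extension M (renormalize \<epsilon> Y s)
     (\<lambda>z. 1 / \<epsilon> * (h ((z / \<epsilon> - x / \<epsilon>) / (\<delta> / \<epsilon>)) / (\<delta> / \<epsilon>)))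
     (\<lambda>\<omega>. \<epsilon> powr (1/2) * (1 / \<epsilon>) * V (\<delta> / \<epsilon>) (s / ?\<tau>) (x / \<epsilon>) \<omega>)"
    using e by (simp add: renormalize_def[abs_def])
  moreover have "1 / \<epsilon> * (h ((z / \<epsilon> - x / \<epsilon>) / (\<delta> / \<epsilon>)) / (\<delta> / \<epsilon>)) = h ((z - x) / \<delta>) / \<delta>" for z
  proof -
    have "(z / \<epsilon> - x / \<epsilon>) / (\<delta> / \<epsilon>) = (z - x) / \<delta>"
      using e d by (simp add: field_simps)
    then have "h ((z / \<epsilon> - x / \<epsilon>) / (\<delta> / \<epsilon>)) = h ((z - x) / \<delta>)" by (rule arg_cong)
    then show ?thesis using e by simp
  qed
  ultimately show "L2_extension M (renormalize \<epsilon> Y s) (\<lambda>z. h ((z - x) / \<delta>) / \<delta>)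
     (\<lambda>\<omega>. \<epsilon> powr (1/2) * (1 / \<epsilon>) * V (\<delta> / \<epsilon>) (s / ?\<tau>) (x / \<epsilon>) \<omega>)"
    by (simp only:)
qed

text \<open>The squared prefactor is 1/\<epsilon>, the space variable contributes \<epsilon>, the
  derivative of f is \<tau>/\<epsilon> times that of its rescaling, and time contributes \<tau>:
  altogether \<tau>^2/\<epsilon> = \<epsilon>^2 for \<tau> = \<epsilon>^(3/2).\<close>

lemma energy_field_renormalize:
  assumes e: "\<epsilon> > 0" and f: "\<And>r. r \<in> {s..t} \<Longrightarrow> schwartz (f r)"
  shows "energy_field (\<lambda>\<delta> s x \<omega>. \<epsilon> powr (1/2) * (1 / \<epsilon>) * V (\<delta> / \<epsilon>) (s / \<epsilon> powr (3/2)) (x / \<epsilon>) \<omega>) \<delta> s t f \<omega>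
    = \<epsilon>\<^sup>2 * energy_field V (\<delta> / \<epsilon>) (s / \<epsilon> powr (3/2)) (t / \<epsilon> powr (3/2))
        (\<lambda>u x. f (\<epsilon> powr (3/2) * u) (\<epsilon> * x) / \<epsilon> powr (3/2)) \<omega>"
proof -
  define \<tau> where "\<tau> = \<epsilon> powr (3/2)"
  have \<tau>: "\<tau> > 0" using e by (simp add: \<tau>_def)
  define W where "W u y = V (\<delta> / \<epsilon>) u y \<omega>" for u y
  define G where "G u = (LBINT y. (W u y)\<^sup>2 * deriv (\<lambda>x. f (\<tau> * u) (\<epsilon> * x) / \<tau>) y)" for u
  have inner: "(LBINT x. (\<epsilon> powr (1/2) * (1 / \<epsilon>) * W (r / \<tau>) (x / \<epsilon>))\<^sup>2 * deriv (f r) x) = \<tau> / \<epsilon> * G (r / \<tau>)"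
    if r: "r \<in> {s..t}" for r
  proof -
    have b: "(\<epsilon> powr (1/2) * (1 / \<epsilon>))\<^sup>2 = 1 / \<epsilon>"
      unfolding power_mult_distrib powr_half_power(1)[OF e] using e by (simp add: power2_eq_square)
    have "(LBINT x. (\<epsilon> powr (1/2) * (1 / \<epsilon>) * W (r / \<tau>) (x / \<epsilon>))\<^sup>2 * deriv (f r) x)
      = (LBINT x. 1 / \<epsilon> * ((W (r / \<tau>) (x / \<epsilon>))\<^sup>2 * deriv (f r) x))"
      unfolding power_mult_distrib[of "\<epsilon> powr (1/2) * (1 / \<epsilon>)"] b by (simp add: mult.assoc)
    also have "\<dots> = \<epsilon> * (LBINT y. 1 / \<epsilon> * ((W (r / \<tau>) y)\<^sup>2 * deriv (f r) (\<epsilon> * y)))"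
      using lborel_integral_real_affine[of \<epsilon> "\<lambda>x. 1 / \<epsilon> * ((W (r / \<tau>) (x / \<epsilon>))\<^sup>2 * deriv (f r) x)" 0] e
      by simp
    also have "\<dots> = (LBINT y. (W (r / \<tau>) y)\<^sup>2 * deriv (f r) (\<epsilon> * y))"
      using e by simp
    also have "\<dots> = (LBINT y. \<tau> / \<epsilon> * ((W (r / \<tau>) y)\<^sup>2 * (\<epsilon> * deriv (f r) (\<epsilon> * y) / \<tau>)))"
      by (intro Bochner_Integration.integral_cong refl) (use e \<tau> in simp)
    also have "\<dots> = \<tau> / \<epsilon> * (LBINT y. (W (r / \<tau>) y)\<^sup>2 * (\<epsilon> * deriv (f r) (\<epsilon> * y) / \<tau>))"
      by (rule integral_mult_right_zero)
    also have "(LBINT y. (W (r / \<tau>) y)\<^sup>2 * (\<epsilon> * deriv (f r) (\<epsilon> * y) / \<tau>)) = G (r / \<tau>)"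
      using \<tau> by (simp add: G_def deriv_scale_divide[OF f[OF r]])
    finally show ?thesis .
  qed
  have "energy_field (\<lambda>\<delta> s x \<omega>. \<epsilon> powr (1/2) * (1 / \<epsilon>) * V (\<delta> / \<epsilon>) (s / \<tau>) (x / \<epsilon>) \<omega>) \<delta> s t f \<omega>
      = \<tau> / \<epsilon> * \<tau> * (LBINT u:{s / \<tau>..t / \<tau>}. G u)"
    unfolding energy_field_def
    by (rule set_lborel_integral_time_change[where G = G, OF \<tau>]) (use inner in \<open>simp add: W_def\<close>)
  also have "\<tau> / \<epsilon> * \<tau> = \<tau>\<^sup>2 / \<epsilon>" by (simp add: power2_eq_square)
  also have "\<tau>\<^sup>2 / \<epsilon> = \<epsilon>\<^sup>2"
    unfolding \<tau>_def powr_half_power(2)[OF e] using e by (simp add: power2_eq_square power3_eq_cube)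
  finally show ?thesis
    by (simp add: \<tau>_def energy_field_def G_def W_def)
qed

text \<open>The constant may depend on the renormalization parameter, so only the linear dependence
  on the scale and the power \<beta> of the time interval have to survive.\<close>

lemma (in prob_space) energy_estimate_renormalize:
  assumes e: "\<epsilon> > 0" and h: "mollifier h"
    and w: "\<And>r. r \<in> {0..T / \<epsilon> powr (3/2)} \<Longrightarrow> white_noise M v (Y r)"
    and V: "mollification M (T / \<epsilon> powr (3/2)) h Y V" and EE: "energy_estimate M (T / \<epsilon> powr (3/2)) V"
  shows "energy_estimate M T
    (\<lambda>\<delta> s x \<omega>. \<epsilon> powr (1/2) * (1 / \<epsilon>) * V (\<delta> / \<epsilon>) (s / \<epsilon> powr (3/2)) (x / \<epsilon>) \<omega>)"
proof -
  define \<tau> where "\<tau> = \<epsilon> powr (3/2)"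
  have \<tau>: "\<tau> > 0" using e by (simp add: \<tau>_def)
  obtain \<kappa> \<beta> where \<kappa>: "\<kappa> > 0" and \<beta>: "\<beta> \<in> {0<..<1}" and
    E: "\<And>f \<eta> \<delta> s t. schwartz f \<Longrightarrow> 0 < \<delta> \<Longrightarrow> \<delta> < \<eta> \<Longrightarrow> 0 \<le> s \<Longrightarrow> s < t \<Longrightarrow> t \<le> T / \<tau> \<Longrightarrow>
    (\<integral>\<^sup>+\<omega>. ennreal ((energy_field V \<eta> s t (\<lambda>_. f) \<omega> - energy_field V \<delta> s t (\<lambda>_. f) \<omega>)\<^sup>2) \<partial>M)
      \<le> ennreal (\<kappa> * \<eta> * (t - s) powr \<beta> * L2_norm_sq (deriv f))"
    using energy_estimate_all_scales[OF h w V EE] unfolding \<tau>_def by blast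
  let ?V = "\<lambda>\<delta> s x \<omega>. \<epsilon> powr (1/2) * (1 / \<epsilon>) * V (\<delta> / \<epsilon>) (s / \<tau>) (x / \<epsilon>) \<omega>"
  \<comment> \<open>\<epsilon>^4 from the squared field, 1/\<epsilon> from the scale
    \<eta>/\<epsilon>, \<tau>^(-\<beta>) from the time interval and \<epsilon>^(-2) from the squared
    norm of the derivative of g combine to this constant.\<close>
  define \<kappa>' where "\<kappa>' = \<epsilon> * \<kappa> / \<tau> powr \<beta>"
  have "(\<integral>\<^sup>+\<omega>. ennreal ((energy_field ?V \<eta> s t (\<lambda>_. f) \<omega> - energy_field ?V \<delta> s t (\<lambda>_. f) \<omega>)\<^sup>2) \<partial>M)
      \<le> ennreal (\<kappa>' * \<eta> * (t - s) powr \<beta> * L2_norm_sq (deriv f))"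
    if f: "schwartz f" and d: "0 < \<delta>" "\<delta> < \<eta>" and st: "0 \<le> s" "s < t" "t \<le> T" for f \<eta> \<delta> s t
  proof -
    define g where "g x = f (\<epsilon> * x) / \<tau>" for x
    have g: "schwartz g"
      using schwartz_divide[OF schwartz_scale[OF f], of \<epsilon> \<tau>] e by (simp add: g_def[abs_def])
    have "energy_field ?V \<delta> s t (\<lambda>_. f) \<omega> = \<epsilon>\<^sup>2 * energy_field V (\<delta> / \<epsilon>) (s / \<tau>) (t / \<tau>) (\<lambda>_. g) \<omega>" for \<delta> \<omega>
      using energy_field_renormalize[OF e, of s t "\<lambda>_. f" V \<delta> \<omega>] f by (simp add: \<tau>_def g_def[abs_def])
    then have "(\<integral>\<^sup>+\<omega>. ennreal ((energy_field ?V \<eta> s t (\<lambda>_. f) \<omega> - energy_field ?V \<delta> s t (\<lambda>_. f) \<omega>)\<^sup>2) \<partial>M)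
      = ennreal (\<epsilon> ^ 4) * (\<integral>\<^sup>+\<omega>. ennreal ((energy_field V (\<eta> / \<epsilon>) (s / \<tau>) (t / \<tau>) (\<lambda>_. g) \<omega>
          - energy_field V (\<delta> / \<epsilon>) (s / \<tau>) (t / \<tau>) (\<lambda>_. g) \<omega>)\<^sup>2) \<partial>M)"
      using e by (simp add: right_diff_distrib[symmetric] nn_integral_square_cmult power_mult[symmetric])
    also have "\<dots> \<le> ennreal (\<epsilon> ^ 4) * ennreal (\<kappa> * (\<eta> / \<epsilon>) * (t / \<tau> - s / \<tau>) powr \<beta> * L2_norm_sq (deriv g))"
      using d st e \<tau> by (intro mult_left_mono E g) (auto simp: divide_strict_right_mono divide_right_mono)
    also have "\<dots> = ennreal (\<epsilon> ^ 4 * (\<kappa> * (\<eta> / \<epsilon>) * (t / \<tau> - s / \<tau>) powr \<beta> * L2_norm_sq (deriv g)))"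
      by (rule ennreal_mult'[symmetric]) simp
    also have "\<epsilon> ^ 4 * (\<kappa> * (\<eta> / \<epsilon>) * (t / \<tau> - s / \<tau>) powr \<beta> * L2_norm_sq (deriv g))
        = \<kappa>' * \<eta> * (t - s) powr \<beta> * L2_norm_sq (deriv f)"
    proof -
      have "L2_norm_sq (deriv g) = (\<epsilon> / \<tau>)\<^sup>2 * L2_norm_sq (\<lambda>x. deriv f (\<epsilon> * x))"
        unfolding g_def[abs_def] L2_norm_sq_def deriv_scale_divide[OF f]
        by (simp add: power_mult_distrib power_divide)
      also have "\<dots> = \<epsilon> / \<tau>\<^sup>2 * L2_norm_sq (deriv f)"
        unfolding L2_norm_sq_scale[OF e] using e by (simp add: power_divide power2_eq_square)
      also have "\<tau>\<^sup>2 = \<epsilon> ^ 3" using e by (simp add: \<tau>_def powr_half_power)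
      finally have 1: "L2_norm_sq (deriv g) = \<epsilon> / \<epsilon> ^ 3 * L2_norm_sq (deriv f)" .
      have 2: "(t / \<tau> - s / \<tau>) powr \<beta> = (t - s) powr \<beta> / \<tau> powr \<beta>"
        using st \<tau> by (simp add: diff_divide_distrib[symmetric] powr_divide)
      show ?thesis
        unfolding 1 2 \<kappa>'_def using e \<tau> by (simp add: field_simps power_numeral_reduce)
    qed
    finally show ?thesis .
  qed
  moreover have "\<kappa>' > 0" using \<kappa> e \<tau> by (simp add: \<kappa>'_def)
  ultimately show ?thesis
    unfolding energy_estimate_def \<tau>_def[symmetric] using \<beta> by blast
qed

text \<open>A trajectory \<open>f\<close> on \<open>[0,T]\<close> is tested through \<open>g\<^sub>u(x) = f\<^bsub>\<tau>u\<^esub>(\<epsilon>x) / \<tau>\<close> with \<open>\<tau> = \<epsilon>\<^bsup>3/2\<^esup>\<close>. The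
  factor \<open>1/\<tau>\<close> makes \<open>\<L>\<^sup>\<rho> g\<^sub>u\<close> equal to \<open>\<L>\<^sup>\<rho> f\<^bsub>\<tau>u\<^esub>\<close> at \<open>\<epsilon>x\<close>, so that linearity of the process is only
  ever used on Schwartz functions. Every term of the martingale is then multiplied by
  \<open>\<epsilon>\<^bsup>1/2\<^esup> \<tau> = \<epsilon>\<^sup>2\<close>.\<close>

lemma (in prob_space) energy_martingale_problem_renormalize:
  assumes e: "\<epsilon> > 0" and Y: "distribution_process M (T / \<epsilon> powr (3/2)) Y"
    and w: "\<And>r. r \<in> {0..T / \<epsilon> powr (3/2)} \<Longrightarrow> white_noise M v (Y r)"
    and MP: "energy_martingale_problem M (3/2) cp cm \<rho> m (T / \<epsilon> powr (3/2)) Y V"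
  shows "energy_martingale_problem M (3/2) cp cm \<rho> m T (renormalize \<epsilon> Y)
    (\<lambda>\<delta> s x \<omega>. \<epsilon> powr (1/2) * (1 / \<epsilon>) * V (\<delta> / \<epsilon>) (s / \<epsilon> powr (3/2)) (x / \<epsilon>) \<omega>)"
  unfolding energy_martingale_problem_def
proof (intro allI impI)
  fix f f' assume tr: "schwartz_trajectory T f f'"
  define \<tau> where "\<tau> = \<epsilon> powr (3/2)"
  have \<tau>: "\<tau> > 0" using e by (simp add: \<tau>_def)
  define a where "a = \<epsilon> powr (1/2)"
  define c where "c = \<epsilon>\<^sup>2"
  have c: "c \<noteq> 0" and a: "a * \<tau> = c" "a\<^sup>2 = \<epsilon>" "\<tau>\<^sup>2 = \<epsilon> ^ 3"
    using e by (simp_all add: c_def a_def \<tau>_def powr_half_power)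
  define g where "g u x = f (\<tau> * u) (\<epsilon> * x) / \<tau>" for u x
  define g' where "g' u x = f' (\<tau> * u) (\<epsilon> * x)" for u x
  let ?V = "\<lambda>\<delta> s x \<omega>. \<epsilon> powr (1/2) * (1 / \<epsilon>) * V (\<delta> / \<epsilon>) (s / \<tau>) (x / \<epsilon>) \<omega>"
  let ?Y = "renormalize \<epsilon> Y"
  have sf: "schwartz (f t)" "schwartz (f' t)" if "t \<in> {0..T}" for t
    using tr that by (auto simp: schwartz_trajectory_def)
  have mem: "t / \<tau> \<in> {0..T / \<tau>}" if "t \<in> {0..T}" for t
    using that \<tau> by (rule divide_mem_scaled_interval)
  have R: "?Y t \<omega> \<phi> = a * Y (t / \<tau>) \<omega> (\<lambda>x. \<phi> (\<epsilon> * x))" for t \<omega> \<phi>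
    by (simp add: renormalize_def a_def \<tau>_def)
  have "schwartz_trajectory (T / \<tau>) g g'"
    using schwartz_trajectory_scale[OF tr e \<tau>] by (simp add: g_def[abs_def] g'_def[abs_def])
  with MP obtain I A where
    I: "\<And>t. t \<in> {0..T / \<tau>} \<Longrightarrow> L2_lim M
         (\<lambda>\<delta> \<omega>. LBINT s:{0..t}. Y s \<omega> (\<lambda>x. gauss_cutoff \<delta> x * levy_op (3/2) cp cm \<rho> (g s) x)) (I t) (at_right 0)"
    and Ic: "continuous_paths M (T / \<tau>) I"
    and A: "\<And>t. t \<in> {0..T / \<tau>} \<Longrightarrow> L2_lim M (\<lambda>\<delta>. energy_field V \<delta> 0 t g) (A t) (at_right 0)"
    and Ac: "continuous_paths M (T / \<tau>) A"
    and N: "let N = (\<lambda>t \<omega>. Y t \<omega> (g t) - Y 0 \<omega> (g 0) - ((LBINT s:{0..t}. Y s \<omega> (g' s)) + I t \<omega>) + m * A t \<omega>)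
       in martingale_on M (process_filtration M Y) (T / \<tau>) N \<and> continuous_paths M (T / \<tau>) N \<and>
          quadratic_variation M (T / \<tau>) N (\<lambda>t. 2 * \<rho> * (1 - \<rho>) *
             (LBINT s:{0..t}. L2_inner (g s) (\<lambda>x. - levy_op (3/2) cp cm (1/2) (g s) x)))"
    unfolding energy_martingale_problem_def \<tau>_def by blast
  define I' where "I' t \<omega> = c * I (t / \<tau>) \<omega>" for t \<omega>
  define A' where "A' t \<omega> = c * A (t / \<tau>) \<omega>" for t \<omega>
  have levy: "levy_op (3/2) cp cm \<sigma> (g (s / \<tau>)) x = levy_op (3/2) cp cm \<sigma> (f s) (\<epsilon> * x)"
    if "s \<in> {0..T}" for s \<sigma> x
    using levy_op_scale[OF sf(1)[OF that] e, of "3/2" cp cm \<sigma> x] \<tau> by (simp add: g_def[abs_def] \<tau>_def)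
  have I'lim: "L2_lim M (\<lambda>\<delta> \<omega>. LBINT s:{0..t}. ?Y s \<omega> (\<lambda>x. gauss_cutoff \<delta> x * levy_op (3/2) cp cm \<rho> (f s) x))
      (I' t) (at_right 0)" if t: "t \<in> {0..T}" for t
  proof -
    let ?J = "\<lambda>\<delta> u \<omega>. Y u \<omega> (\<lambda>x. gauss_cutoff \<delta> x * levy_op (3/2) cp cm \<rho> (g u) x)"
    have "(LBINT s:{0..t}. ?Y s \<omega> (\<lambda>x. gauss_cutoff \<delta> x * levy_op (3/2) cp cm \<rho> (f s) x))
      = c * (LBINT u:{0..t / \<tau>}. ?J (\<epsilon> * \<delta>) u \<omega>)" for \<delta> \<omega>
    proof -
      \<comment> \<open>Dilation turns the cutoff parameter \<delta> into \<epsilon> \<delta>, which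
        still tends to 0 from the right, so the limit defining the drift is the given one.\<close>
      have "gauss_cutoff (\<epsilon> * \<delta>) x = gauss_cutoff \<delta> (\<epsilon> * x)" for x
        by (simp add: gauss_cutoff_def power_mult_distrib mult_ac)
      then have "?Y s \<omega> (\<lambda>x. gauss_cutoff \<delta> x * levy_op (3/2) cp cm \<rho> (f s) x)
          = a * ?J (\<epsilon> * \<delta>) (s / \<tau>) \<omega>" if "s \<in> {0..t}" for s
        using that t by (simp add: R levy)
      from set_lborel_integral_time_change[of \<tau> 0 t
          "\<lambda>s. ?Y s \<omega> (\<lambda>x. gauss_cutoff \<delta> x * levy_op (3/2) cp cm \<rho> (f s) x)" a "\<lambda>u. ?J (\<epsilon> * \<delta>) u \<omega>",
          OF \<tau> this]
      show ?thesis by (simp only: a(1) div_0)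
    qed
    then show ?thesis
      using L2_lim_cmult[OF c L2_lim_compose[OF I[OF mem[OF t]] filterlim_cmult_at_right_0[OF e]]]
      by (simp add: I'_def[abs_def])
  qed
  have A'lim: "L2_lim M (\<lambda>\<delta>. energy_field ?V \<delta> 0 t f) (A' t) (at_right 0)" if t: "t \<in> {0..T}" for t
  proof -
    \<comment> \<open>The mollification scale becomes \<delta>/\<epsilon>, written as a product so
      that the limit at 0 from the right composes with a linear map.\<close>
    have eq: "(\<lambda>\<delta>. energy_field ?V \<delta> 0 t f) = (\<lambda>\<delta> \<omega>. c * energy_field V (1 / \<epsilon> * \<delta>) 0 (t / \<tau>) g \<omega>)"
    proof (intro ext)
      fix \<delta> \<omega>
      show "energy_field ?V \<delta> 0 t f \<omega> = c * energy_field V (1 / \<epsilon> * \<delta>) 0 (t / \<tau>) g \<omega>"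
        using energy_field_renormalize[OF e, of 0 t f V \<delta> \<omega>] sf t
        by (simp add: \<tau>_def[symmetric] c_def g_def[abs_def])
    qed
    have "0 < 1 / \<epsilon>" using e by simp
    from L2_lim_cmult[OF c L2_lim_compose[OF A[OF mem[OF t]] filterlim_cmult_at_right_0[OF this]]]
    show ?thesis
      unfolding eq by (simp only: A'_def[abs_def])
  qed
  define N where "N t \<omega> = Y t \<omega> (g t) - Y 0 \<omega> (g 0) - ((LBINT s:{0..t}. Y s \<omega> (g' s)) + I t \<omega>) + m * A t \<omega>" for t \<omega>
  define N' where "N' t \<omega> = ?Y t \<omega> (f t) - ?Y 0 \<omega> (f 0) - ((LBINT s:{0..t}. ?Y s \<omega> (f' s)) + I' t \<omega>) + m * A' t \<omega>" for t \<omega>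
  have N'N: "N' t \<omega> = c * N (t / \<tau>) \<omega>" if t: "t \<in> {0..T}" and \<omega>: "\<omega> \<in> space M" for t \<omega>
  proof -
    \<comment> \<open>Here linearity of the process enters: f at time s, dilated, is \<tau> times g
      at time s/\<tau>, which turns the prefactor \<epsilon>^(1/2) into c.\<close>
    have Yf: "?Y s \<omega> (f s) = c * Y (s / \<tau>) \<omega> (g (s / \<tau>))" if s: "s \<in> {0..T}" for s
    proof -
      have "tempered_distribution (Y (s / \<tau>) \<omega>)"
        using Y[folded \<tau>_def, unfolded distribution_process_def, THEN conjunct1] \<omega> mem[OF s] by blast
      from tempered_distribution_divide[OF this schwartz_scale[OF sf(1)[OF s]], of \<epsilon> \<tau>]
      have "Y (s / \<tau>) \<omega> (g (s / \<tau>)) = Y (s / \<tau>) \<omega> (\<lambda>x. f s (\<epsilon> * x)) / \<tau>"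
        using e \<tau> by (simp add: g_def[abs_def])
      then show ?thesis using \<tau> by (simp add: R a(1)[symmetric])
    qed
    have "?Y s \<omega> (f' s) = a * Y (s / \<tau>) \<omega> (g' (s / \<tau>))" for s
      using \<tau> by (simp add: R g'_def[abs_def])
    from set_lborel_integral_time_change[of \<tau> 0 t "\<lambda>s. ?Y s \<omega> (f' s)" a "\<lambda>u. Y u \<omega> (g' u)", OF \<tau> this]
    have F': "(LBINT s:{0..t}. ?Y s \<omega> (f' s)) = c * (LBINT u:{0..t / \<tau>}. Y u \<omega> (g' u))"
      by (simp only: a(1) div_0)
    have "0 \<in> {0..T}" using t by simp
    note Y0 = Yf[OF this, unfolded div_0]
    show ?thesis
      unfolding N'_def N_def I'_def A'_def F' Yf[OF t] Y0
      by (simp only: right_diff_distrib distrib_left mult.left_commute[of c m])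
  qed
  have QV: "2 * \<rho> * (1 - \<rho>) * (LBINT s:{0..t}. L2_inner (f s) (\<lambda>x. - levy_op (3/2) cp cm (1/2) (f s) x))
    = c\<^sup>2 * (2 * \<rho> * (1 - \<rho>) * (LBINT s:{0..t / \<tau>}. L2_inner (g s) (\<lambda>x. - levy_op (3/2) cp cm (1/2) (g s) x)))"
    if t: "t \<in> {0..T}" for t
  proof -
    define G where "G u = L2_inner (g u) (\<lambda>x. - levy_op (3/2) cp cm (1/2) (g u) x)" for u
    \<comment> \<open>The space variable gives \<epsilon>. The operator applied to g already matches
      that applied to f, so \<tau> arises once here, from f = \<tau> g, and once more from the time
      integral, making c^2 in total.\<close>
    have fG: "L2_inner (f s) (\<lambda>x. - levy_op (3/2) cp cm (1/2) (f s) x) = \<tau> * \<epsilon> * G (s / \<tau>)"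
      if s: "s \<in> {0..T}" for s
    proof -
      have "L2_inner (f s) (\<lambda>x. - levy_op (3/2) cp cm (1/2) (f s) x)
        = \<epsilon> * (LBINT x. f s (\<epsilon> * x) * - levy_op (3/2) cp cm (1/2) (f s) (\<epsilon> * x))"
        unfolding L2_inner_def
        using lborel_integral_real_affine[of \<epsilon> "\<lambda>x. f s x * - levy_op (3/2) cp cm (1/2) (f s) x" 0] e
        by simp
      also have "(\<lambda>x. f s (\<epsilon> * x) * - levy_op (3/2) cp cm (1/2) (f s) (\<epsilon> * x))
        = (\<lambda>x. \<tau> * (g (s / \<tau>) x * - levy_op (3/2) cp cm (1/2) (g (s / \<tau>)) x))"
        using \<tau> by (simp add: levy[OF s]) (simp add: g_def)
      also have "(LBINT x. \<tau> * (g (s / \<tau>) x * - levy_op (3/2) cp cm (1/2) (g (s / \<tau>)) x)) = \<tau> * G (s / \<tau>)"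
        unfolding G_def L2_inner_def by (rule integral_mult_right_zero)
      finally show ?thesis by (simp only: mult_ac)
    qed
    have "s \<in> {0..T}" if "s \<in> {0..t}" for s using that t by simp
    from set_lborel_integral_time_change[of \<tau> 0 t
        "\<lambda>s. L2_inner (f s) (\<lambda>x. - levy_op (3/2) cp cm (1/2) (f s) x)" "\<tau> * \<epsilon>" G, OF \<tau> fG[OF this]]
    have "(LBINT s:{0..t}. L2_inner (f s) (\<lambda>x. - levy_op (3/2) cp cm (1/2) (f s) x))
      = \<tau> * \<epsilon> * \<tau> * (LBINT u:{0..t / \<tau>}. G u)"
      by (simp only: div_0)
    moreover have "\<tau> * \<epsilon> * \<tau> = c\<^sup>2"
    proof -
      have "\<tau> * \<epsilon> * \<tau> = \<tau>\<^sup>2 * \<epsilon>" by (simp add: power2_eq_square)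
      then show ?thesis unfolding a(3) c_def by (simp add: power_numeral_reduce)
    qed
    ultimately show ?thesis by (simp only: G_def mult.left_commute[of "2 * \<rho> * (1 - \<rho>)" "c\<^sup>2"])
  qed
  have filt: "process_filtration M ?Y t = process_filtration M Y (t / \<tau>)" for t
    unfolding \<tau>_def by (rule process_filtration_renormalize[OF e])
  \<comment> \<open>Conditional expectations require sub-\<sigma>-algebras of M. Evaluations are
    random variables here because they are centered Gaussian at each time.\<close>
  have sub: "subalgebra M (process_filtration M Y t)" if "t \<in> {0..T / \<tau>}" for t
  proof (rule subalgebra_process_filtration)
    fix s f assume "s \<in> {0..t}" and \<phi>: "schwartz f"
    then have "s \<in> {0..T / \<tau>}" using that by auto
    from white_noise_measurable[OF w[folded \<tau>_def, OF this] \<phi>]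
    show "(\<lambda>\<omega>. Y s \<omega> f) \<in> borel_measurable M" .
  qed
  have Nm: "martingale_on M (process_filtration M Y) (T / \<tau>) N" and Nc: "continuous_paths M (T / \<tau>) N"
    and Nq: "quadratic_variation M (T / \<tau>) N (\<lambda>t. 2 * \<rho> * (1 - \<rho>) *
             (LBINT s:{0..t}. L2_inner (g s) (\<lambda>x. - levy_op (3/2) cp cm (1/2) (g s) x)))"
    using N unfolding Let_def N_def[abs_def] by blast+
  have N'm: "martingale_on M (process_filtration M ?Y) T N'"
    by (rule martingale_on_rescale[OF Nm \<tau> sub N'N filt])
  have N'c: "continuous_paths M T N'"
    by (rule continuous_paths_rescale[OF Nc \<tau> N'N])
  have N'q: "quadratic_variation M T N' (\<lambda>t. 2 * \<rho> * (1 - \<rho>) *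
             (LBINT s:{0..t}. L2_inner (f s) (\<lambda>x. - levy_op (3/2) cp cm (1/2) (f s) x)))"
    by (rule quadratic_variation_rescale[OF Nq \<tau> c N'N QV])
  have I'c: "continuous_paths M T I'"
    by (rule continuous_paths_rescale[OF Ic \<tau> I'_def])
  have A'c: "continuous_paths M T A'"
    by (rule continuous_paths_rescale[OF Ac \<tau> A'_def])
  show "\<exists>I A.
      (\<forall>t\<in>{0..T}. L2_lim M (\<lambda>\<delta> \<omega>. LBINT s:{0..t}. ?Y s \<omega>
          (\<lambda>x. gauss_cutoff \<delta> x * levy_op (3/2) cp cm \<rho> (f s) x)) (I t) (at_right 0)) \<and>
      continuous_paths M T I \<and>
      (\<forall>t\<in>{0..T}. L2_lim M (\<lambda>\<delta>. energy_field
        (\<lambda>\<delta> s x \<omega>. \<epsilon> powr (1/2) * (1 / \<epsilon>) * V (\<delta> / \<epsilon>) (s / \<epsilon> powr (3/2)) (x / \<epsilon>) \<omega>) \<delta> 0 t f) (A t) (at_right 0)) \<and>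
      continuous_paths M T A \<and>
      (let N = (\<lambda>t \<omega>. ?Y t \<omega> (f t) - ?Y 0 \<omega> (f 0) - ((LBINT s:{0..t}. ?Y s \<omega> (f' s)) + I t \<omega>) + m * A t \<omega>)
       in martingale_on M (process_filtration M ?Y) T N \<and> continuous_paths M T N \<and>
          quadratic_variation M T N (\<lambda>t. 2 * \<rho> * (1 - \<rho>) *
             (LBINT s:{0..t}. L2_inner (f s) (\<lambda>x. - levy_op (3/2) cp cm (1/2) (f s) x))))"
    unfolding \<tau>_def[symmetric] Let_def
    using N'm N'c N'q unfolding N'_def[abs_def]
    by (intro exI[of _ I'] exI[of _ A'] conjI ballI I'lim A'lim I'c A'c)
qed

section \<open>Invariance on a finite horizon and for all times\<close>

lemma (in prob_space) stationary_energy_solution_on_renormalize: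
  assumes e: "\<epsilon> > 0" and h: "mollifier h"
    and S: "stationary_energy_solution_on M (3/2) cp cm \<rho> m h (T / \<epsilon> powr (3/2)) Y"
  shows "stationary_energy_solution_on M (3/2) cp cm \<rho> m h T (renormalize \<epsilon> Y)"
proof -
  let ?\<tau> = "\<epsilon> powr (3/2)"
  have \<tau>: "?\<tau> > 0" using e by simp
  have D: "distribution_process M (T / ?\<tau>) Y" and U: "usc_process M (T / ?\<tau>) Y"
    and G: "\<And>t f. t \<in> {0..T / ?\<tau>} \<Longrightarrow> schwartz f \<Longrightarrow>
      centered_gaussian M (\<lambda>\<omega>. Y t \<omega> f) (\<rho> * (1 - \<rho>) * L2_norm_sq f)"
    using S by (auto simp: stationary_energy_solution_on_def)
  obtain V where V: "mollification M (T / ?\<tau>) h Y V" "energy_estimate M (T / ?\<tau>) V"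
    "energy_martingale_problem M (3/2) cp cm \<rho> m (T / ?\<tau>) Y V"
    using S by (auto simp: stationary_energy_solution_on_def)
  have w: "white_noise M (\<rho> * (1 - \<rho>)) (Y r)" if "r \<in> {0..T / ?\<tau>}" for r
    using D G that by (simp add: white_noise_def distribution_process_def)
  \<comment> \<open>The square of \<epsilon>^(1/2) cancels the 1/\<epsilon> of the dilated norm, so
    the white noise keeps its variance.\<close>
  have "centered_gaussian M (\<lambda>\<omega>. renormalize \<epsilon> Y t \<omega> f) (\<rho> * (1 - \<rho>) * L2_norm_sq f)"
    if t: "t \<in> {0..T}" and f: "schwartz f" for t f
    using centered_gaussian_cmult[OF G[OF divide_mem_scaled_interval[OF t \<tau>] schwartz_scale[OF f, of \<epsilon>]], of "\<epsilon> powr (1/2)"] e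
    by (simp add: renormalize_def powr_half_power L2_norm_sq_scale)
  then have G': "\<forall>t\<in>{0..T}. \<forall>f. schwartz f \<longrightarrow>
      centered_gaussian M (\<lambda>\<omega>. renormalize \<epsilon> Y t \<omega> f) (\<rho> * (1 - \<rho>) * L2_norm_sq f)"
    by blast
  note V' = mollification_renormalize[OF e D V(1)] energy_estimate_renormalize[OF e h w V(1,2)]
    energy_martingale_problem_renormalize[OF e D w V(3)]
  show ?thesis
    unfolding stationary_energy_solution_on_def
    by (intro conjI distribution_process_renormalize[OF e D] usc_process_renormalize[OF e U] G')
      (rule exI, intro conjI, (rule V'; assumption)+)
qed

theorem theorem6p1:
  fixes M :: "'w measure" and \<alpha> cp cm \<rho> m \<epsilon> :: real and h :: "real \<Rightarrow> real"
    and Y :: "real \<Rightarrow> 'w \<Rightarrow> (real \<Rightarrow> real) \<Rightarrow> real"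
  assumes "\<alpha> = 3/2" and "0 < \<rho>" and "\<rho> < 1"
    and "cp \<ge> 0" and "cm \<ge> 0" and "cp + cm > 0"
    and "prob_space M"
    and "mollifier h"
    and "stationary_energy_solution M \<alpha> cp cm \<rho> m h Y"
    and "\<epsilon> > 0"
  shows "stationary_energy_solution M \<alpha> cp cm \<rho> m h (renormalize \<epsilon> Y)"
  unfolding stationary_energy_solution_def \<open>\<alpha> = 3/2\<close>
proof (intro allI impI)
  fix T :: real assume "0 < T"
  \<comment> \<open>The original process has to be a solution up to T/\<epsilon>^(3/2), which
    exceeds T if \<epsilon> < 1; being a solution on every horizon provides this.\<close>
  then have "0 < T / \<epsilon> powr (3/2)" using \<open>\<epsilon> > 0\<close> by simp
  then have "stationary_energy_solution_on M (3/2) cp cm \<rho> m h (T / \<epsilon> powr (3/2)) Y"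
    using assms(9)[unfolded assms(1) stationary_energy_solution_def] by blast
  then show "stationary_energy_solution_on M (3/2) cp cm \<rho> m h T (renormalize \<epsilon> Y)"
    using prob_space.stationary_energy_solution_on_renormalize assms(7,8,10) by blast
qed

end
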